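(* Let $\mathcal G=\mathrm{Diff}\,\mathbb C[t,t^{-1}]$ be the Lie algebra of differential operators over $\mathbb C[t,t^{-1}]$, with center $\mathcal C_d=\mathbb C\{1\}$, and regard $\mathcal G\otimes\mathcal G$ as a $\mathcal G$-module under the diagonal adjoint action. Let $\mathcal D_d$ and $\mathcal D_d^0$ be as defined in the context. (i) $\mathrm{Der}(\mathcal G,\mathcal G\otimes\mathcal G)=\mathrm{Inn}(\mathcal G,\mathcal G\otimes\mathcal G)\oplus\mathcal D_d$ and $H^1(\mathcal G,\mathcal G\otimes\mathcal G)\cong\mathcal D_d$. (ii) Let $(\mathcal G,[\cdot,\cdot],\Delta)$ be a Lie bialgebra, and write $\Delta=\Delta_r+\sigma$ according to the decomposition in (i), where $r\in\mathcal G\otimes\mathcal G$ is taken modulo $\mathcal C_d\otimes\mathcal C_d$ and $\sigma\in\mathcal D_d$. Then $r\in\mathrm{Im}(1-\tau)$ modulo $\mathcal C_d\otimes\mathcal C_d$ and $\sigma\in\mathcal D_d^0$. Furthermore, $(\mathcal G,[\cdot,\cdot],\sigma)$ is a Lie bialgebra whenever $\sigma\in\mathcal D_d^0$. (iii) A Lie bialgebra $(\mathcal G,[\cdot,\cdot],\Delta)$ is triangular coboundary if and only if $\Delta$ is an inner derivation (and thus $\Delta=\Delta_r$, where $r\in\mathrm{Im}(1-\tau)$ is a solution of the classical Yang-Baxter equation).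
   Context: With $D=t\frac{d}{dt}$, $\mathcal G$ has $\mathbb C$-basis $\{t^mD^n\mid m\in\mathbb Z,\ n\in\mathbb Z_{\ge0}\}$ and bracket $[t^mD^n,t^{m_1}D^{n_1}]=t^{m+m_1}\left(\sum_{i=1}^n\binom ni m_1^iD^{n+n_1-i}-\sum_{j=1}^{n_1}\binom{n_1}{j}m^jD^{n+n_1-j}\right)$. For a Lie algebra $L$ and an $L$-module $M$, $\mathrm{Der}(L,M)$ is the space of linear maps $\phi:L\to M$ with $\phi([x,y])=x\cdot\phi(y)-y\cdot\phi(x)$; $\mathrm{Inn}(L,M)$ is the subspace of inner derivations $x\mapsto x\cdot v$, $v\in M$; $H^1(L,M)\cong\mathrm{Der}(L,M)/\mathrm{Inn}(L,M)$. The diagonal adjoint action on $L\otimes L$ is $x\cdot\sum_i a_i\otimes b_i=\sum_i([x,a_i]\otimes b_i+a_i\otimes[x,b_i])$. For $\alpha,\alpha^\dag\in\mathbb C$, let $\zeta_{\alpha,\alpha^\dag}:\mathcal G\to\mathcal G\otimes\mathcal G$ be the linear map (a derivation) with $\zeta_{\alpha,\alpha^\dag}(t^m)=0$ and $\zeta_{\alpha,\alpha^\dag}(t^mD^n)=\alpha n\,t^mD^{n-1}\otimes1+\alpha^\dag n\,1\otimes t^mD^{n-1}$ for $m\in\mathbb Z$, $n\ge1$. $\mathcal D_d$ is the space spanned by all $\zeta_{\alpha,\alpha^\dag}$, and $\mathcal D_d^0$ is the subspace of those $\zeta_{\alpha,\alpha^\dag}$ with $\zeta_{\alpha,\alpha^\dag}(\mathcal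 G)\subseteq\mathrm{Im}(1-\tau)$, i.e. with $\alpha=-\alpha^\dag$. $\tau(x\otimes y)=y\otimes x$ on $L\otimes L$ and $\xi(x_1\otimes x_2\otimes x_3)=x_2\otimes x_3\otimes x_1$ on $L^{\otimes3}$. A Lie bialgebra $(L,[\cdot,\cdot],\Delta)$ is a Lie algebra $(L,[\cdot,\cdot])$ with a linear map $\Delta:L\to L\otimes L$ such that $\mathrm{Im}\,\Delta\subset\mathrm{Im}(1-\tau)$, $(1+\xi+\xi^2)\cdot(1\otimes\Delta)\cdot\Delta=0$, and $\Delta([x,y])=x\cdot\Delta(y)-y\cdot\Delta(x)$. For $r\in L\otimes L$, $\Delta_r(x)=x\cdot r$. A Lie bialgebra is coboundary if $\Delta=\Delta_r$ for some $r\in\mathrm{Im}(1-\tau)$, and triangular coboundary if moreover $r=\sum_i a_i\otimes b_i$ satisfies the classical Yang-Baxter equation $\sum_{i,j}[a_i,a_j]\otimes b_i\otimes b_j+\sum_{i,j}a_i\otimes[b_i,a_j]\otimes b_j+\sum_{i,j}a_i\otimes a_j\otimes[b_i,b_j]=0$. *)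

theory Defs
  imports Complex_Main "HOL-Library.Poly_Mapping" "HOL-Library.Function_Algebras"
begin

section \<open>Complex vector spaces with a distinguished basis\<close>

text \<open>
  A complex vector space with basis indexed by \<open>'b\<close> is the type of finitely supported functions
  from \<open>'b\<close> to the complex numbers; every complex vector space is of this form up to isomorphism.
\<close>

definition vscale :: "complex \<Rightarrow> ('b \<Rightarrow>\<^sub>0 complex) \<Rightarrow> ('b \<Rightarrow>\<^sub>0 complex)" (infixr \<open>*\<^sub>v\<close> 75)
  where "c *\<^sub>v x = Poly_Mapping.map ((*) c) x"

abbreviation basis_vec :: "'b \<Rightarrow> ('b \<Rightarrow>\<^sub>0 complex)"
  where "basis_vec b \<equiv> Poly_Mapping.single b 1"

lemma lookup_vscale [simp]: "Poly_Mapping.lookup (c *\<^sub>v x) b = c * Poly_Mapping.lookup x b"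
  unfolding vscale_def by (simp add: Poly_Mapping.map.rep_eq when_def)

global_interpretation pm: vector_space vscale
  by standard (auto intro!: poly_mapping_eqI simp: lookup_add algebra_simps)

abbreviation linear_map :: "(('a \<Rightarrow>\<^sub>0 complex) \<Rightarrow> ('b \<Rightarrow>\<^sub>0 complex)) \<Rightarrow> bool"
  where "linear_map \<equiv> Vector_Spaces.linear vscale vscale"

definition bilinear_map ::
    "(('a \<Rightarrow>\<^sub>0 complex) \<Rightarrow> ('b \<Rightarrow>\<^sub>0 complex) \<Rightarrow> ('c \<Rightarrow>\<^sub>0 complex)) \<Rightarrow> bool"
  where "bilinear_map B \<longleftrightarrow> (\<forall>x. linear_map (B x)) \<and> (\<forall>y. linear_map (\<lambda>x. B x y))"

definition lin_ext :: "('a \<Rightarrow> ('b \<Rightarrow>\<^sub>0 complex)) \<Rightarrow> ('a \<Rightarrow>\<^sub>0 complex) \<Rightarrow> ('b \<Rightarrow>\<^sub>0 complex)"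
  where "lin_ext f x = (\<Sum>a\<in>Poly_Mapping.keys x. Poly_Mapping.lookup x a *\<^sub>v f a)"

definition bilin_ext ::
    "('a \<Rightarrow> 'b \<Rightarrow> ('c \<Rightarrow>\<^sub>0 complex)) \<Rightarrow> ('a \<Rightarrow>\<^sub>0 complex) \<Rightarrow> ('b \<Rightarrow>\<^sub>0 complex) \<Rightarrow> ('c \<Rightarrow>\<^sub>0 complex)"
  where "bilin_ext f x y = lin_ext (\<lambda>a. lin_ext (f a) y) x"

lemma lin_ext_superset:
  assumes "finite A" "Poly_Mapping.keys x \<subseteq> A"
  shows "lin_ext f x = (\<Sum>a\<in>A. Poly_Mapping.lookup x a *\<^sub>v f a)"
  unfolding lin_ext_def
  by (rule sum.mono_neutral_left) (use assms in \<open>auto simp: in_keys_iff\<close>)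

lemma linear_lin_ext: "linear_map (lin_ext f)"
proof (rule linear_module_homI, unfold_locales)
  fix x y :: "'a \<Rightarrow>\<^sub>0 complex"
  let ?A = "Poly_Mapping.keys x \<union> Poly_Mapping.keys y"
  have "lin_ext f (x + y) = (\<Sum>a\<in>?A. Poly_Mapping.lookup (x + y) a *\<^sub>v f a)"
    by (rule lin_ext_superset) (use Poly_Mapping.keys_add[of x y] in auto)
  also have "\<dots> = (\<Sum>a\<in>?A. Poly_Mapping.lookup x a *\<^sub>v f a) + (\<Sum>a\<in>?A. Poly_Mapping.lookup y a *\<^sub>v f a)"
    by (simp add: lookup_add pm.scale_left_distrib sum.distrib)
  also have "\<dots> = lin_ext f x + lin_ext f y"
    by (subst (1 2) lin_ext_superset[where A = ?A]) auto
  finally show "lin_ext f (x + y) = lin_ext f x + lin_ext f y" .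
next
  fix c :: complex and x :: "'a \<Rightarrow>\<^sub>0 complex"
  have "lin_ext f (c *\<^sub>v x) = (\<Sum>a\<in>Poly_Mapping.keys x. Poly_Mapping.lookup (c *\<^sub>v x) a *\<^sub>v f a)"
    by (rule lin_ext_superset) (auto simp: in_keys_iff)
  then show "lin_ext f (c *\<^sub>v x) = c *\<^sub>v lin_ext f x"
    by (simp add: lin_ext_def pm.scale_sum_right)
qed

lemma lin_ext_single [simp]: "lin_ext f (Poly_Mapping.single a c) = c *\<^sub>v f a"
  by (simp add: lin_ext_def)

lemma linear_mapI:
  "(\<And>x y. f (x + y) = f x + f y) \<Longrightarrow> (\<And>c x. f (c *\<^sub>v x) = c *\<^sub>v f x) \<Longrightarrow> linear_map f"
  by (rule linear_module_homI, unfold_locales) auto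

lemma linear_map_add: "linear_map f \<Longrightarrow> f (x + y) = f x + f y"
  by (simp add: linear_iff_module_hom module_hom.add)

lemma linear_map_scale: "linear_map f \<Longrightarrow> f (c *\<^sub>v x) = c *\<^sub>v f x"
  by (simp add: linear_iff_module_hom module_hom.scale)

lemma linear_map_diff: "linear_map f \<Longrightarrow> f (x - y) = f x - f y"
  by (simp add: linear_iff_module_hom module_hom.diff)

lemma linear_map_sum: "linear_map f \<Longrightarrow> f (\<Sum>i\<in>I. g i) = (\<Sum>i\<in>I. f (g i))"
  by (simp add: linear_iff_module_hom module_hom.sum)

lemma linear_map_id: "linear_map (\<lambda>x. x)"
  by (rule linear_mapI) auto

lemma linear_map_plus: "linear_map f \<Longrightarrow> linear_map g \<Longrightarrow> linear_map (\<lambda>x. f x + g x)"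
  by (rule linear_mapI) (auto simp: linear_map_add linear_map_scale pm.scale_right_distrib)

lemma linear_map_minus: "linear_map f \<Longrightarrow> linear_map g \<Longrightarrow> linear_map (\<lambda>x. f x - g x)"
  by (rule linear_mapI) (auto simp: linear_map_add linear_map_scale pm.scale_right_diff_distrib)

lemma linear_map_comp: "linear_map f \<Longrightarrow> linear_map g \<Longrightarrow> linear_map (\<lambda>x. f (g x))"
  by (rule linear_mapI) (auto simp: linear_map_add linear_map_scale)

lemma basis_expansion: "x = lin_ext basis_vec x"
proof (rule poly_mapping_eqI)
  fix k
  have "Poly_Mapping.lookup (lin_ext basis_vec x) k =
      (\<Sum>a\<in>Poly_Mapping.keys x. if a = k then Poly_Mapping.lookup x a else 0)"
    unfolding lin_ext_def lookup_sum
    by (rule sum.cong) (auto simp: lookup_single when_def)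
  then show "Poly_Mapping.lookup x k = Poly_Mapping.lookup (lin_ext basis_vec x) k"
    by (auto simp: in_keys_iff)
qed

lemma linear_eq_lin_ext:
  assumes "linear_map f"
  shows "f = lin_ext (\<lambda>a. f (basis_vec a))"
proof
  fix x
  have "f x = f (lin_ext basis_vec x)" using basis_expansion by metis
  also have "\<dots> = lin_ext (\<lambda>a. f (basis_vec a)) x"
    by (simp add: lin_ext_def linear_map_sum[OF assms] linear_map_scale[OF assms])
  finally show "f x = lin_ext (\<lambda>a. f (basis_vec a)) x" .
qed

lemma linear_eqI:
  assumes "linear_map f" "linear_map g" "\<And>a. f (basis_vec a) = g (basis_vec a)"
  shows "f x = g x"
  by (subst linear_eq_lin_ext[OF assms(1)], subst linear_eq_lin_ext[OF assms(2)]) (simp only: assms(3))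

lemma bilinear_mapI:
  "(\<And>x. linear_map (B x)) \<Longrightarrow> (\<And>y. linear_map (\<lambda>x. B x y)) \<Longrightarrow> bilinear_map B"
  by (simp add: bilinear_map_def)

lemma bilinear_map_left:
  assumes "bilinear_map B" "linear_map f"
  shows "linear_map (\<lambda>x. B (f x) y)"
proof -
  have "linear_map (\<lambda>x. B x y)"
    using assms(1) unfolding bilinear_map_def by (elim conjE allE)
  from linear_map_comp[OF this assms(2)] show ?thesis .
qed

lemma bilinear_map_right:
  assumes "bilinear_map B" "linear_map f"
  shows "linear_map (\<lambda>x. B y (f x))"
proof -
  have "linear_map (B y)"
    using assms(1) unfolding bilinear_map_def by (elim conjE allE)
  from linear_map_comp[OF this assms(2)] show ?thesis .
qed

lemma bilinear_bilin_ext: "bilinear_map (bilin_ext f)"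
  unfolding bilinear_map_def
proof safe
  fix y show "linear_map (\<lambda>x. bilin_ext f x y)"
    unfolding bilin_ext_def by (rule linear_lin_ext)
next
  fix x show "linear_map (bilin_ext f x)"
    unfolding bilin_ext_def lin_ext_def[of _ x]
    by (rule linear_mapI)
      (simp_all add: linear_map_add[OF linear_lin_ext] linear_map_scale[OF linear_lin_ext]
        pm.scale_right_distrib sum.distrib pm.scale_sum_right mult.commute)
qed

lemma bilin_ext_basis [simp]: "bilin_ext f (basis_vec a) (basis_vec b) = f a b"
  by (simp add: bilin_ext_def)

lemma bilinear_eqI:
  assumes "bilinear_map B" "bilinear_map C"
    "\<And>a b. B (basis_vec a) (basis_vec b) = C (basis_vec a) (basis_vec b)"
  shows "B x y = C x y"
proof -
  have lin: "linear_map (B u)" "linear_map (C u)" "linear_map (\<lambda>x. B x v)" "linear_map (\<lambda>x. C x v)" for u v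
    using assms(1,2) unfolding bilinear_map_def by blast+
  have "B (basis_vec a) y = C (basis_vec a) y" for a
    by (rule linear_eqI[OF lin(1,2) assms(3)])
  then show ?thesis
    by (rule linear_eqI[OF lin(3,4)])
qed


section \<open>Tensor products\<close>

text \<open>
  The tensor product of the spaces with bases \<open>'a\<close> and \<open>'b\<close> is the space with basis \<open>'a \<times> 'b\<close>.
  Threefold tensor products are bracketed to the right.
\<close>

definition tensor ::
    "('a \<Rightarrow>\<^sub>0 complex) \<Rightarrow> ('b \<Rightarrow>\<^sub>0 complex) \<Rightarrow> ('a \<times> 'b \<Rightarrow>\<^sub>0 complex)" (infixr \<open>\<otimes>\<close> 70)
  where "x \<otimes> y = bilin_ext (\<lambda>a b. basis_vec (a, b)) x y"

definition tensor_map ::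
    "(('a \<Rightarrow>\<^sub>0 complex) \<Rightarrow> ('c \<Rightarrow>\<^sub>0 complex)) \<Rightarrow> (('b \<Rightarrow>\<^sub>0 complex) \<Rightarrow> ('d \<Rightarrow>\<^sub>0 complex)) \<Rightarrow>
     ('a \<times> 'b \<Rightarrow>\<^sub>0 complex) \<Rightarrow> ('c \<times> 'd \<Rightarrow>\<^sub>0 complex)"
  where "tensor_map f g = lin_ext (\<lambda>(a, b). f (basis_vec a) \<otimes> g (basis_vec b))"

definition twist :: "('a \<times> 'b \<Rightarrow>\<^sub>0 complex) \<Rightarrow> ('b \<times> 'a \<Rightarrow>\<^sub>0 complex)"
  where "twist = lin_ext (\<lambda>(a, b). basis_vec b \<otimes> basis_vec a)"

definition cyc :: "('b \<times> 'b \<times> 'b \<Rightarrow>\<^sub>0 complex) \<Rightarrow> ('b \<times> 'b \<times> 'b \<Rightarrow>\<^sub>0 complex)"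
  where "cyc = lin_ext (\<lambda>(a, b, c). basis_vec b \<otimes> basis_vec c \<otimes> basis_vec a)"

definition skew_tensors :: "('b \<times> 'b \<Rightarrow>\<^sub>0 complex) set"
  where "skew_tensors = range (\<lambda>u. u - twist u)"

lemma bilinear_tensor: "bilinear_map tensor"
  using bilinear_bilin_ext[of "\<lambda>a b. basis_vec (a, b)"] by (simp add: tensor_def[abs_def])

lemma tensor_basis [simp]: "basis_vec a \<otimes> basis_vec b = basis_vec (a, b)"
  by (simp add: tensor_def)

lemma linear_tensor_left: "linear_map (\<lambda>x. x \<otimes> y)"
  and linear_tensor_right: "linear_map (\<lambda>y. x \<otimes> y)"
  using bilinear_tensor by (auto simp: bilinear_map_def)

lemmas linear_intros = linear_map_id linear_map_plus linear_map_minus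
  bilinear_map_left[OF bilinear_tensor] bilinear_map_right[OF bilinear_tensor]

lemma tensor_eqI:
  assumes "linear_map F" "linear_map G" "\<And>x y. F (x \<otimes> y) = G (x \<otimes> y)"
  shows "F u = G u"
proof (rule linear_eqI[OF assms(1,2)])
  fix p
  show "F (basis_vec p) = G (basis_vec p)"
    using assms(3)[of "basis_vec (fst p)" "basis_vec (snd p)"] by simp
qed

theorem tensor_universal:
  fixes B :: "('a \<Rightarrow>\<^sub>0 complex) \<Rightarrow> ('b \<Rightarrow>\<^sub>0 complex) \<Rightarrow> ('c \<Rightarrow>\<^sub>0 complex)"
  assumes "bilinear_map B"
  shows "\<exists>!F. linear_map F \<and> (\<forall>x y. F (x \<otimes> y) = B x y)"
proof (rule ex1I)
  let ?F = "lin_ext (\<lambda>(a, b). B (basis_vec a) (basis_vec b))"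
  have F: "?F (x \<otimes> y) = B x y" for x y
  proof (rule bilinear_eqI[where B = "\<lambda>x y. ?F (x \<otimes> y)"])
    show "bilinear_map (\<lambda>x y. ?F (x \<otimes> y))"
      by (intro bilinear_mapI linear_intros linear_map_comp[OF linear_lin_ext])
  qed (use assms in simp_all)
  then show "linear_map ?F \<and> (\<forall>x y. ?F (x \<otimes> y) = B x y)"
    by (simp add: linear_lin_ext)
  show "G = ?F" if "linear_map G \<and> (\<forall>x y. G (x \<otimes> y) = B x y)" for G
    by (rule ext, rule tensor_eqI) (simp_all add: that linear_lin_ext F)
qed

lemma tensor_map_tensor:
  assumes "linear_map f" "linear_map g"
  shows "tensor_map f g (x \<otimes> y) = f x \<otimes> g y"
proof (rule bilinear_eqI[where B = "\<lambda>x y. tensor_map f g (x \<otimes> y)"])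
  show "bilinear_map (\<lambda>x y. tensor_map f g (x \<otimes> y))"
    unfolding tensor_map_def
    by (intro bilinear_mapI linear_intros linear_map_comp[OF linear_lin_ext])
  show "bilinear_map (\<lambda>x y. f x \<otimes> g y)"
    by (intro bilinear_mapI linear_intros assms)
qed (simp add: tensor_map_def)

lemma twist_tensor: "twist (x \<otimes> y) = y \<otimes> x"
proof (rule bilinear_eqI[where B = "\<lambda>x y. twist (x \<otimes> y)"])
  show "bilinear_map (\<lambda>x y. twist (x \<otimes> y))"
    unfolding twist_def
    by (intro bilinear_mapI linear_intros linear_map_comp[OF linear_lin_ext])
  show "bilinear_map (\<lambda>x y. y \<otimes> x)"
    by (intro bilinear_mapI linear_intros)
qed (simp add: twist_def)

lemma cyc_tensor: "cyc (x \<otimes> y \<otimes> z) = y \<otimes> z \<otimes> x"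
proof (rule linear_eqI[where f = "\<lambda>x. cyc (x \<otimes> y \<otimes> z)"])
  show "linear_map (\<lambda>x. cyc (x \<otimes> y \<otimes> z))"
    unfolding cyc_def by (intro linear_intros linear_map_comp[OF linear_lin_ext])
  show "linear_map (\<lambda>x. y \<otimes> z \<otimes> x)"
    by (intro linear_intros)
  fix a
  show "cyc (basis_vec a \<otimes> y \<otimes> z) = y \<otimes> z \<otimes> basis_vec a"
  proof (rule bilinear_eqI[where B = "\<lambda>y z. cyc (basis_vec a \<otimes> y \<otimes> z)"])
    show "bilinear_map (\<lambda>y z. cyc (basis_vec a \<otimes> y \<otimes> z))"
      unfolding cyc_def by (intro bilinear_mapI linear_intros linear_map_comp[OF linear_lin_ext])
    show "bilinear_map (\<lambda>y z. y \<otimes> z \<otimes> basis_vec a)"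
      by (intro bilinear_mapI linear_intros)
  qed (simp add: cyc_def)
qed


section \<open>Derivations and first cohomology\<close>

definition lie_algebra ::
    "(('b \<Rightarrow>\<^sub>0 complex) \<Rightarrow> ('b \<Rightarrow>\<^sub>0 complex) \<Rightarrow> ('b \<Rightarrow>\<^sub>0 complex)) \<Rightarrow> bool"
  where "lie_algebra br \<longleftrightarrow> bilinear_map br \<and> (\<forall>x. br x x = 0) \<and>
    (\<forall>x y z. br x (br y z) + br y (br z x) + br z (br x y) = 0)"

definition Der ::
    "(('a \<Rightarrow>\<^sub>0 complex) \<Rightarrow> ('a \<Rightarrow>\<^sub>0 complex) \<Rightarrow> ('a \<Rightarrow>\<^sub>0 complex)) \<Rightarrow>
     (('a \<Rightarrow>\<^sub>0 complex) \<Rightarrow> ('m \<Rightarrow>\<^sub>0 complex) \<Rightarrow> ('m \<Rightarrow>\<^sub>0 complex)) \<Rightarrow>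
     (('a \<Rightarrow>\<^sub>0 complex) \<Rightarrow> ('m \<Rightarrow>\<^sub>0 complex)) set"
  where "Der br act =
    {\<phi>. linear_map \<phi> \<and> (\<forall>x y. \<phi> (br x y) = act x (\<phi> y) - act y (\<phi> x))}"

definition Inn ::
    "(('a \<Rightarrow>\<^sub>0 complex) \<Rightarrow> ('m \<Rightarrow>\<^sub>0 complex) \<Rightarrow> ('m \<Rightarrow>\<^sub>0 complex)) \<Rightarrow>
     (('a \<Rightarrow>\<^sub>0 complex) \<Rightarrow> ('m \<Rightarrow>\<^sub>0 complex)) set"
  where "Inn act = {(\<lambda>x. act x v) | v. True}"

definition fscale :: "complex \<Rightarrow> ('a \<Rightarrow> ('b \<Rightarrow>\<^sub>0 complex)) \<Rightarrow> ('a \<Rightarrow> ('b \<Rightarrow>\<^sub>0 complex))"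
  where "fscale c \<phi> = (\<lambda>x. c *\<^sub>v \<phi> x)"

text \<open>The vector space of all functions into a fixed space; addition is pointwise.\<close>

global_interpretation fm: vector_space fscale
  by standard (auto simp: fscale_def fun_eq_iff pm.scale_right_distrib pm.scale_left_distrib)

definition internal_direct_sum ::
    "('a \<Rightarrow> ('b \<Rightarrow>\<^sub>0 complex)) set \<Rightarrow> ('a \<Rightarrow> ('b \<Rightarrow>\<^sub>0 complex)) set \<Rightarrow>
     ('a \<Rightarrow> ('b \<Rightarrow>\<^sub>0 complex)) set \<Rightarrow> bool"
  where "internal_direct_sum V U W \<longleftrightarrow>
    fm.subspace U \<and> fm.subspace W \<and> V = {u + w | u w. u \<in> U \<and> w \<in> W} \<and> U \<inter> W = {0}"

definition coset_of :: "'v::ab_group_add set \<Rightarrow> 'v \<Rightarrow> 'v set"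
  where "coset_of N v = {v + n | n. n \<in> N}"

definition H1 ::
    "(('a \<Rightarrow>\<^sub>0 complex) \<Rightarrow> ('a \<Rightarrow>\<^sub>0 complex) \<Rightarrow> ('a \<Rightarrow>\<^sub>0 complex)) \<Rightarrow>
     (('a \<Rightarrow>\<^sub>0 complex) \<Rightarrow> ('m \<Rightarrow>\<^sub>0 complex) \<Rightarrow> ('m \<Rightarrow>\<^sub>0 complex)) \<Rightarrow>
     (('a \<Rightarrow>\<^sub>0 complex) \<Rightarrow> ('m \<Rightarrow>\<^sub>0 complex)) set set"
  where "H1 br act = coset_of (Inn act) ` Der br act"

text \<open>
  An isomorphism of vector spaces from \<open>H1\<close> onto a subspace \<open>W\<close> of a function space.  The linear
  structure of \<open>H1\<close> is induced by representatives, so linearity is expressed through them.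
\<close>

definition H1_isomorphism ::
    "(('a \<Rightarrow>\<^sub>0 complex) \<Rightarrow> ('a \<Rightarrow>\<^sub>0 complex) \<Rightarrow> ('a \<Rightarrow>\<^sub>0 complex)) \<Rightarrow>
     (('a \<Rightarrow>\<^sub>0 complex) \<Rightarrow> ('m \<Rightarrow>\<^sub>0 complex) \<Rightarrow> ('m \<Rightarrow>\<^sub>0 complex)) \<Rightarrow>
     ('c \<Rightarrow> ('d \<Rightarrow>\<^sub>0 complex)) set \<Rightarrow>
     ((('a \<Rightarrow>\<^sub>0 complex) \<Rightarrow> ('m \<Rightarrow>\<^sub>0 complex)) set \<Rightarrow> ('c \<Rightarrow> ('d \<Rightarrow>\<^sub>0 complex))) \<Rightarrow> bool"
  where "H1_isomorphism br act W F \<longleftrightarrow>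
    bij_betw F (H1 br act) W \<and>
    (\<forall>\<phi>\<in>Der br act. \<forall>\<psi>\<in>Der br act.
      F (coset_of (Inn act) (\<phi> + \<psi>)) = F (coset_of (Inn act) \<phi>) + F (coset_of (Inn act) \<psi>)) \<and>
    (\<forall>c. \<forall>\<phi>\<in>Der br act.
      F (coset_of (Inn act) (fscale c \<phi>)) = fscale c (F (coset_of (Inn act) \<phi>)))"


section \<open>Lie bialgebras\<close>

definition diag_act ::
    "(('b \<Rightarrow>\<^sub>0 complex) \<Rightarrow> ('b \<Rightarrow>\<^sub>0 complex) \<Rightarrow> ('b \<Rightarrow>\<^sub>0 complex)) \<Rightarrow>
     ('b \<Rightarrow>\<^sub>0 complex) \<Rightarrow> ('b \<times> 'b \<Rightarrow>\<^sub>0 complex) \<Rightarrow> ('b \<times> 'b \<Rightarrow>\<^sub>0 complex)"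
  where "diag_act br x u = tensor_map (br x) (\<lambda>z. z) u + tensor_map (\<lambda>z. z) (br x) u"

definition lie_bialgebra ::
    "(('b \<Rightarrow>\<^sub>0 complex) \<Rightarrow> ('b \<Rightarrow>\<^sub>0 complex) \<Rightarrow> ('b \<Rightarrow>\<^sub>0 complex)) \<Rightarrow>
     (('b \<Rightarrow>\<^sub>0 complex) \<Rightarrow> ('b \<times> 'b \<Rightarrow>\<^sub>0 complex)) \<Rightarrow> bool"
  where "lie_bialgebra br \<Delta> \<longleftrightarrow>
    lie_algebra br \<and> linear_map \<Delta> \<and> range \<Delta> \<subseteq> skew_tensors \<and>
    (\<forall>x. let w = tensor_map (\<lambda>z. z) \<Delta> (\<Delta> x) in w + cyc w + cyc (cyc w) = 0) \<and>
    (\<forall>x y. \<Delta> (br x y) = diag_act br x (\<Delta> y) - diag_act br y (\<Delta> x))"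

definition inner_der ::
    "(('b \<Rightarrow>\<^sub>0 complex) \<Rightarrow> ('b \<Rightarrow>\<^sub>0 complex) \<Rightarrow> ('b \<Rightarrow>\<^sub>0 complex)) \<Rightarrow>
     ('b \<times> 'b \<Rightarrow>\<^sub>0 complex) \<Rightarrow> ('b \<Rightarrow>\<^sub>0 complex) \<Rightarrow> ('b \<times> 'b \<Rightarrow>\<^sub>0 complex)"
  where "inner_der br r = (\<lambda>x. diag_act br x r)"

text \<open>
  The left-hand side of the classical Yang-Baxter equation, computed from the expansion of \<open>r\<close> in
  the product basis; by \<open>cyb_sum_tensor\<close> below any expansion gives the same value.
\<close>

definition cyb_term ::
    "(('b \<Rightarrow>\<^sub>0 complex) \<Rightarrow> ('b \<Rightarrow>\<^sub>0 complex) \<Rightarrow> ('b \<Rightarrow>\<^sub>0 complex)) \<Rightarrow>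
     ('b \<Rightarrow>\<^sub>0 complex) \<Rightarrow> ('b \<Rightarrow>\<^sub>0 complex) \<Rightarrow> ('b \<Rightarrow>\<^sub>0 complex) \<Rightarrow> ('b \<Rightarrow>\<^sub>0 complex) \<Rightarrow>
     ('b \<times> 'b \<times> 'b \<Rightarrow>\<^sub>0 complex)"
  where "cyb_term br a b a' b' =
    br a a' \<otimes> b \<otimes> b' + a \<otimes> br b a' \<otimes> b' + a \<otimes> a' \<otimes> br b b'"

definition cyb ::
    "(('b \<Rightarrow>\<^sub>0 complex) \<Rightarrow> ('b \<Rightarrow>\<^sub>0 complex) \<Rightarrow> ('b \<Rightarrow>\<^sub>0 complex)) \<Rightarrow>
     ('b \<times> 'b \<Rightarrow>\<^sub>0 complex) \<Rightarrow> ('b \<times> 'b \<times> 'b \<Rightarrow>\<^sub>0 complex)"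
  where "cyb br r = bilin_ext
    (\<lambda>(a, b) (a', b'). cyb_term br (basis_vec a) (basis_vec b) (basis_vec a') (basis_vec b')) r r"

definition triangular_coboundary ::
    "(('b \<Rightarrow>\<^sub>0 complex) \<Rightarrow> ('b \<Rightarrow>\<^sub>0 complex) \<Rightarrow> ('b \<Rightarrow>\<^sub>0 complex)) \<Rightarrow>
     (('b \<Rightarrow>\<^sub>0 complex) \<Rightarrow> ('b \<times> 'b \<Rightarrow>\<^sub>0 complex)) \<Rightarrow> bool"
  where "triangular_coboundary br \<Delta> \<longleftrightarrow>
    lie_bialgebra br \<Delta> \<and> (\<exists>r\<in>skew_tensors. \<Delta> = inner_der br r \<and> cyb br r = 0)"

lemma diag_act_tensor:
  assumes "bilinear_map br"
  shows "diag_act br x (a \<otimes> b) = br x a \<otimes> b + a \<otimes> br x b"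
  using assms
  by (simp add: diag_act_def bilinear_map_def tensor_map_tensor linear_map_id)

lemma bilinear_sum:
  assumes "bilinear_map B"
  shows "B (\<Sum>i\<in>I. f i) (\<Sum>j\<in>J. g j) = (\<Sum>i\<in>I. \<Sum>j\<in>J. B (f i) (g j))"
proof -
  have "B (\<Sum>i\<in>I. f i) (\<Sum>j\<in>J. g j) = (\<Sum>i\<in>I. B (f i) (\<Sum>j\<in>J. g j))"
    using assms linear_map_sum[of "\<lambda>x. B x (\<Sum>j\<in>J. g j)"] by (simp add: bilinear_map_def)
  then show ?thesis
    using assms by (simp add: bilinear_map_def linear_map_sum)
qed

lemma cyb_sum_tensor:
  assumes br: "bilinear_map br" and r: "r = (\<Sum>i\<in>I. a i \<otimes> b i)"
  shows "cyb br r =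
    (\<Sum>i\<in>I. \<Sum>j\<in>I. br (a i) (a j) \<otimes> b i \<otimes> b j) +
    (\<Sum>i\<in>I. \<Sum>j\<in>I. a i \<otimes> br (b i) (a j) \<otimes> b j) +
    (\<Sum>i\<in>I. \<Sum>j\<in>I. a i \<otimes> a j \<otimes> br (b i) (b j))"
proof -
  let ?B = "bilin_ext
    (\<lambda>(a, b) (a', b'). cyb_term br (basis_vec a) (basis_vec b) (basis_vec a') (basis_vec b'))"
  note li = linear_intros bilinear_map_left[OF br] bilinear_map_right[OF br]
    bilinear_map_left[OF bilinear_bilin_ext] bilinear_map_right[OF bilinear_bilin_ext]
  have *: "?B (basis_vec p \<otimes> basis_vec q) (x \<otimes> y) = cyb_term br (basis_vec p) (basis_vec q) x y" for p q x y
  proof (rule bilinear_eqI[where B = "\<lambda>x y. ?B (basis_vec p \<otimes> basis_vec q) (x \<otimes> y)"])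
    show "bilinear_map (\<lambda>x y. ?B (basis_vec p \<otimes> basis_vec q) (x \<otimes> y))"
      by (intro bilinear_mapI li)
    show "bilinear_map (cyb_term br (basis_vec p) (basis_vec q))"
      unfolding cyb_term_def[abs_def] by (intro bilinear_mapI li)
  qed simp
  have **: "?B (x \<otimes> y) (x' \<otimes> y') = cyb_term br x y x' y'" for x y x' y'
  proof (rule bilinear_eqI[where B = "\<lambda>x y. ?B (x \<otimes> y) (x' \<otimes> y')" and C = "\<lambda>x y. cyb_term br x y x' y'"])
    show "bilinear_map (\<lambda>x y. ?B (x \<otimes> y) (x' \<otimes> y'))"
      by (intro bilinear_mapI li)
    show "bilinear_map (\<lambda>x y. cyb_term br x y x' y')"
      unfolding cyb_term_def by (intro bilinear_mapI li)
  qed (simp add: * del: tensor_basis)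
  have "cyb br r = (\<Sum>i\<in>I. \<Sum>j\<in>I. cyb_term br (a i) (b i) (a j) (b j))"
    unfolding cyb_def r by (subst bilinear_sum[OF bilinear_bilin_ext]) (simp only: **)
  then show ?thesis
    by (simp add: cyb_term_def sum.distrib)
qed


section \<open>The Lie algebra of differential operators on Laurent polynomials\<close>

text \<open>
  The basis vector at \<open>(m, n)\<close> is \<open>t\<^sup>m D\<^sup>n\<close>, where \<open>D = t d/dt\<close>.
\<close>

type_synonym diffop = "int \<times> nat \<Rightarrow>\<^sub>0 complex"

definition diff_bracket :: "diffop \<Rightarrow> diffop \<Rightarrow> diffop"
  where "diff_bracket = bilin_ext (\<lambda>(m, n) (m1, n1).
    (\<Sum>i=1..n. (of_nat (n choose i) * of_int m1 ^ i) *\<^sub>v basis_vec (m + m1, n + n1 - i)) -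
    (\<Sum>j=1..n1. (of_nat (n1 choose j) * of_int m ^ j) *\<^sub>v basis_vec (m + m1, n + n1 - j)))"

definition diff_one :: diffop
  where "diff_one = basis_vec (0, 0)"

definition center_d :: "diffop set"
  where "center_d = pm.span {diff_one}"

definition center_d_tensor :: "(((int \<times> nat) \<times> (int \<times> nat)) \<Rightarrow>\<^sub>0 complex) set"
  where "center_d_tensor = pm.span {x \<otimes> y | x y. x \<in> center_d \<and> y \<in> center_d}"

definition zeta :: "complex \<Rightarrow> complex \<Rightarrow> diffop \<Rightarrow> ((int \<times> nat) \<times> (int \<times> nat) \<Rightarrow>\<^sub>0 complex)"
  where "zeta \<alpha> \<alpha>' = lin_ext (\<lambda>(m, n). if n = 0 then 0 else
    (\<alpha> * of_nat n) *\<^sub>v (basis_vec (m, n - 1) \<otimes> diff_one) +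
    (\<alpha>' * of_nat n) *\<^sub>v (diff_one \<otimes> basis_vec (m, n - 1)))"

definition D_d :: "(diffop \<Rightarrow> ((int \<times> nat) \<times> (int \<times> nat) \<Rightarrow>\<^sub>0 complex)) set"
  where "D_d = fm.span {zeta \<alpha> \<alpha>' | \<alpha> \<alpha>'. True}"

definition D_d0 :: "(diffop \<Rightarrow> ((int \<times> nat) \<times> (int \<times> nat) \<Rightarrow>\<^sub>0 complex)) set"
  where "D_d0 = {\<sigma> \<in> D_d. range \<sigma> \<subseteq> skew_tensors}"

abbreviation diff_act ::
    "diffop \<Rightarrow> ((int \<times> nat) \<times> (int \<times> nat) \<Rightarrow>\<^sub>0 complex) \<Rightarrow> ((int \<times> nat) \<times> (int \<times> nat) \<Rightarrow>\<^sub>0 complex)"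
  where "diff_act \<equiv> diag_act diff_bracket"

text \<open>
  The concrete realisation: on the Laurent monomial \<open>t\<^sup>k\<close> the operator \<open>t\<^sup>m D\<^sup>n\<close> acts by
  \<open>t\<^sup>k \<mapsto> k\<^sup>n t\<^sup>k\<^sup>+\<^sup>m\<close>.  The realisation is faithful and turns the bracket
  into the commutator.
\<close>

definition diff_apply :: "diffop \<Rightarrow> (int \<Rightarrow>\<^sub>0 complex) \<Rightarrow> (int \<Rightarrow>\<^sub>0 complex)"
  where "diff_apply = bilin_ext (\<lambda>(m, n) k. (of_int k ^ n) *\<^sub>v basis_vec (k + m))"

lemma bilinear_diff_apply: "bilinear_map diff_apply"
  and bilinear_diff_bracket: "bilinear_map diff_bracket"
  unfolding diff_apply_def diff_bracket_def by (rule bilinear_bilin_ext)+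

lemma linear_diff_apply: "linear_map (diff_apply x)" "linear_map (\<lambda>x. diff_apply x p)"
  and linear_diff_bracket: "linear_map (diff_bracket x)" "linear_map (\<lambda>x. diff_bracket x y)"
  using bilinear_diff_apply bilinear_diff_bracket by (simp_all add: bilinear_map_def)

lemma diff_apply_basis:
  "diff_apply (basis_vec (m, n)) (basis_vec k) = (of_int k ^ n) *\<^sub>v basis_vec (k + m)"
  by (simp add: diff_apply_def)

lemma diff_bracket_basis:
  "diff_bracket (basis_vec (m, n)) (basis_vec (m1, n1)) =
    (\<Sum>i=1..n. (of_nat (n choose i) * of_int m1 ^ i) *\<^sub>v basis_vec (m + m1, n + n1 - i)) -
    (\<Sum>j=1..n1. (of_nat (n1 choose j) * of_int m ^ j) *\<^sub>v basis_vec (m + m1, n + n1 - j))"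
  by (simp add: diff_bracket_def)

lemma binomial_tail:
  fixes x k :: complex
  shows "(\<Sum>i=1..n. of_nat (n choose i) * x ^ i * k ^ (n + l - i)) = (k + x) ^ n * k ^ l - k ^ (n + l)"
proof -
  have "(k + x) ^ n * k ^ l = (\<Sum>i\<le>n. of_nat (n choose i) * x ^ i * k ^ (n - i)) * k ^ l"
    by (subst add.commute, subst binomial_ring) simp
  also have "\<dots> = (\<Sum>i\<le>n. of_nat (n choose i) * x ^ i * k ^ (n + l - i))"
    unfolding sum_distrib_right
    by (rule sum.cong) (auto simp: mult.assoc simp flip: power_add)
  also have "{..n} = insert 0 {1..n}" by auto
  also have "(\<Sum>i\<in>insert 0 {1..n}. of_nat (n choose i) * x ^ i * k ^ (n + l - i)) =
      k ^ (n + l) + (\<Sum>i=1..n. of_nat (n choose i) * x ^ i * k ^ (n + l - i))"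
    by (subst sum.insert) auto
  finally show ?thesis by simp
qed

theorem diff_apply_bracket:
  "diff_apply (diff_bracket x y) p = diff_apply x (diff_apply y p) - diff_apply y (diff_apply x p)"
proof (rule linear_eqI[where x = p])
  note li = linear_map_id linear_map_minus
    bilinear_map_left[OF bilinear_diff_apply] bilinear_map_right[OF bilinear_diff_apply]
    bilinear_map_left[OF bilinear_diff_bracket] bilinear_map_right[OF bilinear_diff_bracket]
  show "linear_map (diff_apply (diff_bracket x y))"
    "linear_map (\<lambda>p. diff_apply x (diff_apply y p) - diff_apply y (diff_apply x p))"
    by (intro li linear_diff_apply)+
  fix k
  show "diff_apply (diff_bracket x y) (basis_vec k) =
      diff_apply x (diff_apply y (basis_vec k)) - diff_apply y (diff_apply x (basis_vec k))"
  proof (rule bilinear_eqI[where x = x and y = y])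
    show "bilinear_map (\<lambda>x y. diff_apply (diff_bracket x y) (basis_vec k))"
      "bilinear_map (\<lambda>x y. diff_apply x (diff_apply y (basis_vec k)) -
        diff_apply y (diff_apply x (basis_vec k)))"
      by (intro bilinear_mapI li)+
    fix a b :: "int \<times> nat"
    obtain m n m1 n1 where ab: "a = (m, n)" "b = (m1, n1)" by (metis surj_pair)
    show "diff_apply (diff_bracket (basis_vec a) (basis_vec b)) (basis_vec k) =
      diff_apply (basis_vec a) (diff_apply (basis_vec b) (basis_vec k)) -
      diff_apply (basis_vec b) (diff_apply (basis_vec a) (basis_vec k))"
      unfolding ab diff_bracket_basis diff_apply_basis
        linear_map_diff[OF linear_diff_apply(2)] linear_map_sum[OF linear_diff_apply(2)]
        linear_map_scale[OF linear_diff_apply(2)] linear_map_scale[OF linear_diff_apply(1)]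
        pm.scale_scale
      apply (simp only: flip: pm.scale_sum_left)
      using binomial_tail[where k = "of_int k" and n = n and x = "of_int m1" and l = n1]
        binomial_tail[where k = "of_int k" and n = n1 and x = "of_int m" and l = n]
      by (simp add: add_ac mult_ac pm.scale_left_diff_distrib)
  qed
qed

lemma lookup_diff_apply:
  "Poly_Mapping.lookup (diff_apply x (basis_vec k)) (k + m) =
    (\<Sum>n | (m, n) \<in> Poly_Mapping.keys x. Poly_Mapping.lookup x (m, n) * of_int k ^ n)"
proof -
  have "Poly_Mapping.lookup (diff_apply x (basis_vec k)) (k + m) =
      (\<Sum>a\<in>Poly_Mapping.keys x. if fst a = m then Poly_Mapping.lookup x a * of_int k ^ snd a else 0)"
    unfolding diff_apply_def bilin_ext_def lin_ext_def[of _ x] lookup_sum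
    by (rule sum.cong) (auto simp: lookup_single when_def split: prod.splits)
  also have "\<dots> = (\<Sum>a | a \<in> Poly_Mapping.keys x \<and> fst a = m. Poly_Mapping.lookup x a * of_int k ^ snd a)"
    by (simp add: sum.inter_filter)
  also have "\<dots> = (\<Sum>n | (m, n) \<in> Poly_Mapping.keys x. Poly_Mapping.lookup x (m, n) * of_int k ^ n)"
    by (rule sum.reindex_bij_witness[where i = "\<lambda>n. (m, n)" and j = snd]) auto
  finally show ?thesis .
qed

theorem diff_apply_faithful:
  assumes "\<And>p. diff_apply x p = 0"
  shows "x = 0"
proof (rule poly_mapping_eqI)
  fix a :: "int \<times> nat"
  obtain m n where a: "a = (m, n)" by (metis surj_pair)
  let ?S = "{n. (m, n) \<in> Poly_Mapping.keys x}"
  have fin: "finite ?S"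
    by (rule finite_subset[of _ "snd ` Poly_Mapping.keys x"]) force+
  define N where "N = Max (insert 0 ?S)"
  define c where "c n = Poly_Mapping.lookup x (m, n)" for n
  have sub: "?S \<subseteq> {..N}" using fin by (auto simp: N_def)
  have root: "(\<Sum>n\<le>N. c n * of_int k ^ n) = 0" for k :: int
  proof -
    have "(\<Sum>n\<le>N. c n * of_int k ^ n) = (\<Sum>n\<in>?S. c n * of_int k ^ n)"
      by (rule sum.mono_neutral_right) (use sub in \<open>auto simp: c_def in_keys_iff\<close>)
    then show ?thesis
      using lookup_diff_apply[of x k m] assms by (simp add: c_def)
  qed
  have "infinite {z::complex. (\<Sum>n\<le>N. c n * z ^ n) = 0}"
  proof
    assume "finite {z::complex. (\<Sum>n\<le>N. c n * z ^ n) = 0}"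
    then have "finite (range (of_int :: int \<Rightarrow> complex))"
      by (rule rev_finite_subset) (use root in auto)
    moreover have "inj (of_int :: int \<Rightarrow> complex)" by (simp add: inj_def)
    ultimately show False using finite_imageD infinite_UNIV_int by blast
  qed
  then have "\<forall>i\<le>N. c i = 0"
    using polyfun_finite_roots[of c N] by blast
  then have "c n = 0"
    using sub by (cases "n \<le> N") (auto simp: c_def in_keys_iff)
  then show "Poly_Mapping.lookup x a = Poly_Mapping.lookup 0 a" by (simp add: a c_def)
qed

lemma diff_apply_inject:
  assumes "\<And>p. diff_apply x p = diff_apply y p"
  shows "x = y"
  using diff_apply_faithful[of "x - y"] assms
  by (simp add: linear_map_diff[OF linear_diff_apply(2)])

theorem lie_algebra_diff: "lie_algebra diff_bracket"
  unfolding lie_algebra_def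
proof safe
  show "bilinear_map diff_bracket" by (simp add: bilinear_map_def linear_diff_bracket)
  have z: "diff_apply 0 p = 0" for p
    using linear_map_scale[OF linear_diff_apply(2), of 0 0 p] by simp
  show "diff_bracket x x = 0" for x
    by (rule diff_apply_inject) (simp add: diff_apply_bracket z)
  show "diff_bracket x (diff_bracket y z) + diff_bracket y (diff_bracket z x) +
      diff_bracket z (diff_bracket x y) = 0" for x y z
    by (rule diff_apply_inject)
      (simp add: diff_apply_bracket z linear_map_add[OF linear_diff_apply(2)]
        linear_map_diff[OF linear_diff_apply(1)])
qed

theorem center_diff: "{x. \<forall>y. diff_bracket x y = 0} = center_d"
proof safe
  fix x assume x: "\<forall>y. diff_bracket x y = 0"
  have z: "diff_apply 0 p = 0" for p
    using linear_map_scale[OF linear_diff_apply(2), of 0 0 p] by simp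
  have comm: "diff_apply x (diff_apply y p) = diff_apply y (diff_apply x p)" for y p
    using diff_apply_bracket[of x y p] x by (simp add: z)
  have lk: "Poly_Mapping.lookup (diff_apply (basis_vec (1, 0)) q) j = Poly_Mapping.lookup q (j - 1)" for q j
  proof -
    have "Poly_Mapping.lookup (diff_apply (basis_vec (1, 0)) q) j =
        (\<Sum>k\<in>Poly_Mapping.keys q. if k = j - 1 then Poly_Mapping.lookup q k else 0)"
      unfolding diff_apply_def bilin_ext_def lin_ext_single lin_ext_def[of _ q] lookup_vscale lookup_sum
      unfolding mult_1 prod.case by (rule sum.cong) (auto simp: lookup_single when_def)
    then show ?thesis by (auto simp: in_keys_iff)
  qed
  have D: "Poly_Mapping.lookup (diff_apply (basis_vec (0, 1)) q) j = of_int j * Poly_Mapping.lookup q j" for q j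
  proof -
    have "Poly_Mapping.lookup (diff_apply (basis_vec (0, 1)) q) j =
        (\<Sum>k\<in>Poly_Mapping.keys q. if k = j then of_int j * Poly_Mapping.lookup q k else 0)"
      unfolding diff_apply_def bilin_ext_def lin_ext_single lin_ext_def[of _ q] lookup_vscale lookup_sum
      unfolding mult_1 prod.case by (rule sum.cong) (auto simp: lookup_single when_def)
    then show ?thesis by (auto simp: in_keys_iff)
  qed
  define s where "s k j = Poly_Mapping.lookup (diff_apply x (basis_vec k)) j" for k j
  have s1: "s (k + 1) (j + 1) = s k j" for k j
    using comm[of "basis_vec (1, 0)" "basis_vec k"] lk[of "diff_apply x (basis_vec k)" "j + 1"]
    by (simp add: diff_apply_basis s_def)
  have s2: "s k j = 0" if "j \<noteq> k" for k j
  proof -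
    have "of_int k *\<^sub>v diff_apply x (basis_vec k) =
        diff_apply (basis_vec (0, 1)) (diff_apply x (basis_vec k))"
      using comm[of "basis_vec (0, 1)" "basis_vec k"]
      by (simp add: diff_apply_basis linear_map_scale[OF linear_diff_apply(1)])
    then have "of_int k * s k j = of_int j * s k j"
      using D[of "diff_apply x (basis_vec k)" j] by (simp add: s_def flip: lookup_vscale)
    then show ?thesis using that by simp
  qed
  have s3: "s k k = s 0 0" for k
  proof (induction k rule: int_induct[where k = 0])
    case (step2 i)
    then show ?case using s1[of "i - 1" "i - 1"] by simp
  qed (simp_all add: s1)
  have "x = s 0 0 *\<^sub>v diff_one"
  proof (rule diff_apply_inject)
    fix p
    show "diff_apply x p = diff_apply (s 0 0 *\<^sub>v diff_one) p"
    proof (rule linear_eqI[OF linear_diff_apply(1) linear_diff_apply(1)])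
      fix k
      have "diff_apply x (basis_vec k) = s 0 0 *\<^sub>v basis_vec k"
        by (rule poly_mapping_eqI) (use s2 s3 in \<open>auto simp: s_def lookup_single when_def\<close>)
      then show "diff_apply x (basis_vec k) = diff_apply (s 0 0 *\<^sub>v diff_one) (basis_vec k)"
        by (simp add: linear_map_scale[OF linear_diff_apply(2)] diff_one_def diff_apply_basis)
    qed
  qed
  then show "x \<in> center_d" unfolding center_d_def pm.span_singleton by auto
next
  fix x y assume "x \<in> center_d"
  then obtain c where c: "x = c *\<^sub>v diff_one" unfolding center_d_def pm.span_singleton by auto
  have id: "diff_apply diff_one p = p" for p
    by (rule linear_eqI[OF linear_diff_apply(1) linear_map_id]) (simp add: diff_one_def diff_apply_basis)
  have z: "diff_apply 0 p = 0" for p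
    using linear_map_scale[OF linear_diff_apply(2), of 0 0 p] by simp
  have x: "diff_apply x p = c *\<^sub>v p" for p
    unfolding c linear_map_scale[OF linear_diff_apply(2)] id ..
  show "diff_bracket x y = 0"
    by (rule diff_apply_faithful)
      (simp only: x diff_apply_bracket linear_map_scale[OF linear_diff_apply(1)] diff_self)
qed

end

theory Submission
  imports Defs "HOL-Computational_Algebra.Polynomial"
begin

text \<open>
  Write an element of \<open>\<G>\<close> as a finite sum of operators \<open>t\<^sup>a f(D)\<close> with polynomials \<open>f\<close>. Then
  \<open>\<G> \<otimes> \<G>\<close> consists of the finite sums of \<open>s\<^sup>a t\<^sup>b F(x, y)\<close>, where \<open>F\<close> is a polynomial in the
  commuting variables \<open>x = D \<otimes> 1\<close> and \<open>y = 1 \<otimes> D\<close>; here \<open>F\<close> is called the symbol at \<open>(a, b)\<close>.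
  As \<open>f(D) t\<^sup>m = t\<^sup>m f(D + m)\<close>, the diagonal action turns into the functional equation
  \<open>symbol2_act\<close>, which contains only multiplications by polynomials and integer shifts of
  arguments. Everything about derivations is obtained by comparing polynomials in such equations.

  Derivations. Let \<open>\<phi>\<close> be a derivation. The element \<open>D\<close> acts on \<open>\<G> \<otimes> \<G>\<close> by the total degree
  \<open>a + b\<close>, so subtracting an inner derivation makes \<open>\<phi>\<close> preserve degrees. Next, \<open>D\<^sup>2\<close> acts on
  \<open>s\<^sup>p t\<^sup>-\<^sup>p F\<close> as multiplication by \<open>2p(x - y + p)\<close>. The symbol of \<open>\<phi>(D\<^sup>2)\<close> at \<open>(p, -p)\<close> can
  therefore be removed as soon as it vanishes on the line \<open>y = x + p\<close>. On this line \<open>s\<^sup>p t\<^sup>-\<^sup>p\<close>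
  acts as the flip of the two tensor factors, which commutes with all of \<open>\<G>\<close> but lies only in a
  completion of \<open>\<G> \<otimes> \<G>\<close>; since \<open>\<phi>(D\<^sup>2)\<close> has finitely many symbols, comparison with \<open>\<phi>(t\<^sup>m)\<close> for
  almost any \<open>m\<close> shows that the vanishing does hold (\<open>derivation_flip_residue_zero\<close>). Afterwards
  \<open>D\<^sup>2\<close> and \<open>D\<^sup>3\<close> force \<open>\<phi>(t\<^sup>m f(D))\<close> to live in \<open>s\<^sup>m\<close> and \<open>t\<^sup>m\<close> only
  (\<open>reduced_mixed_zero\<close>) and \<open>\<phi>(D\<^sup>2)\<close> to be \<open>\<alpha> x + \<alpha>' y\<close> plus a constant
  (\<open>reduced_square_linear\<close>). This is the value at \<open>D\<^sup>2\<close> of an outer derivation \<open>\<zeta>\<close>, up to the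
  constant, and after subtracting it \<open>\<phi>(t\<^sup>m f(D))\<close> with \<open>m \<noteq> 0\<close> arises from \<open>f\<close> by
  multiplication with symbols that satisfy a cocycle identity in \<open>m\<close>. A last inner derivation,
  found by inverting the difference operator on polynomials, makes \<open>\<phi>(t) = 0\<close>, and then \<open>\<phi> = 0\<close>
  on a generating set. The sum is direct because, unlike that of \<open>\<zeta>(D\<^sup>2)\<close> for \<open>\<zeta> \<noteq> 0\<close>,
  the symbol of \<open>D\<^sup>2 \<cdot> v\<close> at \<open>(0, 0)\<close> is zero for every \<open>v\<close>.

  Bialgebras. Skewness of \<open>\<Delta> = \<Delta>\<^sub>r + \<sigma>\<close> and directness of the sum give separately that \<open>\<sigma>\<close> is skew
  and that \<open>r + \<tau> r\<close> is invariant, hence a multiple of \<open>1 \<otimes> 1\<close>. If \<open>\<sigma> = 0\<close> and \<open>r\<close> is skew,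
  the co-Jacobi identity says that the Yang-Baxter element \<open>c(r)\<close> is invariant
  (\<open>co_jacobi_inner\<close>), so that \<open>c(r)\<close> is a multiple of \<open>1 \<otimes> 1 \<otimes> 1\<close>. It is also antisymmetric
  (\<open>cyb_swap12\<close>), and so it vanishes.
\<close>

section \<open>Linear functionals on finitely supported functions\<close>

definition pairing :: "('b \<Rightarrow> complex) \<Rightarrow> ('b \<Rightarrow>\<^sub>0 complex) \<Rightarrow> complex"
  where "pairing f u = (\<Sum>b\<in>Poly_Mapping.keys u. Poly_Mapping.lookup u b * f b)"

lemma pairing_superset:
  assumes "finite A" "Poly_Mapping.keys u \<subseteq> A"
  shows "pairing f u = (\<Sum>b\<in>A. Poly_Mapping.lookup u b * f b)"
  unfolding pairing_def
  by (rule sum.mono_neutral_left) (use assms in \<open>auto simp: in_keys_iff\<close>)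

lemma pairing_zero [simp]: "pairing f 0 = 0"
  by (simp add: pairing_def)

lemma pairing_basis [simp]: "pairing f (basis_vec b) = f b"
  by (simp add: pairing_def)

lemma pairing_add [simp]: "pairing f (u + v) = pairing f u + pairing f v"
proof -
  let ?A = "Poly_Mapping.keys u \<union> Poly_Mapping.keys v"
  have "pairing f (u + v) = (\<Sum>b\<in>?A. Poly_Mapping.lookup (u + v) b * f b)"
    by (rule pairing_superset) (use Poly_Mapping.keys_add[of u v] in auto)
  also have "\<dots> = (\<Sum>b\<in>?A. Poly_Mapping.lookup u b * f b) + (\<Sum>b\<in>?A. Poly_Mapping.lookup v b * f b)"
    by (simp add: lookup_add algebra_simps sum.distrib)
  also have "\<dots> = pairing f u + pairing f v"
    by (subst (1 2) pairing_superset[where A = ?A]) auto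
  finally show ?thesis .
qed

lemma pairing_scale [simp]: "pairing f (c *\<^sub>v u) = c * pairing f u"
proof -
  have "pairing f (c *\<^sub>v u) = (\<Sum>b\<in>Poly_Mapping.keys u. Poly_Mapping.lookup (c *\<^sub>v u) b * f b)"
    by (rule pairing_superset) (auto simp: in_keys_iff)
  then show ?thesis by (simp add: pairing_def sum_distrib_left mult.assoc)
qed

lemma pairing_uminus [simp]: "pairing f (- u) = - pairing f u"
  using pairing_add[of f u "- u"] by (simp add: eq_neg_iff_add_eq_0 add.commute del: pairing_add)

lemma pairing_diff [simp]: "pairing f (u - v) = pairing f u - pairing f v"
  using pairing_add[of f u "- v"] by simp

lemma pairing_sum: "pairing f (\<Sum>i\<in>I. g i) = (\<Sum>i\<in>I. pairing f (g i))"
  by (induction I rule: infinite_finite_induct) auto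

lemma pairing_linear_map:
  assumes "linear_map L"
  shows "pairing f (L u) = pairing (\<lambda>b. pairing f (L (basis_vec b))) u"
  by (subst linear_eq_lin_ext[OF assms]) (simp add: lin_ext_def pairing_sum pairing_def[of _ u])

lemma pairing_fun_add: "pairing (\<lambda>b. f b + g b) u = pairing f u + pairing g u"
  and pairing_fun_diff: "pairing (\<lambda>b. f b - g b) u = pairing f u - pairing g u"
  and pairing_fun_scale: "pairing (\<lambda>b. c * f b) u = c * pairing f u"
  by (simp_all add: pairing_def sum.distrib sum_subtractf sum_distrib_left algebra_simps)

definition tensor_fun :: "('a \<Rightarrow> complex) \<Rightarrow> ('b \<Rightarrow> complex) \<Rightarrow> 'a \<times> 'b \<Rightarrow> complex"
  where "tensor_fun f g = (\<lambda>(a, b). f a * g b)"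

lemma tensor_fun_apply [simp]: "tensor_fun f g (a, b) = f a * g b"
  by (simp add: tensor_fun_def)

lemma pairing_tensor [simp]:
  "pairing (tensor_fun f g) (x \<otimes> y) = pairing f x * pairing g y"
proof -
  have "pairing (tensor_fun f g) (x \<otimes> y) =
      pairing (\<lambda>a. pairing (\<lambda>b. pairing (tensor_fun f g) (basis_vec a \<otimes> basis_vec b)) y) x"
    by (subst pairing_linear_map[OF linear_tensor_left], subst pairing_linear_map[OF linear_tensor_right])
      (rule refl)
  then show ?thesis
    by (simp add: pairing_fun_scale) (simp add: pairing_fun_scale mult.commute[of "f _"] mult.commute[of "pairing f x"])
qed

lemma pairing_tensor_fun_combine:
  "pairing (tensor_fun (\<lambda>k. f k - g k) h) u = pairing (tensor_fun f h) u - pairing (tensor_fun g h) u"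
  "pairing (tensor_fun (\<lambda>k. c * f k) h) u = c * pairing (tensor_fun f h) u"
  "pairing (tensor_fun h' (\<lambda>k. f' k + g' k)) u' = pairing (tensor_fun h' f') u' + pairing (tensor_fun h' g') u'"
  "pairing (tensor_fun h' (\<lambda>k. f' k - g' k)) u' = pairing (tensor_fun h' f') u' - pairing (tensor_fun h' g') u'"
  "pairing (tensor_fun h' (\<lambda>k. c * f' k)) u' = c * pairing (tensor_fun h' f') u'"
  by (simp_all add: tensor_fun_def case_prod_unfold algebra_simps flip: pairing_fun_add pairing_fun_diff pairing_fun_scale)

lemma pairing_tensor_fun_zero: "(\<And>k. f k = 0) \<Longrightarrow> pairing (tensor_fun f g) u = 0"
  "(\<And>k. g' k = 0) \<Longrightarrow> pairing (tensor_fun f' g') u' = 0"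
  by (simp_all add: pairing_def tensor_fun_def case_prod_unfold)

lemma linear_tensor_map: "linear_map (tensor_map A B)"
  by (simp add: tensor_map_def linear_lin_ext)

lemma tensor_map_basis: "tensor_map A B (basis_vec p) = A (basis_vec (fst p)) \<otimes> B (basis_vec (snd p))"
  by (simp add: tensor_map_def split: prod.splits)

lemma pairing_tensor_map:
  "pairing (tensor_fun f g) (tensor_map A B u) =
    pairing (tensor_fun (\<lambda>a. pairing f (A (basis_vec a))) (\<lambda>b. pairing g (B (basis_vec b)))) u"
proof -
  have "(\<lambda>p. pairing (tensor_fun f g) (tensor_map A B (basis_vec p))) =
      tensor_fun (\<lambda>a. pairing f (A (basis_vec a))) (\<lambda>b. pairing g (B (basis_vec b)))"
    by (rule ext) (auto simp: tensor_map_basis)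
  then show ?thesis
    by (subst pairing_linear_map[OF linear_tensor_map]) simp
qed

definition separating :: "('b \<Rightarrow> complex) set \<Rightarrow> bool"
  where "separating S \<longleftrightarrow> (\<forall>u. (\<forall>f\<in>S. pairing f u = 0) \<longrightarrow> u = 0)"

lemma separating_eqI:
  assumes "separating S" "\<And>f. f \<in> S \<Longrightarrow> pairing f u = pairing f v"
  shows "u = v"
proof -
  have "pairing f (u - v) = 0" if "f \<in> S" for f using assms(2)[OF that] by simp
  then have "u - v = 0" using assms(1) unfolding separating_def by blast
  then show ?thesis by simp
qed

text \<open>
  Apply the second functional to the rows of \<open>u\<close> first: contraction with \<open>g\<close> gives a vector that
  all \<open>f \<in> S\<close> kill, hence zero; each coordinate of this vector is the value of \<open>g\<close> on a row.
\<close>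

lemma separating_tensor:
  assumes S: "separating S" and T: "separating T"
  shows "separating {tensor_fun f g | f g. f \<in> S \<and> g \<in> T}"
  unfolding separating_def
proof safe
  fix u :: "'a \<times> 'b \<Rightarrow>\<^sub>0 complex"
  assume 0: "\<forall>h\<in>{tensor_fun f g | f g. f \<in> S \<and> g \<in> T}. pairing h u = 0"
  define row where "row a = lin_ext (\<lambda>(a', b). if a' = a then basis_vec b else 0) u" for a
  have *: "pairing g (row a) = Poly_Mapping.lookup (lin_ext (\<lambda>(a, b). g b *\<^sub>v basis_vec a) u) a" for g a
  proof -
    have "pairing g (row a) =
        (\<Sum>p\<in>Poly_Mapping.keys u. Poly_Mapping.lookup u p * (if fst p = a then g (snd p) else 0))"
      unfolding row_def lin_ext_def pairing_sum
      by (rule sum.cong) (auto split: prod.splits)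
    also have "\<dots> = Poly_Mapping.lookup (lin_ext (\<lambda>(a, b). g b *\<^sub>v basis_vec a) u) a"
      unfolding lin_ext_def lookup_sum
      by (rule sum.cong) (auto simp: lookup_single when_def split: prod.splits)
    finally show ?thesis .
  qed
  have "lin_ext (\<lambda>(a, b). g b *\<^sub>v basis_vec a) u = 0" if g: "g \<in> T" for g
  proof -
    have "pairing f (lin_ext (\<lambda>(a, b). g b *\<^sub>v basis_vec a) u) = pairing (tensor_fun f g) u" for f
      by (subst pairing_linear_map[OF linear_lin_ext]) (simp add: case_prod_unfold tensor_fun_def mult.commute)
    moreover have "pairing (tensor_fun f g) u = 0" if "f \<in> S" for f
      using 0 that g by blast
    ultimately show ?thesis using S unfolding separating_def by metis
  qed
  then have row0: "row a = 0" for a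
    using * T by (auto simp: separating_def)
  show "u = 0"
  proof (rule poly_mapping_eqI)
    fix p :: "'a \<times> 'b"
    obtain a b where p: "p = (a, b)" by fastforce
    have "Poly_Mapping.lookup (row a) b =
        (\<Sum>q\<in>Poly_Mapping.keys u. if q = (a, b) then Poly_Mapping.lookup u q else 0)"
      unfolding row_def lin_ext_def lookup_sum
      by (rule sum.cong) (auto simp: lookup_single when_def split: prod.splits)
    also have "\<dots> = Poly_Mapping.lookup u (a, b)"
      by (auto simp: in_keys_iff)
    finally show "Poly_Mapping.lookup u p = Poly_Mapping.lookup 0 p"
      by (simp add: row0 p)
  qed
qed

section \<open>Polynomial functions of one complex variable\<close>

definition polyfun :: "(complex \<Rightarrow> complex) \<Rightarrow> bool"
  where "polyfun f \<longleftrightarrow> (\<exists>q. \<forall>x. f x = poly q x)"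

lemma polyfun_const [simp]: "polyfun (\<lambda>x. c)"
  unfolding polyfun_def by (rule exI[of _ "[:c:]"]) simp

lemma polyfun_ident [simp]: "polyfun (\<lambda>x. x)"
  unfolding polyfun_def by (rule exI[of _ "[:0, 1:]"]) simp

lemma polyfun_add: "polyfun f \<Longrightarrow> polyfun g \<Longrightarrow> polyfun (\<lambda>x. f x + g x)"
  unfolding polyfun_def by (metis poly_add)

lemma polyfun_diff: "polyfun f \<Longrightarrow> polyfun g \<Longrightarrow> polyfun (\<lambda>x. f x - g x)"
  unfolding polyfun_def by (metis poly_diff)

lemma polyfun_mult: "polyfun f \<Longrightarrow> polyfun g \<Longrightarrow> polyfun (\<lambda>x. f x * g x)"
  unfolding polyfun_def by (metis poly_mult)

lemma polyfun_power: "polyfun f \<Longrightarrow> polyfun (\<lambda>x. f x ^ n)"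
  unfolding polyfun_def by (metis poly_power)

lemma polyfun_shift: "polyfun f \<Longrightarrow> polyfun (\<lambda>x. f (x + c))"
  unfolding polyfun_def
proof safe
  fix q assume q: "\<forall>x. f x = poly q x"
  show "\<exists>q. \<forall>x. f (x + c) = poly q x"
    by (rule exI[of _ "pcompose q [:c, 1:]"]) (simp add: q poly_pcompose add.commute)
qed

lemma polyfun_sum: "(\<And>i. i \<in> I \<Longrightarrow> polyfun (f i)) \<Longrightarrow> polyfun (\<lambda>x. \<Sum>i\<in>I. f i x)"
  by (induction I rule: infinite_finite_induct) (auto intro: polyfun_add)

lemma polyfun_pairing: "(\<And>b. polyfun (\<lambda>x. f x b)) \<Longrightarrow> polyfun (\<lambda>x. pairing (f x) u)"
  unfolding pairing_def by (intro polyfun_sum polyfun_mult polyfun_const)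

lemma polyfun_tensor_fun:
  "(\<And>k. polyfun (\<lambda>x. f x k)) \<Longrightarrow> polyfun (\<lambda>x. tensor_fun (f x) g p)"
  "(\<And>k. polyfun (\<lambda>x. f' x k)) \<Longrightarrow> polyfun (\<lambda>x. tensor_fun h (f' x) p)"
  by (auto simp: tensor_fun_def case_prod_unfold intro: polyfun_mult)

lemma polyfun_zero_if_almost:
  assumes f: "polyfun f" and A: "finite A" and 0: "\<And>x. x \<notin> A \<Longrightarrow> f x = 0"
  shows "f x = 0"
proof -
  from f obtain q where q: "\<And>x. f x = poly q x" by (auto simp: polyfun_def)
  have "q = 0"
  proof (rule ccontr)
    assume "q \<noteq> 0"
    then have "finite {x. poly q x = 0}" by (rule poly_roots_finite)
    then have "finite (UNIV :: complex set)"
      by (rule finite_subset[rotated, OF finite_UnI[OF A]]) (use 0 q in auto)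
    then show False by (simp add: infinite_UNIV_char_0)
  qed
  then show ?thesis by (simp add: q)
qed

text \<open>
  A polynomial with a nonzero period takes one value infinitely often.
\<close>

lemma polyfun_periodic_const:
  assumes f: "polyfun f" and c: "c \<noteq> 0" and per: "\<And>x. f (x + c) = f x"
  shows "f x = f 0"
proof -
  from f obtain q where q: "\<And>x. f x = poly q x" by (auto simp: polyfun_def)
  have mult: "f (of_nat n * c) = f 0" for n
  proof (induction n)
    case (Suc n)
    then show ?case using per[of "of_nat n * c"] by (simp add: algebra_simps)
  qed simp
  have "q - [:f 0:] = 0"
  proof (rule ccontr)
    assume "q - [:f 0:] \<noteq> 0"
    then have "finite {x. poly (q - [:f 0:]) x = 0}" by (rule poly_roots_finite)
    then have "finite (range (\<lambda>n. of_nat n * c))"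
      by (rule rev_finite_subset) (use mult q in auto)
    moreover have "inj (\<lambda>n. of_nat n * c)" using c by (auto simp: inj_def)
    ultimately show False using finite_imageD by blast
  qed
  then have "poly q x = poly [:f 0:] x" by simp
  then show ?thesis by (simp add: q)
qed

text \<open>
  The difference operator is onto: up to the factor \<open>-(n + 1)\<close>, the difference of \<open>x\<^sup>n\<^sup>+\<^sup>1\<close> is
  \<open>x\<^sup>n\<close> plus lower powers, which are differences by induction.
\<close>

lemma polyfun_antidifference: "\<exists>q. \<forall>x::complex. poly q x - poly q (x + 1) = x ^ n"
proof (induction n rule: less_induct)
  case (less n)
  then obtain q where q: "\<And>k x. k < n \<Longrightarrow> poly (q k) x - poly (q k) (x + 1) = (x::complex) ^ k"
    by metis
  define r where "r = smult (- 1 / of_nat (Suc n))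
    (monom 1 (Suc n) + (\<Sum>k<n. smult (of_nat (Suc n choose k)) (q k)))"
  have "poly r x - poly r (x + 1) = x ^ n" for x
  proof -
    have "(x + 1) ^ Suc n = (\<Sum>k\<le>Suc n. of_nat (Suc n choose k) * x ^ k)"
      by (subst binomial_ring) simp
    also have "\<dots> = (\<Sum>k<n. of_nat (Suc n choose k) * x ^ k) + of_nat (Suc n) * x ^ n + x ^ Suc n"
      by (simp add: lessThan_Suc_atMost[symmetric])
    finally have pow: "x ^ Suc n - (x + 1) ^ Suc n + (\<Sum>k<n. of_nat (Suc n choose k) * x ^ k) =
        - of_nat (Suc n) * x ^ n" by (simp add: algebra_simps)
    have "poly r x - poly r (x + 1) = (- 1 / of_nat (Suc n)) * (x ^ Suc n - (x + 1) ^ Suc n +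
        (\<Sum>k<n. of_nat (Suc n choose k) * (poly (q k) x - poly (q k) (x + 1))))"
      unfolding r_def
      by (simp only: poly_smult poly_add poly_monom poly_sum mult_1 right_diff_distrib sum_subtractf)
        (simp only: algebra_simps)
    also have "(\<Sum>k<n. of_nat (Suc n choose k) * (poly (q k) x - poly (q k) (x + 1))) =
        (\<Sum>k<n. of_nat (Suc n choose k) * x ^ k)"
      by (rule sum.cong) (simp_all add: q)
    also note pow
    also have "(- 1 / of_nat (Suc n)) * (- of_nat (Suc n) * x ^ n) = x ^ n"
      using of_nat_neq_0[of n, where 'a = complex] by (simp del: of_nat_Suc)
    finally show ?thesis .
  qed
  then show ?case by blast
qed

section \<open>Lie algebras, the diagonal action and derivations\<close>

lemma lie_algebra_bilinear: "lie_algebra br \<Longrightarrow> bilinear_map br"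
  by (simp add: lie_algebra_def)

lemma bilinear_map_linear: "bilinear_map br \<Longrightarrow> linear_map (br x)" "bilinear_map br \<Longrightarrow> linear_map (\<lambda>x. br x y)"
  by (simp_all add: bilinear_map_def)

lemma linear_map_zero: "linear_map f \<Longrightarrow> f 0 = 0"
  using linear_map_diff[of f 0 0] by simp

lemma linear_map_uminus: "linear_map f \<Longrightarrow> f (- x) = - f x"
  using linear_map_diff[of f 0 x] by (simp add: linear_map_zero)

lemma lie_algebra_antisym:
  assumes "lie_algebra br"
  shows "br y x = - br x y"
proof -
  note lin = bilinear_map_linear[OF lie_algebra_bilinear[OF assms]]
  have sq: "br z z = 0" for z
    using assms by (simp add: lie_algebra_def)
  have "br x y + br y x = br (x + y) (x + y)"
    by (simp only: linear_map_add[OF lin(1)] linear_map_add[OF lin(2)]) (simp add: sq add.commute)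
  also have "\<dots> = 0" by (rule sq)
  finally have "br x y + br y x = 0" .
  then show ?thesis by (simp add: eq_neg_iff_add_eq_0 add.commute)
qed

lemma lie_algebra_leibniz:
  assumes "lie_algebra br"
  shows "br x (br y z) = br (br x y) z + br y (br x z)"
proof -
  note lin = bilinear_map_linear[OF lie_algebra_bilinear[OF assms]]
  have "br x (br y z) + br y (br z x) + br z (br x y) = 0"
    using assms by (simp add: lie_algebra_def)
  moreover have "br z (br x y) = - br (br x y) z" "br y (br z x) = - br y (br x z)"
    using lie_algebra_antisym[OF assms, of z "br x y"] lie_algebra_antisym[OF assms, of z x]
    by (simp_all add: linear_map_uminus[OF lin(1)])
  ultimately show ?thesis by (simp add: algebra_simps)
qed

lemma linear_diag_act: "linear_map (diag_act br x)"
  unfolding diag_act_def[abs_def] by (intro linear_map_plus linear_tensor_map)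

lemma linear_diag_act_left:
  assumes br: "bilinear_map br"
  shows "linear_map (\<lambda>x. diag_act br x u)"
proof (rule linear_mapI)
  fix x y
  show "diag_act br (x + y) u = diag_act br x u + diag_act br y u"
    by (rule tensor_eqI[OF linear_diag_act linear_map_plus[OF linear_diag_act linear_diag_act]])
      (simp add: diag_act_tensor[OF br] linear_map_add[OF bilinear_map_linear(2)[OF br]]
        linear_map_add[OF linear_tensor_left] linear_map_add[OF linear_tensor_right])
next
  fix c x
  have "linear_map (\<lambda>u. c *\<^sub>v diag_act br x u)"
    by (rule linear_mapI) (simp_all add: linear_map_add[OF linear_diag_act]
        linear_map_scale[OF linear_diag_act] pm.scale_right_distrib mult.commute)
  then show "diag_act br (c *\<^sub>v x) u = c *\<^sub>v diag_act br x u"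
    by (rule tensor_eqI[OF linear_diag_act])
      (simp add: diag_act_tensor[OF br] linear_map_scale[OF bilinear_map_linear(2)[OF br]]
        linear_map_scale[OF linear_tensor_left] linear_map_scale[OF linear_tensor_right]
        pm.scale_right_distrib)
qed

lemma diag_act_bracket:
  assumes br: "lie_algebra br"
  shows "diag_act br (br x y) u = diag_act br x (diag_act br y u) - diag_act br y (diag_act br x u)"
proof (rule tensor_eqI[OF linear_diag_act])
  show "linear_map (\<lambda>u. diag_act br x (diag_act br y u) - diag_act br y (diag_act br x u))"
    by (intro linear_map_minus linear_map_comp[OF linear_diag_act linear_diag_act])
  show "diag_act br (br x y) (a \<otimes> b) =
      diag_act br x (diag_act br y (a \<otimes> b)) - diag_act br y (diag_act br x (a \<otimes> b))" for a b
    by (simp add: diag_act_tensor[OF lie_algebra_bilinear[OF br]] linear_map_add[OF linear_diag_act]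
        lie_algebra_leibniz[OF br, of x y] linear_map_add[OF linear_tensor_left]
        linear_map_add[OF linear_tensor_right])
qed

lemma linear_twist: "linear_map twist"
  by (simp add: twist_def linear_lin_ext)

lemma twist_twist [simp]: "twist (twist u) = u"
  by (rule tensor_eqI[OF linear_map_comp[OF linear_twist linear_twist] linear_map_id])
    (simp add: twist_tensor)

lemma twist_diag_act:
  assumes br: "bilinear_map br"
  shows "twist (diag_act br x u) = diag_act br x (twist u)"
  by (rule tensor_eqI[OF linear_map_comp[OF linear_twist linear_diag_act]
        linear_map_comp[OF linear_diag_act linear_twist]])
    (simp add: diag_act_tensor[OF br] twist_tensor linear_map_add[OF linear_twist] add.commute)

lemma skew_tensors_iff: "u \<in> skew_tensors \<longleftrightarrow> twist u = - u"
proof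
  assume "u \<in> skew_tensors"
  then show "twist u = - u"
    by (auto simp: skew_tensors_def linear_map_diff[OF linear_twist])
next
  assume u: "twist u = - u"
  have "u = (1 / 2) *\<^sub>v u - twist ((1 / 2) *\<^sub>v u)"
    unfolding linear_map_scale[OF linear_twist] u
    by (simp flip: pm.scale_left_distrib)
  then show "u \<in> skew_tensors" by (auto simp: skew_tensors_def)
qed

lemma pairing_twist: "pairing (tensor_fun f g) (twist u) = pairing (tensor_fun g f) u"
proof -
  have "(\<lambda>p. pairing (tensor_fun f g) (twist (basis_vec p))) = tensor_fun g f"
    by (rule ext) (auto simp: twist_def mult.commute)
  then show ?thesis by (subst pairing_linear_map[OF linear_twist]) simp
qed

lemma DerI:
  assumes "linear_map \<phi>" "\<And>x y. \<phi> (br x y) = act x (\<phi> y) - act y (\<phi> x)"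
  shows "\<phi> \<in> Der br act"
  using assms by (simp add: Der_def)

lemma Der_linear: "\<phi> \<in> Der br act \<Longrightarrow> linear_map \<phi>"
  by (simp add: Der_def)

lemma Der_bracket: "\<phi> \<in> Der br act \<Longrightarrow> \<phi> (br x y) = act x (\<phi> y) - act y (\<phi> x)"
  unfolding Der_def by blast

lemma Der_diff:
  assumes "\<phi> \<in> Der br (diag_act br')" "\<psi> \<in> Der br (diag_act br')"
  shows "\<phi> - \<psi> \<in> Der br (diag_act br')"
  using linear_map_minus[OF Der_linear[OF assms(1)] Der_linear[OF assms(2)]]
  by (intro DerI) (simp_all add: fun_diff_def Der_bracket[OF assms(1)] Der_bracket[OF assms(2)]
      linear_map_diff[OF linear_diag_act])

lemma inner_in_Der:
  assumes "lie_algebra br"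
  shows "(\<lambda>x. diag_act br x v) \<in> Der br (diag_act br)"
  by (rule DerI[OF linear_diag_act_left[OF lie_algebra_bilinear[OF assms]]])
    (rule diag_act_bracket[OF assms])

lemma subspace_Inn: "fm.subspace (Inn (diag_act br))"
proof (rule fm.subspaceI)
  show "0 \<in> Inn (diag_act br)"
    unfolding Inn_def zero_fun_def
    by (auto simp: linear_map_zero[OF linear_diag_act] intro!: exI[of _ 0])
next
  fix f g assume "f \<in> Inn (diag_act br)" "g \<in> Inn (diag_act br)"
  then obtain v w where "f = (\<lambda>x. diag_act br x v)" "g = (\<lambda>x. diag_act br x w)" by (auto simp: Inn_def)
  then have "f + g = (\<lambda>x. diag_act br x (v + w))"
    by (simp add: fun_eq_iff linear_map_add[OF linear_diag_act])
  then show "f + g \<in> Inn (diag_act br)" by (auto simp: Inn_def)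
next
  fix c f assume "f \<in> Inn (diag_act br)"
  then obtain v where "f = (\<lambda>x. diag_act br x v)" by (auto simp: Inn_def)
  then have "fscale c f = (\<lambda>x. diag_act br x (c *\<^sub>v v))"
    by (simp add: fun_eq_iff fscale_def linear_map_scale[OF linear_diag_act])
  then show "fscale c f \<in> Inn (diag_act br)" by (auto simp: Inn_def)
qed

text \<open>
  Every coset of the inner derivations meets a complement \<open>W\<close> in exactly one point, and the
  isomorphism picks this point.
\<close>

lemma H1_isomorphism_of_complement:
  assumes sum: "internal_direct_sum (Der br act) (Inn act) W"
  shows "\<exists>F. H1_isomorphism br act W F"
proof -
  let ?N = "Inn act"
  have N: "fm.subspace ?N" and W: "fm.subspace W"
    and V: "Der br act = {u + w | u w. u \<in> ?N \<and> w \<in> W}" and int: "?N \<inter> W = {0}"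
    using sum by (simp_all add: internal_direct_sum_def)
  define F where "F C = (THE w. w \<in> C \<and> w \<in> W)" for C
  have F: "F (coset_of ?N (u + w)) = w" if u: "u \<in> ?N" and w: "w \<in> W" for u w
    unfolding F_def
  proof (rule the_equality)
    have "w = u + w + - u" by simp
    then show "w \<in> coset_of ?N (u + w) \<and> w \<in> W"
      using w fm.subspace_neg[OF N u] unfolding coset_of_def by blast
    fix w' assume w': "w' \<in> coset_of ?N (u + w) \<and> w' \<in> W"
    then obtain n where n: "n \<in> ?N" "w' = u + w + n" by (auto simp: coset_of_def)
    have "w' - w \<in> ?N" using fm.subspace_add[OF N u n(1)] n(2) by (simp add: add_ac)
    moreover have "w' - w \<in> W" using fm.subspace_diff[OF W] w w' by simp
    ultimately have "w' - w = 0" using int by blast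
    then show "w' = w" by simp
  qed
  have cos: "coset_of ?N (u + w) = coset_of ?N w" if u: "u \<in> ?N" for u w
  proof -
    have "u + w + n = w + (u + n)" "w + n = u + w + (n - u)" for n by (simp_all add: add_ac)
    then show ?thesis
      unfolding coset_of_def using fm.subspace_add[OF N u] fm.subspace_diff[OF N _ u] by blast
  qed
  have "H1_isomorphism br act W F"
    unfolding H1_isomorphism_def
  proof (intro conjI ballI allI)
    show "bij_betw F (H1 br act) W"
    proof (rule bij_betw_imageI)
      show "inj_on F (H1 br act)"
        unfolding H1_def V using F[OF fm.subspace_0[OF N]]
        by (intro inj_onI) (auto simp: F cos)
      have "w \<in> F ` H1 br act" if "w \<in> W" for w
      proof -
        have "0 + w \<in> Der br act" using V that fm.subspace_0[OF N] by blast
        then show ?thesis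
          unfolding H1_def using F[OF fm.subspace_0[OF N] that] by (metis image_eqI)
      qed
      then show "F ` H1 br act = W" unfolding H1_def V by (auto simp: F)
    qed
  next
    fix \<phi> \<psi> assume "\<phi> \<in> Der br act" "\<psi> \<in> Der br act"
    then obtain u w u' w' where *: "\<phi> = u + w" "\<psi> = u' + w'" "u \<in> ?N" "w \<in> W" "u' \<in> ?N" "w' \<in> W"
      unfolding V by blast
    have "\<phi> + \<psi> = (u + u') + (w + w')" by (simp add: *(1,2) add_ac)
    then have "F (coset_of ?N (\<phi> + \<psi>)) = w + w'"
      using F[OF fm.subspace_add[OF N *(3,5)] fm.subspace_add[OF W *(4,6)]] by metis
    moreover have "F (coset_of ?N \<phi>) = w" unfolding *(1) by (rule F[OF *(3,4)])
    moreover have "F (coset_of ?N \<psi>) = w'" unfolding *(2) by (rule F[OF *(5,6)])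
    ultimately show "F (coset_of ?N (\<phi> + \<psi>)) = F (coset_of ?N \<phi>) + F (coset_of ?N \<psi>)"
      by (simp only:)
  next
    fix c \<phi> assume "\<phi> \<in> Der br act"
    then obtain u w where *: "\<phi> = u + w" "u \<in> ?N" "w \<in> W"
      unfolding V by blast
    then show "F (coset_of ?N (fscale c \<phi>)) = fscale c (F (coset_of ?N \<phi>))"
      using F fm.subspace_scale[OF N] fm.subspace_scale[OF W] by (simp add: fm.scale_right_distrib)
  qed
  then show ?thesis by blast
qed

section \<open>Co-Jacobi and Yang-Baxter\<close>

text \<open>
  A bilinear map with the quadratic expression \<open>cyb br\<close> on its diagonal, as needed for polarization.
\<close>

definition cyb_form ::
    "(('b \<Rightarrow>\<^sub>0 complex) \<Rightarrow> ('b \<Rightarrow>\<^sub>0 complex) \<Rightarrow> ('b \<Rightarrow>\<^sub>0 complex)) \<Rightarrow>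
     ('b \<times> 'b \<Rightarrow>\<^sub>0 complex) \<Rightarrow> ('b \<times> 'b \<Rightarrow>\<^sub>0 complex) \<Rightarrow> ('b \<times> 'b \<times> 'b \<Rightarrow>\<^sub>0 complex)"
  where "cyb_form br = bilin_ext
    (\<lambda>(a, b) (a', b'). cyb_term br (basis_vec a) (basis_vec b) (basis_vec a') (basis_vec b'))"

lemma cyb_eq_form: "cyb br r = cyb_form br r r"
  by (simp add: cyb_def cyb_form_def)

lemma bilinear_cyb_form: "bilinear_map (cyb_form br)"
  by (simp add: cyb_form_def bilinear_bilin_ext)

lemma linear_cyb_form: "linear_map (cyb_form br r)" "linear_map (\<lambda>r. cyb_form br r r')"
  using bilinear_cyb_form[of br] by (simp_all add: bilinear_map_def)

text \<open>
  Identities that are quadratic in a skew tensor need to be checked only in polarized form and on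
  the spanning elements \<open>a \<otimes> b - b \<otimes> a\<close>, where no sums over an expansion of \<open>r\<close> occur.
\<close>

lemma skew_quadratic_zero:
  assumes B: "bilinear_map B"
    and basis: "\<And>a b c d. B (basis_vec (a, b) - basis_vec (b, a)) (basis_vec (c, d) - basis_vec (d, c)) +
      B (basis_vec (c, d) - basis_vec (d, c)) (basis_vec (a, b) - basis_vec (b, a)) = 0"
    and r: "r \<in> skew_tensors"
  shows "B r r = 0"
proof -
  note lin = bilinear_map_linear[OF B]
  let ?s = "\<lambda>u. u - twist u"
  have ls: "linear_map ?s" by (intro linear_map_minus linear_map_id linear_twist)
  have "B (?s u) (?s v) + B (?s v) (?s u) = 0" for u v
  proof (rule bilinear_eqI[where x = u and y = v])
    show "bilinear_map (\<lambda>u v. B (?s u) (?s v) + B (?s v) (?s u))"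
      by (intro bilinear_mapI linear_map_plus linear_map_comp[OF lin(1) ls] linear_map_comp[OF lin(2) ls])
    show "bilinear_map (\<lambda>u v. 0)"
      by (intro bilinear_mapI linear_mapI) simp_all
    fix p q
    show "B (?s (basis_vec p)) (?s (basis_vec q)) + B (?s (basis_vec q)) (?s (basis_vec p)) = 0"
      using basis[of "fst p" "snd p" "fst q" "snd q"] by (cases p; cases q) (simp add: twist_def)
  qed
  moreover obtain u where "r = ?s u" using r by (auto simp: skew_tensors_def)
  ultimately have "B r r + B r r = 0" by blast
  then have "2 *\<^sub>v B r r = 0"
    using pm.scale_left_distrib[of 1 1 "B r r"] by simp
  then show ?thesis using pm.scale_eq_0_iff by (metis zero_neq_numeral)
qed

lemma linear_cyc: "linear_map cyc"
  by (simp add: cyc_def linear_lin_ext)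

lemma linear_tensor_map_right:
  assumes F: "\<And>y. linear_map (F y)"
  shows "linear_map (\<lambda>r. tensor_map (\<lambda>z. z) (\<lambda>y. F y r) u)"
  by (rule linear_mapI)
    (simp_all add: tensor_map_def lin_ext_def case_prod_unfold linear_map_add[OF F] linear_map_scale[OF F]
      linear_map_add[OF linear_tensor_right] linear_map_scale[OF linear_tensor_right]
      pm.scale_right_distrib sum.distrib pm.scale_sum_right mult.commute)

definition triple_act ::
    "(('b \<Rightarrow>\<^sub>0 complex) \<Rightarrow> ('b \<Rightarrow>\<^sub>0 complex) \<Rightarrow> ('b \<Rightarrow>\<^sub>0 complex)) \<Rightarrow>
     ('b \<Rightarrow>\<^sub>0 complex) \<Rightarrow> ('b \<times> 'b \<times> 'b \<Rightarrow>\<^sub>0 complex) \<Rightarrow> ('b \<times> 'b \<times> 'b \<Rightarrow>\<^sub>0 complex)"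
  where "triple_act br X u = tensor_map (br X) (\<lambda>z. z) u + tensor_map (\<lambda>z. z) (diag_act br X) u"

lemma linear_triple_act: "linear_map (triple_act br X)"
  unfolding triple_act_def[abs_def] by (intro linear_map_plus linear_tensor_map)

lemma triple_act_tensor:
  assumes br: "bilinear_map br"
  shows "triple_act br X (a \<otimes> b \<otimes> c) = br X a \<otimes> b \<otimes> c + a \<otimes> br X b \<otimes> c + a \<otimes> b \<otimes> br X c"
  by (simp add: triple_act_def tensor_map_tensor bilinear_map_linear[OF br] linear_map_id linear_diag_act
      diag_act_tensor[OF br] linear_map_add[OF linear_tensor_right])

definition cyclic_sum :: "('b \<times> 'b \<times> 'b \<Rightarrow>\<^sub>0 complex) \<Rightarrow> ('b \<times> 'b \<times> 'b \<Rightarrow>\<^sub>0 complex)"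
  where "cyclic_sum w = w + cyc w + cyc (cyc w)"

lemma linear_cyclic_sum: "linear_map cyclic_sum"
  unfolding cyclic_sum_def[abs_def]
  by (intro linear_map_plus linear_map_id linear_cyc linear_map_comp[OF linear_cyc linear_cyc])

lemma cyclic_sum_tensor:
  "cyclic_sum (a \<otimes> b \<otimes> c) = a \<otimes> b \<otimes> c + b \<otimes> c \<otimes> a + c \<otimes> a \<otimes> b"
  by (simp add: cyclic_sum_def cyc_tensor)

text \<open>
  Both sides expand into pure tensors in iterated brackets. The Leibniz rule for \<open>x\<close> and a fixed
  orientation of the brackets between \<open>{a, b}\<close> and \<open>{c, d}\<close> bring them to the same normal form.
  Conceptually, for one skew tensor \<open>r\<close> and with \<open>P, Q, R\<close> denoting \<open>r\<close> placed in the positions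
  \<open>12, 23, 31\<close>, the cyclic sum in question is that of \<open>[[x, P - R], Q]\<close>, which the Jacobi identity collapses to
  \<open>[x, [P, Q] + [Q, R] + [R, P]]\<close>.
\<close>

lemma co_jacobi_polarized:
  fixes a b c d x :: "'b \<Rightarrow>\<^sub>0 complex"
  assumes br: "lie_algebra br"
  defines "w \<equiv> \<lambda>p q. tensor_map (\<lambda>z. z) (\<lambda>y. diag_act br y p) (diag_act br x q)"
    and "p \<equiv> a \<otimes> b - b \<otimes> a" and "q \<equiv> c \<otimes> d - d \<otimes> c"
    and "k \<equiv> \<lambda>a b c d. cyb_term br a b c d - cyb_term br b a c d - cyb_term br a b d c + cyb_term br b a d c"
  shows "cyclic_sum (w p q) + cyclic_sum (w q p) = triple_act br x (k a b c d + k c d a b)"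
proof -
  note bil = lie_algebra_bilinear[OF br]
  note expand = linear_map_add[OF linear_tensor_left] linear_map_add[OF linear_tensor_right]
    linear_map_diff[OF linear_tensor_left] linear_map_diff[OF linear_tensor_right]
    linear_map_uminus[OF linear_tensor_left] linear_map_uminus[OF linear_tensor_right]
    linear_map_add[OF linear_cyclic_sum] linear_map_diff[OF linear_cyclic_sum]
    linear_map_uminus[OF linear_cyclic_sum] linear_map_uminus[OF linear_triple_act]
    linear_map_add[OF linear_triple_act] linear_map_diff[OF linear_triple_act]
    linear_map_add[OF linear_diag_act] linear_map_diff[OF linear_diag_act]
    linear_map_add[OF linear_tensor_map] linear_map_diff[OF linear_tensor_map]
  have w: "w r (u \<otimes> v - v \<otimes> u) = br x u \<otimes> diag_act br v r + u \<otimes> diag_act br (br x v) r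
      - (br x v \<otimes> diag_act br u r + v \<otimes> diag_act br (br x u) r)" for r u v
    by (simp add: w_def tensor_map_tensor linear_map_id linear_diag_act_left[OF bil] expand
        diag_act_tensor[OF bil])
  have antisym: "br v u = - br u v" "br (br x v) u = - br u (br x v)" "br v (br x u) = - br (br x u) v"
    if "u \<in> {a, b}" "v \<in> {c, d}" for u v
    using lie_algebra_antisym[OF br] by blast+
  note flips = antisym[of a c] antisym[of a d] antisym[of b c] antisym[of b d]
  have leib: "br x (br u v) = br (br x u) v + br u (br x v)" for u v
    by (rule lie_algebra_leibniz[OF br])
  show ?thesis
    unfolding p_def q_def w k_def cyb_term_def
    by (simp only: expand diag_act_tensor[OF bil] triple_act_tensor[OF bil] cyclic_sum_tensor
        flips insert_iff simp_thms leib linear_map_uminus[OF bilinear_map_linear(1)[OF bil]])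
      (simp add: algebra_simps)
qed

text \<open>
  For skew \<open>r\<close> the failure of the co-Jacobi identity of \<open>\<Delta>\<^sub>r\<close> at \<open>x\<close> is \<open>x \<cdot> c(r)\<close>: the Yang-Baxter
  element has to be invariant, but not yet zero.
\<close>

lemma co_jacobi_inner:
  assumes br: "lie_algebra br" and r: "r \<in> skew_tensors"
  shows "cyclic_sum (tensor_map (\<lambda>z. z) (inner_der br r) (inner_der br r x)) = triple_act br x (cyb br r)"
proof -
  note bil = lie_algebra_bilinear[OF br]
  define w where "w = (\<lambda>p q. tensor_map (\<lambda>z. z) (\<lambda>y. diag_act br y p) (diag_act br x q))"
  define B where "B p q = cyclic_sum (w p q) - triple_act br x (cyb_form br p q)" for p q
  have "bilinear_map w"
    unfolding w_def
    by (intro bilinear_mapI linear_map_comp[OF linear_tensor_map linear_diag_act]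
        linear_tensor_map_right linear_diag_act)
  note lw = bilinear_map_linear[OF this]
  have "bilinear_map B"
    unfolding B_def
    by (intro bilinear_mapI linear_map_minus linear_map_comp[OF linear_cyclic_sum]
        linear_map_comp[OF linear_triple_act] lw linear_cyb_form)
  moreover have "B (basis_vec (a, b) - basis_vec (b, a)) (basis_vec (c, d) - basis_vec (d, c)) +
      B (basis_vec (c, d) - basis_vec (d, c)) (basis_vec (a, b) - basis_vec (b, a)) = 0" for a b c d
  proof -
    have k: "cyb_form br (basis_vec (a, b) - basis_vec (b, a)) (basis_vec (c, d) - basis_vec (d, c)) =
      cyb_term br (basis_vec a) (basis_vec b) (basis_vec c) (basis_vec d)
      - cyb_term br (basis_vec b) (basis_vec a) (basis_vec c) (basis_vec d)
      - cyb_term br (basis_vec a) (basis_vec b) (basis_vec d) (basis_vec c)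
      + cyb_term br (basis_vec b) (basis_vec a) (basis_vec d) (basis_vec c)" for a b c d
      by (simp add: linear_map_diff[OF linear_cyb_form(1)] linear_map_diff[OF linear_cyb_form(2)])
        (simp add: cyb_form_def)
    show ?thesis
      using co_jacobi_polarized[OF br, of "basis_vec a" "basis_vec b" x "basis_vec c" "basis_vec d"]
      unfolding B_def w_def k tensor_basis linear_map_add[OF linear_triple_act]
      by (simp add: algebra_simps)
  qed
  ultimately have "B r r = 0" by (rule skew_quadratic_zero[OF _ _ r])
  then show ?thesis by (simp add: B_def w_def inner_der_def[abs_def] cyb_eq_form)
qed

definition swap12 :: "('b \<times> 'b \<times> 'b \<Rightarrow>\<^sub>0 complex) \<Rightarrow> ('b \<times> 'b \<times> 'b \<Rightarrow>\<^sub>0 complex)"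
  where "swap12 = lin_ext (\<lambda>(a, b, c). basis_vec (b, a, c))"

lemma linear_swap12: "linear_map swap12"
  by (simp add: swap12_def linear_lin_ext)

lemma swap12_tensor: "swap12 (a \<otimes> b \<otimes> c) = b \<otimes> a \<otimes> c"
proof (rule linear_eqI[where f = "\<lambda>a. swap12 (a \<otimes> b \<otimes> c)"])
  show "linear_map (\<lambda>a. swap12 (a \<otimes> b \<otimes> c))" "linear_map (\<lambda>a. b \<otimes> a \<otimes> c)"
    by (intro linear_intros linear_map_comp[OF linear_swap12])+
  fix a
  show "swap12 (basis_vec a \<otimes> b \<otimes> c) = b \<otimes> basis_vec a \<otimes> c"
  proof (rule bilinear_eqI[where B = "\<lambda>b c. swap12 (basis_vec a \<otimes> b \<otimes> c)"])
    show "bilinear_map (\<lambda>b c. swap12 (basis_vec a \<otimes> b \<otimes> c))"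
      by (intro bilinear_mapI linear_intros linear_map_comp[OF linear_swap12])
    show "bilinear_map (\<lambda>b c. b \<otimes> basis_vec a \<otimes> c)"
      by (intro bilinear_mapI linear_intros)
  qed (simp add: swap12_def)
qed

text \<open>
  For skew \<open>r\<close> the transposition of the first two positions exchanges \<open>[r\<^sub>1\<^sub>2, r\<^sub>1\<^sub>3]\<close> with
  \<open>-[r\<^sub>1\<^sub>2, r\<^sub>2\<^sub>3]\<close> and negates \<open>[r\<^sub>1\<^sub>3, r\<^sub>2\<^sub>3]\<close>, because \<open>r\<^sub>2\<^sub>1 = -r\<^sub>1\<^sub>2\<close>.
\<close>

lemma cyb_swap12:
  assumes br: "lie_algebra br" and r: "r \<in> skew_tensors"
  shows "swap12 (cyb br r) = - cyb br r"
proof -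
  define B where "B p q = cyb_form br p q + swap12 (cyb_form br p q)" for p q
  have "bilinear_map B"
    unfolding B_def
    by (intro bilinear_mapI linear_map_plus linear_map_comp[OF linear_swap12] linear_cyb_form)
  moreover have "B (basis_vec (a, b) - basis_vec (b, a)) (basis_vec (c, d) - basis_vec (d, c)) +
      B (basis_vec (c, d) - basis_vec (d, c)) (basis_vec (a, b) - basis_vec (b, a)) = 0" for a b c d
  proof -
    let ?a = "basis_vec a" and ?b = "basis_vec b" and ?c = "basis_vec c" and ?d = "basis_vec d"
    have form: "cyb_form br (basis_vec (a, b)) (basis_vec (c, d)) =
      cyb_term br (basis_vec a) (basis_vec b) (basis_vec c) (basis_vec d)" for a b c d
      by (simp add: cyb_form_def)
    have flips: "br ?c ?a = - br ?a ?c" "br ?d ?a = - br ?a ?d" "br ?c ?b = - br ?b ?c" "br ?d ?b = - br ?b ?d"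
      by (rule lie_algebra_antisym[OF br])+
    show ?thesis
      unfolding B_def
      by (simp only: form linear_map_diff[OF linear_cyb_form(1)] linear_map_diff[OF linear_cyb_form(2)]
          cyb_term_def flips linear_map_add[OF linear_swap12] linear_map_diff[OF linear_swap12]
          linear_map_uminus[OF linear_tensor_left] linear_map_uminus[OF linear_tensor_right] swap12_tensor
          linear_map_uminus[OF linear_swap12])
        (simp add: algebra_simps del: tensor_basis)
  qed
  ultimately have "B r r = 0" by (rule skew_quadratic_zero[OF _ _ r])
  then show ?thesis by (simp add: B_def cyb_eq_form eq_neg_iff_add_eq_0 add.commute)
qed

section \<open>Symbols of differential operators and their tensors\<close>

text \<open>
  For \<open>z = \<Sum> t\<^sup>m f\<^sub>m(D)\<close> the pairing of \<open>ev a x\<close> with \<open>z\<close> is \<open>f\<^sub>a(x)\<close>.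
\<close>

definition ev :: "int \<Rightarrow> complex \<Rightarrow> int \<times> nat \<Rightarrow> complex"
  where "ev a x = (\<lambda>(m, n). if m = a then x ^ n else 0)"

lemma ev_apply [simp]: "ev a x (m, n) = (if m = a then x ^ n else 0)"
  by (simp add: ev_def)

lemma polyfun_ev: "polyfun (\<lambda>x. ev a x b)"
  using polyfun_power[OF polyfun_ident] by (cases b; cases "fst b = a") auto

lemma separating_ev: "separating {ev a x | a x. True}"
  unfolding separating_def
proof safe
  fix u :: diffop
  assume 0: "\<forall>f\<in>{ev a x | a x. True}. pairing f u = 0"
  show "u = 0"
  proof (rule poly_mapping_eqI)
    fix k :: "int \<times> nat"
    obtain m n where k: "k = (m, n)" by fastforce
    define q where "q = (\<Sum>b\<in>Poly_Mapping.keys u. if fst b = m then monom (Poly_Mapping.lookup u b) (snd b) else 0)"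
    have "poly q x = pairing (ev m x) u" for x
      unfolding q_def poly_sum pairing_def
      by (rule sum.cong) (auto simp: poly_monom)
    then have "poly q = poly 0" using 0 by force
    then have "q = 0" by (simp only: poly_eq_poly_eq_iff)
    moreover have "coeff q n = (\<Sum>b\<in>Poly_Mapping.keys u. if b = (m, n) then Poly_Mapping.lookup u b else 0)"
      unfolding q_def coeff_sum by (rule sum.cong) auto
    ultimately show "Poly_Mapping.lookup u k = Poly_Mapping.lookup 0 k"
      by (auto simp: k in_keys_iff split: if_splits)
  qed
qed

lemma ev_eqI: "(\<And>a x. pairing (ev a x) u = pairing (ev a x) v) \<Longrightarrow> u = v"
  by (rule separating_eqI[OF separating_ev]) blast

definition op_of :: "int \<Rightarrow> complex poly \<Rightarrow> diffop"
  where "op_of a q = (\<Sum>i\<le>degree q. coeff q i *\<^sub>v basis_vec (a, i))"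

lemma ev_op_of [simp]: "pairing (ev b x) (op_of a q) = (if a = b then poly q x else 0)"
  by (simp add: op_of_def pairing_sum poly_altdef)

text \<open>
  This is \<open>[t\<^sup>m D\<^sup>n, t\<^sup>k g(D)] = t\<^sup>m\<^sup>+\<^sup>k ((D + k)\<^sup>n g(D) - D\<^sup>n g(D + m))\<close> with \<open>k = a - m\<close>: moving a
  polynomial in \<open>D\<close> past \<open>t\<^sup>k\<close> shifts its argument by \<open>k\<close>. The two sums in the definition of the
  bracket are the binomial expansions of the two products without their common leading term.
\<close>

lemma ev_bracket:
  "pairing (ev a x) (diff_bracket (basis_vec (m, n)) z) =
    (x + of_int (a - m)) ^ n * pairing (ev (a - m) x) z
    - x ^ n * pairing (ev (a - m) (x + of_int m)) z"
proof -
  have "pairing (ev a x) (diff_bracket (basis_vec (m, n)) (basis_vec b)) =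
      (x + of_int (a - m)) ^ n * ev (a - m) x b - x ^ n * ev (a - m) (x + of_int m) b" for b
  proof (cases b)
    case (Pair k l)
    show ?thesis
    proof (cases "a = m + k")
      case True
      then show ?thesis
        using binomial_tail[where k = x and n = n and x = "of_int k" and l = l]
          binomial_tail[where k = x and n = l and x = "of_int m" and l = n]
        by (simp add: Pair diff_bracket_basis pairing_sum mult_ac add_ac)
    next
      case False
      then show ?thesis
        by (auto simp: Pair diff_bracket_basis pairing_sum)
    qed
  qed
  then show ?thesis
    by (subst pairing_linear_map[OF linear_diff_bracket(1)])
      (simp add: pairing_fun_diff pairing_fun_scale)
qed

lemma tensor_fun_bracket_left:
  "pairing (tensor_fun (\<lambda>k. pairing (ev a x) (diff_bracket (basis_vec (m, n)) (basis_vec k))) h) u =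
    (x + of_int (a - m)) ^ n * pairing (tensor_fun (ev (a - m) x) h) u
    - x ^ n * pairing (tensor_fun (ev (a - m) (x + of_int m)) h) u"
  by (simp only: ev_bracket pairing_tensor_fun_combine pairing_basis)

lemma tensor_fun_bracket_right:
  "pairing (tensor_fun h (\<lambda>k. pairing (ev a x) (diff_bracket (basis_vec (m, n)) (basis_vec k)))) u =
    (x + of_int (a - m)) ^ n * pairing (tensor_fun h (ev (a - m) x)) u
    - x ^ n * pairing (tensor_fun h (ev (a - m) (x + of_int m))) u"
  by (simp only: ev_bracket pairing_tensor_fun_combine pairing_basis)

text \<open>
  The value at \<open>(x, y)\<close> of the polynomial that multiplies \<open>s\<^sup>a t\<^sup>b\<close> in \<open>u\<close>.
\<close>

abbreviation symbol2 where
  "symbol2 a b x y u \<equiv> pairing (tensor_fun (ev a x) (ev b y)) u"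

lemma symbol2_act:
  "symbol2 a b x y (diff_act (basis_vec (m, n)) u) =
    (x + of_int (a - m)) ^ n * symbol2 (a - m) b x y u - x ^ n * symbol2 (a - m) b (x + of_int m) y u
    + (y + of_int (b - m)) ^ n * symbol2 a (b - m) x y u - y ^ n * symbol2 a (b - m) x (y + of_int m) u"
  unfolding diag_act_def pairing_add pairing_tensor_map tensor_fun_bracket_left tensor_fun_bracket_right
  by simp

text \<open>
  Powers of \<open>D\<close> act on each symbol by multiplication, here with \<open>(x + a)\<^sup>2 - x\<^sup>2 + (y + b)\<^sup>2 - y\<^sup>2\<close>.
\<close>

lemma symbol2_act_square:
  "symbol2 a b x y (diff_act (basis_vec (0, 2)) u) =
    (2 * of_int a * x + of_int a ^ 2 + 2 * of_int b * y + of_int b ^ 2) * symbol2 a b x y u"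
  by (simp add: symbol2_act algebra_simps power2_eq_square)

lemma symbol2_act_cube:
  "symbol2 a b x y (diff_act (basis_vec (0, 3)) u) =
    (3 * of_int a * x ^ 2 + 3 * of_int a ^ 2 * x + of_int a ^ 3
      + 3 * of_int b * y ^ 2 + 3 * of_int b ^ 2 * y + of_int b ^ 3) * symbol2 a b x y u"
  by (simp add: symbol2_act algebra_simps power2_eq_square power3_eq_cube)

lemma symbol2_eqI: "(\<And>a b x y. symbol2 a b x y u = symbol2 a b x y v) \<Longrightarrow> u = v"
  by (rule separating_eqI[OF separating_tensor[OF separating_ev separating_ev]]) blast

lemma polyfun_symbol2_left: "polyfun (\<lambda>x. symbol2 a b x y u)"
  by (intro polyfun_pairing polyfun_tensor_fun polyfun_ev)

lemma polyfun_symbol2_right: "polyfun (\<lambda>y. symbol2 a b x y u)"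
  by (intro polyfun_pairing polyfun_tensor_fun polyfun_ev)

abbreviation symbol3 where
  "symbol3 a b c x y z u \<equiv> pairing (tensor_fun (ev a x) (tensor_fun (ev b y) (ev c z))) u"

lemma symbol3_act:
  "symbol3 a b c x y z (triple_act diff_bracket (basis_vec (m, n)) u) =
    (x + of_int (a - m)) ^ n * symbol3 (a - m) b c x y z u
    - x ^ n * symbol3 (a - m) b c (x + of_int m) y z u
    + (y + of_int (b - m)) ^ n * symbol3 a (b - m) c x y z u
    - y ^ n * symbol3 a (b - m) c x (y + of_int m) z u
    + (z + of_int (c - m)) ^ n * symbol3 a b (c - m) x y z u
    - z ^ n * symbol3 a b (c - m) x y (z + of_int m) u"
  unfolding triple_act_def pairing_add pairing_tensor_map tensor_fun_bracket_left symbol2_act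
    pairing_tensor_fun_combine pairing_basis
  by simp

lemma symbol3_eqI: "(\<And>a b c x y z. symbol3 a b c x y z u = symbol3 a b c x y z v) \<Longrightarrow> u = v"
  by (rule separating_eqI[OF separating_tensor[OF separating_ev separating_tensor[OF separating_ev separating_ev]]])
    blast

lemma polyfun_symbol3: "polyfun (\<lambda>x. symbol3 a b c x y z u)" "polyfun (\<lambda>y. symbol3 a b c x y z u)"
  "polyfun (\<lambda>z. symbol3 a b c x y z u)"
  by (intro polyfun_pairing polyfun_tensor_fun polyfun_ev)+

lemma sum_zero_power: "(\<Sum>j = Suc 0..n. (c j * (0 :: complex) ^ j) *\<^sub>v f j) = 0"
  by (rule sum.neutral) (auto simp: power_0_left)

lemma diff_bracket_D1: "diff_bracket (basis_vec (0, 1)) (basis_vec (m, n)) = of_int m *\<^sub>v basis_vec (m, n)"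
  by (simp add: diff_bracket_basis sum_zero_power)

lemma diff_bracket_D2: "diff_bracket (basis_vec (0, 2)) (basis_vec (m, n)) =
    (2 * of_int m) *\<^sub>v basis_vec (m, n + 1) + (of_int m ^ 2) *\<^sub>v basis_vec (m, n)"
  by (simp add: diff_bracket_basis sum_zero_power numeral_2_eq_2)

lemma diff_bracket_D3: "diff_bracket (basis_vec (0, 3)) (basis_vec (m, n)) =
    (3 * of_int m) *\<^sub>v basis_vec (m, n + 2) + (3 * of_int m ^ 2) *\<^sub>v basis_vec (m, n + 1) +
    (of_int m ^ 3) *\<^sub>v basis_vec (m, n)"
  by (simp add: diff_bracket_basis sum_zero_power numeral_3_eq_3 numeral_2_eq_2)

lemma diff_bracket_t: "diff_bracket (basis_vec (m, 0)) (basis_vec (k, 0)) = 0"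
  "diff_bracket (basis_vec (m, 0)) (basis_vec (k, 1)) = - (of_int m *\<^sub>v basis_vec (m + k, 0))"
  by (simp_all add: diff_bracket_basis)

text \<open>
  Bracketing with \<open>t\<^sup>m\<close> is a difference operator on polynomials. For \<open>m = 1\<close> and \<open>m = -1\<close> this
  operator is onto, so that neighbouring degrees generate each other.
\<close>

lemma bracket_t_op_of:
  "diff_bracket (basis_vec (m, 0)) (op_of k q) = op_of (m + k) (q - pcompose q [:of_int m, 1:])"
  by (rule ev_eqI) (auto simp: ev_bracket poly_pcompose add.commute)

lemma basis_vec_op_of: "(\<And>x. poly q x = x ^ n) \<Longrightarrow> basis_vec (k, n) = op_of k q"
  by (rule ev_eqI) simp

section \<open>The outer derivations\<close>

text \<open>
  Formally the commutator with \<open>log t\<close>, up to sign: the derivation \<open>d/dD\<close> of \<open>\<G>\<close>. It is the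
  infinitesimal form of the automorphisms \<open>D \<mapsto> D + c\<close>, which are formal conjugations by \<open>t\<^sup>c\<close>.
\<close>

definition log_derivation :: "diffop \<Rightarrow> diffop"
  where "log_derivation = lin_ext (\<lambda>(m, n). of_nat n *\<^sub>v basis_vec (m, n - 1))"

lemma linear_log_derivation: "linear_map log_derivation"
  by (simp add: log_derivation_def linear_lin_ext)

lemma log_derivation_basis: "log_derivation (basis_vec (m, n)) = of_nat n *\<^sub>v basis_vec (m, n - 1)"
  by (simp add: log_derivation_def)

lemma ev_log_derivation:
  "((\<lambda>x. pairing (ev a x) z) has_field_derivative pairing (ev a x) (log_derivation z)) (at x)"
proof -
  have "((\<lambda>x. ev a x b) has_field_derivative pairing (ev a x) (log_derivation (basis_vec b))) (at x)" for b
    by (cases b) (auto simp: log_derivation_basis intro!: derivative_eq_intros)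
  then show ?thesis
    unfolding pairing_linear_map[OF linear_log_derivation, of "ev a x" z] pairing_def[of _ z]
    by (intro DERIV_sum DERIV_cmult)
qed

text \<open>
  On symbols \<open>d/dD\<close> is differentiation in \<open>x\<close>, and it commutes with the shifts that occur in the
  bracket, so the claim is the product rule.
\<close>

lemma log_derivation_bracket:
  "log_derivation (diff_bracket x y) =
    diff_bracket (log_derivation x) y + diff_bracket x (log_derivation y)"
proof (rule linear_eqI[where x = x])
  note li = linear_map_plus linear_map_comp[OF linear_log_derivation]
    linear_map_comp[OF linear_diff_bracket(2)] linear_diff_bracket linear_log_derivation
  show "linear_map (\<lambda>x. log_derivation (diff_bracket x y))"
    "linear_map (\<lambda>x. diff_bracket (log_derivation x) y + diff_bracket x (log_derivation y))"
    by (intro li)+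
  fix p :: "int \<times> nat"
  obtain m n where p: "p = (m, n)" by fastforce
  show "log_derivation (diff_bracket (basis_vec p) y) =
    diff_bracket (log_derivation (basis_vec p)) y + diff_bracket (basis_vec p) (log_derivation y)"
    (is "?l = ?r")
  proof (rule ev_eqI)
    fix a x
    have shift: "((\<lambda>x. pairing (ev a (x + c)) z) has_field_derivative
        pairing (ev a (x + c)) (log_derivation z)) (at x)" for a c z
      using ev_log_derivation[of a z "x + c"] by (simp only: DERIV_shift)
    have "((\<lambda>x. (x + of_int (a - m)) ^ n * pairing (ev (a - m) x) y
          - x ^ n * pairing (ev (a - m) (x + of_int m)) y)
        has_field_derivative pairing (ev a x) ?r) (at x)"
      by (rule derivative_eq_intros ev_log_derivation shift refl)+
        (simp add: p log_derivation_basis linear_map_scale[OF linear_diff_bracket(2)] ev_bracket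
          algebra_simps)
    moreover have "((\<lambda>x. (x + of_int (a - m)) ^ n * pairing (ev (a - m) x) y
          - x ^ n * pairing (ev (a - m) (x + of_int m)) y)
        has_field_derivative pairing (ev a x) ?l) (at x)"
      using ev_log_derivation[of a "diff_bracket (basis_vec p) y" x] unfolding p ev_bracket .
    ultimately show "pairing (ev a x) ?l = pairing (ev a x) ?r"
      by (rule DERIV_unique[rotated])
  qed
qed

lemma diff_one_central [simp]: "diff_bracket diff_one x = 0" "diff_bracket x diff_one = 0"
proof -
  have "diff_one \<in> center_d" by (simp add: center_d_def pm.span_base)
  then show "diff_bracket diff_one x = 0" using center_diff by blast
  then show "diff_bracket x diff_one = 0"
    using lie_algebra_antisym[OF lie_algebra_diff, of x diff_one] by simp
qed

lemma zeta_eq: "zeta \<alpha> \<alpha>' x =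
    \<alpha> *\<^sub>v (log_derivation x \<otimes> diff_one) + \<alpha>' *\<^sub>v (diff_one \<otimes> log_derivation x)"
proof (rule linear_eqI[where x = x])
  show "linear_map (zeta \<alpha> \<alpha>')" unfolding zeta_def by (rule linear_lin_ext)
  show "linear_map (\<lambda>x. \<alpha> *\<^sub>v (log_derivation x \<otimes> diff_one) + \<alpha>' *\<^sub>v (diff_one \<otimes> log_derivation x))"
    by (rule linear_mapI)
      (simp_all add: linear_map_add[OF linear_log_derivation] linear_map_scale[OF linear_log_derivation]
        linear_map_add[OF linear_tensor_left] linear_map_add[OF linear_tensor_right]
        linear_map_scale[OF linear_tensor_left] linear_map_scale[OF linear_tensor_right]
        pm.scale_right_distrib mult.commute add_ac)
  fix p :: "int \<times> nat"
  show "zeta \<alpha> \<alpha>' (basis_vec p) = \<alpha> *\<^sub>v (log_derivation (basis_vec p) \<otimes> diff_one) +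
      \<alpha>' *\<^sub>v (diff_one \<otimes> log_derivation (basis_vec p))"
    by (cases p) (auto simp: zeta_def log_derivation_basis linear_map_scale[OF linear_tensor_left]
        linear_map_scale[OF linear_tensor_right])
qed

text \<open>
  As \<open>1\<close> is central, \<open>\<delta>(x) \<otimes> 1\<close> and \<open>1 \<otimes> \<delta>(x)\<close> are derivations whenever \<open>\<delta>\<close> is one.
\<close>

lemma zeta_in_Der: "zeta \<alpha> \<alpha>' \<in> Der diff_bracket diff_act"
proof (rule DerI)
  show "linear_map (zeta \<alpha> \<alpha>')" unfolding zeta_def by (rule linear_lin_ext)
  show "zeta \<alpha> \<alpha>' (diff_bracket x y) = diff_act x (zeta \<alpha> \<alpha>' y) - diff_act y (zeta \<alpha> \<alpha>' x)" for x y
    using lie_algebra_antisym[OF lie_algebra_diff, of "log_derivation x" y]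
    by (simp add: zeta_eq log_derivation_bracket linear_map_add[OF linear_diag_act]
        linear_map_scale[OF linear_diag_act] diag_act_tensor[OF bilinear_diff_bracket]
        linear_map_add[OF linear_tensor_left] linear_map_add[OF linear_tensor_right]
        linear_map_zero[OF linear_tensor_left] linear_map_zero[OF linear_tensor_right]
        linear_map_diff[OF linear_tensor_left] linear_map_diff[OF linear_tensor_right]
        pm.scale_right_diff_distrib)
qed

lemma zeta_add: "zeta \<alpha> \<alpha>' + zeta \<beta> \<beta>' = zeta (\<alpha> + \<beta>) (\<alpha>' + \<beta>')"
  by (simp add: fun_eq_iff zeta_eq pm.scale_left_distrib)

lemma fscale_zeta: "fscale c (zeta \<alpha> \<alpha>') = zeta (c * \<alpha>) (c * \<alpha>')"
  by (simp add: fun_eq_iff fscale_def zeta_eq pm.scale_right_distrib)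

lemma D_d_eq: "D_d = {zeta \<alpha> \<alpha>' | \<alpha> \<alpha>'. True}"
  unfolding D_d_def fm.span_eq_iff
proof (rule fm.subspaceI)
  have "0 = zeta 0 0" by (simp add: fun_eq_iff zeta_eq)
  then show "0 \<in> {zeta \<alpha> \<alpha>' | \<alpha> \<alpha>'. True}" by blast
qed (use zeta_add fscale_zeta in blast)+

lemma twist_zeta: "twist (zeta \<alpha> \<alpha>' x) = zeta \<alpha>' \<alpha> x"
  by (simp add: zeta_eq linear_map_add[OF linear_twist] linear_map_scale[OF linear_twist]
      twist_tensor add.commute)

lemma symbol2_zeta_basis:
  "symbol2 a b x y (zeta \<alpha> \<alpha>' (basis_vec (m, n))) =
    (if a = m \<and> b = 0 then \<alpha> * of_nat n * x ^ (n - 1) else 0) +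
    (if a = 0 \<and> b = m then \<alpha>' * of_nat n * y ^ (n - 1) else 0)"
  by (auto simp: zeta_eq log_derivation_basis diff_one_def linear_map_scale[OF linear_tensor_left]
      linear_map_scale[OF linear_tensor_right])

lemma symbol2_zeta: "symbol2 0 0 x y (zeta \<alpha> \<alpha>' (basis_vec (0, 2))) = 2 * \<alpha> * x + 2 * \<alpha>' * y"
  by (simp add: symbol2_zeta_basis)

lemma inner_diff_in_Der: "(\<lambda>x. diff_act x v) \<in> Der diff_bracket diff_act"
  by (rule inner_in_Der[OF lie_algebra_diff])

text \<open>
  The factor by which \<open>D\<^sup>2\<close> acts on the symbol at \<open>(0, 0)\<close> is zero, whereas \<open>\<zeta>(D\<^sup>2)\<close> has there the
  symbol \<open>2 \<alpha> x + 2 \<alpha>' y\<close>.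
\<close>

lemma Inn_Int_D_d: "Inn diff_act \<inter> D_d = {0}"
proof -
  have "\<phi> = 0" if inn: "\<phi> \<in> Inn diff_act" and d: "\<phi> \<in> D_d" for \<phi>
  proof -
    obtain v where v: "\<phi> = (\<lambda>x. diff_act x v)" using inn by (auto simp: Inn_def)
    obtain \<alpha> \<alpha>' where z: "\<phi> = zeta \<alpha> \<alpha>'" using d by (auto simp: D_d_eq)
    have "2 * \<alpha> * x + 2 * \<alpha>' * y = 0" for x y
      using symbol2_act[of 0 x 0 y 0 2 v] symbol2_zeta[of x y \<alpha> \<alpha>'] fun_cong[OF trans[OF v[symmetric] z]]
      by simp
    from this[of 1 0] this[of 0 1] show ?thesis by (simp add: z fun_eq_iff zeta_eq)
  qed
  moreover have "0 \<in> Inn diff_act" by (rule fm.subspace_0[OF subspace_Inn])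
  moreover have "0 \<in> D_d" by (simp add: D_d_def fm.span_zero)
  ultimately show ?thesis by blast
qed

section \<open>Invariant tensors\<close>

lemma linear_root: "(b :: complex) \<noteq> 0 \<Longrightarrow> y \<noteq> - s / (2 * b) \<Longrightarrow> s + 2 * b * y \<noteq> 0"
proof
  assume b: "b \<noteq> 0" and y: "y \<noteq> - s / (2 * b)" and 0: "s + 2 * b * y = 0"
  then have "2 * b * y = - s" by (simp add: add_eq_0_iff)
  then have "y = - s / (2 * b)" using b by (metis mult_eq_0_iff nonzero_mult_div_cancel_left zero_neq_numeral)
  then show False using y by contradiction
qed

text \<open>
  Invariance under \<open>D\<close> and \<open>D\<^sup>2\<close> kills all symbols except the one at \<open>(0, 0)\<close>, since the factors by
  which these elements act are nonzero polynomials; invariance under \<open>t\<close> makes the remaining symbol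
  periodic in each variable.
\<close>

lemma diff_invariants2:
  assumes inv: "\<And>X. diff_act X u = 0"
  shows "\<exists>c. u = c *\<^sub>v (diff_one \<otimes> diff_one)"
proof -
  have act: "(x + of_int (a - m)) ^ n * symbol2 (a - m) b x y u - x ^ n * symbol2 (a - m) b (x + of_int m) y u
    + (y + of_int (b - m)) ^ n * symbol2 a (b - m) x y u - y ^ n * symbol2 a (b - m) x (y + of_int m) u = 0"
    for a b m n x y
    using symbol2_act[of a x b y m n u] inv by simp
  have off: "symbol2 a b x y u = 0" if ab: "a \<noteq> 0 \<or> b \<noteq> 0" for a b x y
  proof (cases "b = 0")
    case True
    have "of_int a * symbol2 a b x y u = 0"
      using act[of x a 0 1 b y] True by (simp add: algebra_simps)
    then show ?thesis using True ab by simp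
  next
    case False
    have *: "(2 * of_int a * x + of_int a ^ 2 + 2 * of_int b * y + of_int b ^ 2) * symbol2 a b x y u = 0" for y
      using act[of x a 0 2 b y] by (simp add: algebra_simps power2_eq_square)
    show ?thesis
    proof (rule polyfun_zero_if_almost[OF polyfun_symbol2_right])
      let ?z = "- (2 * of_int a * x + of_int a ^ 2 + of_int b ^ 2) / (2 * of_int b)"
      show "finite {?z}" by simp
      fix y assume "y \<notin> {?z}"
      then have "2 * of_int a * x + of_int a ^ 2 + 2 * of_int b * y + of_int b ^ 2 \<noteq> 0"
        using linear_root[of "of_int b" y "2 * of_int a * x + of_int a ^ 2 + of_int b ^ 2"] False
        by (simp add: algebra_simps)
      then show "symbol2 a b x y u = 0" using *[of y] by simp
    qed
  qed
  have "symbol2 0 0 (x + 1) y u = symbol2 0 0 x y u" for x y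
    using act[of x 1 1 0 0 y] off[of 1 "-1"] by simp
  then have x: "symbol2 0 0 x y u = symbol2 0 0 0 y u" for x y
    by (intro polyfun_periodic_const[OF polyfun_symbol2_left, of 1]) auto
  have "symbol2 0 0 x (y + 1) u = symbol2 0 0 x y u" for x y
    using act[of x 0 1 0 1 y] off[of "-1" 1] by simp
  then have y: "symbol2 0 0 x y u = symbol2 0 0 x 0 u" for x y
    by (intro polyfun_periodic_const[OF polyfun_symbol2_right, of 1]) auto
  have "u = symbol2 0 0 0 0 u *\<^sub>v (diff_one \<otimes> diff_one)"
  proof (rule symbol2_eqI)
    fix a b x y
    show "symbol2 a b x y u = symbol2 a b x y (symbol2 0 0 0 0 u *\<^sub>v (diff_one \<otimes> diff_one))"
      using x[of x y] y[of 0 y] off[of a b x y]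
      by (cases "a = 0 \<and> b = 0") (auto simp: diff_one_def)
  qed
  then show ?thesis by blast
qed

text \<open>
  The argument for two factors carries over.
\<close>

lemma diff_invariants3:
  assumes inv: "\<And>X. triple_act diff_bracket X u = 0"
  shows "\<exists>c. u = c *\<^sub>v (diff_one \<otimes> diff_one \<otimes> diff_one)"
proof -
  have act: "(x + of_int (a - m)) ^ n * symbol3 (a - m) b c x y z u
    - x ^ n * symbol3 (a - m) b c (x + of_int m) y z u
    + (y + of_int (b - m)) ^ n * symbol3 a (b - m) c x y z u
    - y ^ n * symbol3 a (b - m) c x (y + of_int m) z u
    + (z + of_int (c - m)) ^ n * symbol3 a b (c - m) x y z u
    - z ^ n * symbol3 a b (c - m) x y (z + of_int m) u = 0"
    for a b c m n x y z
    using symbol3_act[of a x b y c z m n u] inv by simp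
  have sq: "(2 * of_int a * x + of_int a ^ 2 + 2 * of_int b * y + of_int b ^ 2
      + 2 * of_int c * z + of_int c ^ 2) * symbol3 a b c x y z u = 0" for a b c x y z
    using act[of x a 0 2 b y c z] by (simp add: algebra_simps power2_eq_square)
  have off: "symbol3 a b c x y z u = 0" if abc: "a \<noteq> 0 \<or> b \<noteq> 0 \<or> c \<noteq> 0" for a b c x y z
  proof -
    consider "c \<noteq> 0" | "b \<noteq> 0" | "a \<noteq> 0" "b = 0" "c = 0" using abc by blast
    then show ?thesis
    proof cases
      case 1
      let ?s = "2 * of_int a * x + of_int a ^ 2 + 2 * of_int b * y + of_int b ^ 2 + of_int c ^ 2"
      show ?thesis
      proof (rule polyfun_zero_if_almost[OF polyfun_symbol3(3)])
        show "finite {- ?s / (2 * of_int c)}" by simp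
        fix z assume "z \<notin> {- ?s / (2 * of_int c)}"
        then have "?s + 2 * of_int c * z \<noteq> 0"
          using 1 by (intro linear_root) auto
        moreover have "(?s + 2 * of_int c * z) * symbol3 a b c x y z u = 0"
          using sq[of a x b y c z] by (simp add: algebra_simps)
        ultimately show "symbol3 a b c x y z u = 0" by simp
      qed
    next
      case 2
      let ?s = "2 * of_int a * x + of_int a ^ 2 + of_int b ^ 2 + 2 * of_int c * z + of_int c ^ 2"
      show ?thesis
      proof (rule polyfun_zero_if_almost[OF polyfun_symbol3(2)])
        show "finite {- ?s / (2 * of_int b)}" by simp
        fix y assume "y \<notin> {- ?s / (2 * of_int b)}"
        then have "?s + 2 * of_int b * y \<noteq> 0"
          using 2 by (intro linear_root) auto
        moreover have "(?s + 2 * of_int b * y) * symbol3 a b c x y z u = 0"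
          using sq[of a x b y c z] by (simp add: algebra_simps)
        ultimately show "symbol3 a b c x y z u = 0" by simp
      qed
    next
      case 3
      have "of_int a * symbol3 a b c x y z u = 0"
        using act[of x a 0 1 b y c z] 3 by (simp add: algebra_simps)
      then show ?thesis using 3 by simp
    qed
  qed
  have "symbol3 0 0 0 (x + 1) y z u = symbol3 0 0 0 x y z u" for x y z
    using act[of x 1 1 0 0 y 0 z] off[of 1 "-1"] off[of 1 0 "-1"] by simp
  then have x: "symbol3 0 0 0 x y z u = symbol3 0 0 0 0 y z u" for x y z
    by (intro polyfun_periodic_const[OF polyfun_symbol3(1), of 1]) auto
  have "symbol3 0 0 0 x (y + 1) z u = symbol3 0 0 0 x y z u" for x y z
    using act[of x 0 1 0 1 y 0 z] off[of "-1" 1] off[of 0 1 "-1"] by simp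
  then have y: "symbol3 0 0 0 x y z u = symbol3 0 0 0 x 0 z u" for x y z
    by (intro polyfun_periodic_const[OF polyfun_symbol3(2), of 1]) auto
  have "symbol3 0 0 0 x y (z + 1) u = symbol3 0 0 0 x y z u" for x y z
    using act[of x 0 1 0 0 y 1 z] off[of "-1" 0 1] off[of 0 "-1" 1] by simp
  then have z: "symbol3 0 0 0 x y z u = symbol3 0 0 0 x y 0 u" for x y z
    by (intro polyfun_periodic_const[OF polyfun_symbol3(3), of 1]) auto
  have "u = symbol3 0 0 0 0 0 0 u *\<^sub>v (diff_one \<otimes> diff_one \<otimes> diff_one)"
  proof (rule symbol3_eqI)
    fix a b c x y z
    show "symbol3 a b c x y z u = symbol3 a b c x y z (symbol3 0 0 0 0 0 0 u *\<^sub>v (diff_one \<otimes> diff_one \<otimes> diff_one))"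
      using x[of x y z] y[of 0 y z] z[of 0 0 z] off[of a b c x y z]
      by (cases "a = 0 \<and> b = 0 \<and> c = 0") (auto simp: diff_one_def)
  qed
  then show ?thesis by blast
qed

section \<open>Derivations of degree zero\<close>

text \<open>
  The symbol at \<open>(a, b)\<close> of the value of \<open>\<phi>\<close> at \<open>t\<^sup>m D\<^sup>n\<close>.
\<close>

abbreviation der_symbol where
  "der_symbol \<phi> m n a b x y \<equiv> symbol2 a b x y (\<phi> (basis_vec (m, n)))"

definition homogeneous :: "(diffop \<Rightarrow> ((int \<times> nat) \<times> (int \<times> nat) \<Rightarrow>\<^sub>0 complex)) \<Rightarrow> bool"
  where "homogeneous \<phi> \<longleftrightarrow> (\<forall>m n a b x y. a + b \<noteq> m \<longrightarrow> der_symbol \<phi> m n a b x y = 0)"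

lemma homogeneous_diff: "homogeneous \<phi> \<Longrightarrow> homogeneous \<psi> \<Longrightarrow> homogeneous (\<phi> - \<psi>)"
  by (simp add: homogeneous_def)

lemma homogeneous_inner:
  assumes "\<And>a b x y. a + b \<noteq> 0 \<Longrightarrow> symbol2 a b x y v = 0"
  shows "homogeneous (\<lambda>x. diff_act x v)"
  unfolding homogeneous_def
proof (intro allI impI)
  fix m a b :: int and n x y
  assume "a + b \<noteq> m"
  then have "a - m + b \<noteq> 0" "a + (b - m) \<noteq> 0" by auto
  then have "symbol2 (a - m) b x y v = 0" and "symbol2 a (b - m) x y v = 0" for x y
    using assms by blast+
  then show "der_symbol (\<lambda>x. diff_act x v) m n a b x y = 0"
    unfolding symbol2_act by simp
qed

text \<open>
  Apply \<open>\<phi>\<close> to \<open>[D\<^sup>2, t\<^sup>m D\<^sup>n] = 2m t\<^sup>m D\<^sup>n\<^sup>+\<^sup>1 + m\<^sup>2 t\<^sup>m D\<^sup>n\<close>. For \<open>m \<noteq> 0\<close> this determines the symbols of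
  \<open>\<phi>(t\<^sup>m D\<^sup>n\<^sup>+\<^sup>1)\<close> from those of \<open>\<phi>(t\<^sup>m D\<^sup>n)\<close> and of \<open>\<phi>(D\<^sup>2)\<close>.
\<close>

lemma derivation_Cartan_square:
  assumes \<phi>: "\<phi> \<in> Der diff_bracket diff_act"
  shows "2 * of_int m * der_symbol \<phi> m (n + 1) a b x y + of_int m ^ 2 * der_symbol \<phi> m n a b x y =
    (2 * of_int a * x + of_int a ^ 2 + 2 * of_int b * y + of_int b ^ 2) * der_symbol \<phi> m n a b x y
    - ((x + of_int (a - m)) ^ n * der_symbol \<phi> 0 2 (a - m) b x y - x ^ n * der_symbol \<phi> 0 2 (a - m) b (x + of_int m) y
      + (y + of_int (b - m)) ^ n * der_symbol \<phi> 0 2 a (b - m) x y - y ^ n * der_symbol \<phi> 0 2 a (b - m) x (y + of_int m))"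
proof -
  have "2 * of_int m * der_symbol \<phi> m (n + 1) a b x y + of_int m ^ 2 * der_symbol \<phi> m n a b x y =
      symbol2 a b x y (\<phi> (diff_bracket (basis_vec (0, 2)) (basis_vec (m, n))))"
    unfolding diff_bracket_D2 linear_map_add[OF Der_linear[OF \<phi>]] linear_map_scale[OF Der_linear[OF \<phi>]] by simp
  then show ?thesis
    unfolding Der_bracket[OF \<phi>] pairing_diff symbol2_act_square symbol2_act[of a x b y m n] .
qed

text \<open>
  The same with \<open>D\<^sup>3\<close>. Combined with two instances for \<open>D\<^sup>2\<close> it is a compatibility condition.
\<close>

lemma derivation_Cartan_cube:
  assumes \<phi>: "\<phi> \<in> Der diff_bracket diff_act"
  shows "3 * of_int m * der_symbol \<phi> m (n + 2) a b x y + 3 * of_int m ^ 2 * der_symbol \<phi> m (n + 1) a b x y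
      + of_int m ^ 3 * der_symbol \<phi> m n a b x y =
    (3 * of_int a * x ^ 2 + 3 * of_int a ^ 2 * x + of_int a ^ 3
      + 3 * of_int b * y ^ 2 + 3 * of_int b ^ 2 * y + of_int b ^ 3) * der_symbol \<phi> m n a b x y
    - ((x + of_int (a - m)) ^ n * der_symbol \<phi> 0 3 (a - m) b x y - x ^ n * der_symbol \<phi> 0 3 (a - m) b (x + of_int m) y
      + (y + of_int (b - m)) ^ n * der_symbol \<phi> 0 3 a (b - m) x y - y ^ n * der_symbol \<phi> 0 3 a (b - m) x (y + of_int m))"
proof -
  have "3 * of_int m * der_symbol \<phi> m (n + 2) a b x y + 3 * of_int m ^ 2 * der_symbol \<phi> m (n + 1) a b x y
      + of_int m ^ 3 * der_symbol \<phi> m n a b x y =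
      symbol2 a b x y (\<phi> (diff_bracket (basis_vec (0, 3)) (basis_vec (m, n))))"
    unfolding diff_bracket_D3 linear_map_add[OF Der_linear[OF \<phi>]] linear_map_scale[OF Der_linear[OF \<phi>]] by simp
  then show ?thesis
    unfolding Der_bracket[OF \<phi>] pairing_diff symbol2_act_cube symbol2_act[of a x b y m n] .
qed

text \<open>
  Division of each component by its total degree. In degree zero the value \<open>inverse 0 = 0\<close> discards
  the component.
\<close>

definition degree_inverse :: "((int \<times> nat) \<times> (int \<times> nat) \<Rightarrow>\<^sub>0 complex) \<Rightarrow> ((int \<times> nat) \<times> (int \<times> nat) \<Rightarrow>\<^sub>0 complex)"
  where "degree_inverse = lin_ext (\<lambda>p. inverse (of_int (fst (fst p) + fst (snd p))) *\<^sub>v basis_vec p)"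

lemma symbol2_degree_inverse:
  "symbol2 a b x y (degree_inverse u) = inverse (of_int (a + b)) * symbol2 a b x y u"
proof -
  have "(\<lambda>p. symbol2 a b x y (degree_inverse (basis_vec p))) =
      (\<lambda>p. inverse (of_int (a + b)) * tensor_fun (ev a x) (ev b y) p)"
    by (rule ext) (auto simp: degree_inverse_def)
  moreover have "linear_map degree_inverse" by (simp add: degree_inverse_def linear_lin_ext)
  ultimately show ?thesis
    using pairing_linear_map[of degree_inverse] by (metis pairing_fun_scale)
qed

text \<open>
  For a part \<open>\<phi>\<^sub>k\<close> of degree \<open>k\<close>, the bracket \<open>[D, x] = m x\<close> with \<open>x\<close> of degree \<open>m\<close> yields
  \<open>k \<phi>\<^sub>k(x) = x \<cdot> \<phi>\<^sub>k(D)\<close>. So \<open>\<phi>\<^sub>k\<close> is inner for \<open>k \<noteq> 0\<close>, and only the finitely many \<open>k\<close> that occur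
  in \<open>\<phi>(D)\<close> contribute.
\<close>

lemma derivation_homogeneous_mod_inner:
  assumes \<phi>: "\<phi> \<in> Der diff_bracket diff_act"
  shows "\<exists>v. homogeneous (\<phi> - (\<lambda>x. diff_act x v))"
proof
  let ?v = "degree_inverse (\<phi> (basis_vec (0, 1)))"
  show "homogeneous (\<phi> - (\<lambda>x. diff_act x ?v))"
    unfolding homogeneous_def
  proof (intro allI impI)
    fix m a b :: int and n x y
    assume ab: "a + b \<noteq> m"
    have "of_int m * der_symbol \<phi> m n a b x y =
        symbol2 a b x y (\<phi> (diff_bracket (basis_vec (0, 1)) (basis_vec (m, n))))"
      unfolding diff_bracket_D1 linear_map_scale[OF Der_linear[OF \<phi>]] by simp
    also have "\<dots> = (of_int a + of_int b) * der_symbol \<phi> m n a b x y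
        - symbol2 a b x y (diff_act (basis_vec (m, n)) (\<phi> (basis_vec (0, 1))))"
      unfolding Der_bracket[OF \<phi>] pairing_diff symbol2_act[of a x b y 0 1] by (simp add: algebra_simps)
    finally have *: "symbol2 a b x y (diff_act (basis_vec (m, n)) (\<phi> (basis_vec (0, 1)))) =
        of_int (a + b - m) * der_symbol \<phi> m n a b x y"
      by (simp add: algebra_simps)
    have eq: "a - m + b = a + b - m" "a + (b - m) = a + b - m" by simp_all
    have "symbol2 a b x y (diff_act (basis_vec (m, n)) ?v) = inverse (of_int (a + b - m)) *
        symbol2 a b x y (diff_act (basis_vec (m, n)) (\<phi> (basis_vec (0, 1))))"
      unfolding symbol2_act symbol2_degree_inverse eq by (simp only: algebra_simps)
    also have "\<dots> = der_symbol \<phi> m n a b x y"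
    proof -
      have "(of_int (a + b - m) :: complex) \<noteq> 0" using ab by (simp only: of_int_eq_0_iff)
      then show ?thesis unfolding * by simp
    qed
    finally show "der_symbol (\<phi> - (\<lambda>x. diff_act x ?v)) m n a b x y = 0" by simp
  qed
qed

section \<open>Removing the flip components\<close>

text \<open>
  The bracket \<open>[D\<^sup>2, D\<^sup>3] = 0\<close> gives this relation multiplied by \<open>p(x - y + p)\<close>.
\<close>

lemma derivation_Cartan_compatible:
  assumes \<phi>: "\<phi> \<in> Der diff_bracket diff_act" and p: "p \<noteq> 0"
  shows "2 * der_symbol \<phi> 0 3 p (- p) x y = 3 * (x + y) * der_symbol \<phi> 0 2 p (- p) x y"
proof -
  let ?f = "\<lambda>y. 2 * der_symbol \<phi> 0 3 p (- p) x y - 3 * (x + y) * der_symbol \<phi> 0 2 p (- p) x y"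
  have poly: "polyfun ?f"
    by (intro polyfun_diff polyfun_mult polyfun_add polyfun_const polyfun_ident polyfun_symbol2_right)
  have *: "of_int p * (x - y + of_int p) * ?f y = 0" for y
    using derivation_Cartan_square[OF \<phi>, of 0 p x "- p" y 3]
    by (simp add: algebra_simps power2_eq_square power3_eq_cube)
  have "?f y = 0"
  proof (rule polyfun_zero_if_almost[OF poly])
    show "finite {x + of_int p}" by simp
    fix y assume "y \<notin> {x + of_int p}"
    then have "x - y + of_int p \<noteq> 0" by (auto simp: algebra_simps)
    then show "?f y = 0" using *[of y] p by simp
  qed
  then show ?thesis by simp
qed

lemma symbol2_finite_support:
  "\<exists>A. finite A \<and> (\<forall>a b x y. a \<notin> A \<longrightarrow> symbol2 a b x y u = 0)"
proof (intro exI conjI allI impI)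
  let ?A = "(\<lambda>k. fst (fst k)) ` Poly_Mapping.keys u"
  show "finite ?A" by simp
  fix a b x y assume "a \<notin> ?A"
  then show "symbol2 a b x y u = 0"
    unfolding pairing_def by (intro sum.neutral) (auto simp: tensor_fun_def image_iff Ball_def)
qed

text \<open>
  Choose \<open>m\<close> outside a finite set such that \<open>\<phi>(D\<^sup>2)\<close> and \<open>\<phi>(D\<^sup>3)\<close> have no symbol at
  \<open>(p - m, m - p)\<close>, and look at the symbols of \<open>\<phi>(t\<^sup>m)\<close>, \<open>\<phi>(t\<^sup>m D)\<close>, \<open>\<phi>(t\<^sup>m D\<^sup>2)\<close> at \<open>(p, m - p)\<close>.
  On the line \<open>y = x + p\<close> powers of \<open>D\<close> act there exactly as they act on \<open>t\<^sup>m\<close> itself. Hence these symbols cancel from the compatibility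
  condition, and what is left is \<open>m - p\<close> times the symbol of \<open>\<phi>(D\<^sup>2)\<close>.
\<close>

lemma derivation_flip_residue_zero:
  assumes \<phi>: "\<phi> \<in> Der diff_bracket diff_act" and p: "p \<noteq> 0"
  shows "der_symbol \<phi> 0 2 p (- p) x (x + of_int p) = 0"
proof -
  obtain A where A: "finite A" "\<And>a b x y. a \<notin> A \<Longrightarrow> der_symbol \<phi> 0 2 a b x y = 0"
    using symbol2_finite_support[of "\<phi> (basis_vec (0, 2))"] by metis
  have "\<exists>m. m \<notin> {0, p} \<union> (\<lambda>a. p - a) ` A"
    by (rule ex_new_if_finite[OF infinite_UNIV_int]) (use A(1) in simp)
  then obtain m where m: "m \<notin> {0, p} \<union> (\<lambda>a. p - a) ` A" by blast
  then have m0: "m \<noteq> 0" "m \<noteq> p" by simp_all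
  have mA: "p - m \<notin> A"
  proof
    assume "p - m \<in> A"
    then have "p - (p - m) \<in> (\<lambda>a. p - a) ` A" by (rule imageI)
    then show False using m by simp
  qed
  have off2: "der_symbol \<phi> 0 2 (p - m) (m - p) x y = 0" for x y
    by (rule A(2)[OF mA])
  have off3: "der_symbol \<phi> 0 3 (p - m) (m - p) x y = 0" for x y
    using derivation_Cartan_compatible[OF \<phi>, of "p - m" x y] off2[of x y] m0 by simp
  define y where "y = x + of_int p"
  define M P :: complex where "M = of_int m" and "P = of_int p"
  (* g and h are symbols at (p, -p) on the line; g' and h' are their shifts by m, which t^m produces. *)
  define g g' where "g = der_symbol \<phi> 0 2 p (- p) x y" and "g' = der_symbol \<phi> 0 2 p (- p) x (y + of_int m)"
  define h h' where "h = der_symbol \<phi> 0 3 p (- p) x y" and "h' = der_symbol \<phi> 0 3 p (- p) x (y + of_int m)"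
  define f where "f n = der_symbol \<phi> m n p (m - p) x y" for n
  have eq: "m - p - m = - p" by simp
  have 1: "2 * M * f 1 + M\<^sup>2 * f 0 = (2 * M * x + M\<^sup>2) * f 0 - (g - g')"
  proof -
    have "2 * M * f 1 + M\<^sup>2 * f 0 =
        (2 * P * x + P\<^sup>2 + 2 * (M - P) * y + (M - P)\<^sup>2) * f 0 - (g - g')"
      using derivation_Cartan_square[OF \<phi>, of m p x "m - p" y 0]
      unfolding off2 eq f_def g_def g'_def M_def P_def by simp
    then show ?thesis unfolding y_def P_def[symmetric] by (simp add: algebra_simps power2_eq_square)
  qed
  have 2: "2 * M * f 2 + M\<^sup>2 * f 1 = (2 * M * x + M\<^sup>2) * f 1 - (x * g - (x + P) * g')"
  proof -
    have "2 * M * f 2 + M\<^sup>2 * f 1 =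
        (2 * P * x + P\<^sup>2 + 2 * (M - P) * y + (M - P)\<^sup>2) * f 1 - ((y - P) * g - y * g')"
      using derivation_Cartan_square[OF \<phi>, of m p x "m - p" y 1]
      unfolding off2 eq f_def g_def g'_def M_def P_def by (simp add: numeral_2_eq_2)
    then show ?thesis unfolding y_def P_def[symmetric] by (simp add: algebra_simps power2_eq_square)
  qed
  have 3: "3 * M * f 2 + 3 * M\<^sup>2 * f 1 + M ^ 3 * f 0 = (3 * M * x\<^sup>2 + 3 * M\<^sup>2 * x + M ^ 3) * f 0 - (h - h')"
  proof -
    have "3 * M * f 2 + 3 * M\<^sup>2 * f 1 + M ^ 3 * f 0 = (3 * P * x\<^sup>2 + 3 * P\<^sup>2 * x + P ^ 3
        + 3 * (M - P) * y\<^sup>2 + 3 * (M - P)\<^sup>2 * y + (M - P) ^ 3) * f 0 - (h - h')"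
      using derivation_Cartan_cube[OF \<phi>, of m p x "m - p" y 0]
      unfolding off3 eq f_def h_def h'_def M_def P_def by (simp add: numeral_2_eq_2)
    then show ?thesis unfolding y_def P_def[symmetric]
      by (simp add: algebra_simps power2_eq_square power3_eq_cube)
  qed
  have "2 * h = 3 * (x + y) * g" "2 * h' = 3 * (x + (y + of_int m)) * g'"
    unfolding h_def g_def h'_def g'_def by (rule derivation_Cartan_compatible[OF \<phi> p])+
  then have h: "2 * h = 3 * (2 * x + P) * g" "2 * h' = 3 * (2 * x + P + M) * g'"
    by (simp_all add: y_def P_def M_def algebra_simps)
  (* Elimination of f 2 and f 1 from 3 by means of 2 and 1; f 0 cancels as well. *)
  have "3 * ((M - P) * g) =
      3 * (M + x) * (2 * M * f 1 + M\<^sup>2 * f 0 - ((2 * M * x + M\<^sup>2) * f 0 - (g - g')))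
      + 3 * (2 * M * f 2 + M\<^sup>2 * f 1 - ((2 * M * x + M\<^sup>2) * f 1 - (x * g - (x + P) * g')))
      - 2 * (3 * M * f 2 + 3 * M\<^sup>2 * f 1 + M ^ 3 * f 0
        - ((3 * M * x\<^sup>2 + 3 * M\<^sup>2 * x + M ^ 3) * f 0 - (h - h')))
      + (2 * h - 3 * (2 * x + P) * g) - (2 * h' - 3 * (2 * x + P + M) * g')"
    by (simp add: algebra_simps power2_eq_square power3_eq_cube)
  then have "(M - P) * g = 0"
    unfolding 1 2 3 h by simp
  moreover have "M \<noteq> P" using m0 by (simp add: M_def P_def)
  ultimately show ?thesis by (simp add: g_def y_def)
qed

text \<open>
  The quotient of \<open>F(x, y) - F(x, x + a)\<close> by \<open>2a(x - y + a)\<close> on each symbol \<open>F\<close> at \<open>(a, -a)\<close>, written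
  out on monomials by means of the geometric sum for \<open>y\<^sup>j - (x + a)\<^sup>j\<close>.
\<close>

definition flip_quotient :: "((int \<times> nat) \<times> (int \<times> nat) \<Rightarrow>\<^sub>0 complex) \<Rightarrow> ((int \<times> nat) \<times> (int \<times> nat) \<Rightarrow>\<^sub>0 complex)"
  where "flip_quotient = lin_ext (\<lambda>((a, i), (b, j)). if a \<noteq> 0 \<and> b = - a then
    (- 1 / (2 * of_int a)) *\<^sub>v
      (\<Sum>l<j. op_of a (monom 1 i * [:of_int a, 1:] ^ (j - Suc l)) \<otimes> basis_vec (b, l)) else 0)"

lemma linear_flip_quotient: "linear_map flip_quotient"
  by (simp add: flip_quotient_def linear_lin_ext)

lemma symbol2_flip_quotient:
  assumes a: "a \<noteq> 0"
  shows "2 * of_int a * (x - y + of_int a) * symbol2 a (- a) x y (flip_quotient u) =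
    symbol2 a (- a) x y u - symbol2 a (- a) x (x + of_int a) u"
proof -
  have "2 * of_int a * (x - y + of_int a) * symbol2 a (- a) x y (flip_quotient (basis_vec p)) =
      tensor_fun (ev a x) (ev (- a) y) p - tensor_fun (ev a x) (ev (- a) (x + of_int a)) p" for p
  proof -
    obtain a' i b' j where p: "p = ((a', i), (b', j))" by (metis surj_pair)
    show ?thesis
    proof (cases "a' = a \<and> b' = - a")
      case True
      define S where "S = (\<Sum>l<j. (x + of_int a) ^ (j - Suc l) * y ^ l)"
      have "symbol2 a (- a) x y (flip_quotient (basis_vec p)) = (- 1 / (2 * of_int a)) * (x ^ i * S)"
        using a True by (simp add: p S_def flip_quotient_def pairing_sum poly_monom add.commute
            sum_distrib_left mult.assoc sum_negf)
      then have "2 * of_int a * (x - y + of_int a) * symbol2 a (- a) x y (flip_quotient (basis_vec p)) =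
          x ^ i * ((y - (x + of_int a)) * S)"
        using a by (simp add: field_simps)
      also have "\<dots> = x ^ i * (y ^ j - (x + of_int a) ^ j)"
        unfolding S_def by (simp only: power_diff_sumr2)
      finally show ?thesis using True by (simp add: p right_diff_distrib)
    next
      case False
      then show ?thesis using a
        by (auto simp: p flip_quotient_def pairing_sum)
    qed
  qed
  then show ?thesis
    unfolding pairing_linear_map[OF linear_flip_quotient, of _ u]
    by (simp only: flip: pairing_fun_scale pairing_fun_diff)
qed

lemma symbol2_flip_quotient_off:
  assumes "a = 0 \<or> b \<noteq> - a"
  shows "symbol2 a b x y (flip_quotient u) = 0"
proof -
  have "symbol2 a b x y (flip_quotient (basis_vec p)) = 0" for p
    using assms by (cases p) (auto simp: flip_quotient_def pairing_sum intro!: sum.neutral)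
  then show ?thesis
    unfolding pairing_linear_map[OF linear_flip_quotient, of _ u] by (simp add: pairing_def)
qed

text \<open>
  Degree zero turns the last condition into the vanishing of all symbols of \<open>\<phi>(D\<^sup>2)\<close> except the one
  at \<open>(0, 0)\<close>.
\<close>

definition reduced :: "(diffop \<Rightarrow> ((int \<times> nat) \<times> (int \<times> nat) \<Rightarrow>\<^sub>0 complex)) \<Rightarrow> bool"
  where "reduced \<phi> \<longleftrightarrow> \<phi> \<in> Der diff_bracket diff_act \<and> homogeneous \<phi> \<and>
    (\<forall>p b x y. p \<noteq> 0 \<longrightarrow> der_symbol \<phi> 0 2 p b x y = 0)"

text \<open>
  Because the symbols of \<open>\<phi>(D\<^sup>2)\<close> at \<open>(p, -p)\<close> vanish on \<open>y = x + p\<close>, \<open>flip_quotient\<close> divides them by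
  the factor with which \<open>D\<^sup>2\<close> acts.
\<close>

lemma homogeneous_reduced_mod_inner:
  assumes \<phi>: "\<phi> \<in> Der diff_bracket diff_act" and hom: "homogeneous \<phi>"
  shows "\<exists>v. reduced (\<phi> - (\<lambda>x. diff_act x v))"
proof
  let ?v = "flip_quotient (\<phi> (basis_vec (0, 2)))"
  have off: "symbol2 a b x y ?v = 0" if "a = 0 \<or> b \<noteq> - a" for a b x y
    by (rule symbol2_flip_quotient_off[OF that])
  have "homogeneous (\<phi> - (\<lambda>x. diff_act x ?v))"
    by (rule homogeneous_diff[OF hom homogeneous_inner]) (rule off, auto)
  moreover have "der_symbol (\<phi> - (\<lambda>x. diff_act x ?v)) 0 2 p b x y = 0" if p: "p \<noteq> 0" for p b x y
  proof (cases "b = - p")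
    case True
    have "symbol2 p b x y (diff_act (basis_vec (0, 2)) ?v) =
        2 * of_int p * (x - y + of_int p) * symbol2 p b x y ?v"
      by (simp add: symbol2_act True algebra_simps power2_eq_square)
    also have "\<dots> = der_symbol \<phi> 0 2 p b x y"
      using symbol2_flip_quotient[OF p, of x y "\<phi> (basis_vec (0, 2))"] derivation_flip_residue_zero[OF \<phi> p, of x]
      by (simp add: True)
    finally show ?thesis by simp
  next
    case False
    then have "p + b \<noteq> 0" by auto
    then show ?thesis using calculation by (auto simp: homogeneous_def)
  qed
  ultimately show "reduced (\<phi> - (\<lambda>x. diff_act x ?v))"
    unfolding reduced_def using Der_diff[OF \<phi> inner_diff_in_Der] by blast
qed

lemma reducedD:
  assumes "reduced \<phi>"
  shows reduced_Der: "\<phi> \<in> Der diff_bracket diff_act"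
    and reduced_homogeneous: "a + b \<noteq> m \<Longrightarrow> der_symbol \<phi> m n a b x y = 0"
    and reduced_square: "p \<noteq> 0 \<Longrightarrow> der_symbol \<phi> 0 2 p b x y = 0"
  using assms by (simp_all add: reduced_def homogeneous_def)

lemma reduced_diff:
  assumes "reduced \<phi>" "reduced \<psi>"
  shows "reduced (\<phi> - \<psi>)"
  using assms Der_diff homogeneous_diff unfolding reduced_def by auto

lemma reduced_zeta: "reduced (zeta \<alpha> \<alpha>')"
  unfolding reduced_def homogeneous_def symbol2_zeta_basis using zeta_in_Der by auto

section \<open>Reduced derivations\<close>

lemma reduced_square_right:
  assumes \<phi>: "reduced \<phi>" and "q \<noteq> 0"
  shows "der_symbol \<phi> 0 2 a q x y = 0"
  using reduced_square[OF \<phi>, of a x q y] reduced_homogeneous[OF \<phi>, of a q 0 x y 2] assms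
  by (cases "a = 0") simp_all

text \<open>
  Exchanging the two tensor factors preserves all hypotheses, so each statement about the component
  \<open>s\<^sup>m\<close> has a mirror image for \<open>t\<^sup>m\<close>.
\<close>

lemma reduced_twist:
  assumes \<phi>: "reduced \<phi>"
  shows "reduced (\<lambda>x. twist (\<phi> x))"
proof -
  have "(\<lambda>x. twist (\<phi> x)) \<in> Der diff_bracket diff_act"
    using linear_map_comp[OF linear_twist Der_linear[OF reduced_Der[OF \<phi>]]]
    by (rule DerI) (simp add: Der_bracket[OF reduced_Der[OF \<phi>]] linear_map_diff[OF linear_twist]
        twist_diag_act[OF bilinear_diff_bracket])
  moreover have "homogeneous (\<lambda>x. twist (\<phi> x))"
    unfolding homogeneous_def pairing_twist
    by (intro allI impI, rule reduced_homogeneous[OF \<phi>]) (simp add: add.commute)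
  ultimately show ?thesis
    unfolding reduced_def pairing_twist using reduced_square_right[OF \<phi>] by blast
qed

lemma reduced_cube:
  assumes \<phi>: "reduced \<phi>" and p: "p \<noteq> 0"
  shows "der_symbol \<phi> 0 3 p b x y = 0"
proof (cases "b = - p")
  case True
  have "2 * der_symbol \<phi> 0 3 p (- p) x y = 0"
    unfolding derivation_Cartan_compatible[OF reduced_Der[OF \<phi>] p] reduced_square[OF \<phi> p] by simp
  then show ?thesis using True by simp
next
  case False
  then have "p + b \<noteq> 0" by auto
  then show ?thesis by (rule reduced_homogeneous[OF \<phi>])
qed

lemma reduced_cube_right:
  assumes \<phi>: "reduced \<phi>" and "q \<noteq> 0"
  shows "der_symbol \<phi> 0 3 a q x y = 0"
  using reduced_cube[OF \<phi>, of a x q y] reduced_homogeneous[OF \<phi>, of a q 0 x y 3] assms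
  by (cases "a = 0") simp_all

text \<open>
  At \<open>(a, b)\<close> with \<open>a + b = m\<close> the symbols of \<open>\<phi>(t\<^sup>m f(D))\<close> depend on \<open>f\<close> through evaluation at the
  point \<open>z\<close> with \<open>(z + m)\<^sup>2 - z\<^sup>2 = (x + a)\<^sup>2 - x\<^sup>2 + (y + b)\<^sup>2 - y\<^sup>2\<close>. The same identity for cubes fails
  by a multiple of \<open>a b (x - y + a)(x - y - b)\<close>, which is a nonzero polynomial.
\<close>

lemma reduced_mixed_zero:
  assumes \<phi>: "reduced \<phi>" and m: "m \<noteq> 0" and a: "a \<noteq> 0" and b: "b \<noteq> 0"
  shows "der_symbol \<phi> m n a b x y = 0"
proof (cases "a + b = m")
  case False
  then show ?thesis by (rule reduced_homogeneous[OF \<phi>])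
next
  case True
  define A B where "A = (of_int a :: complex)" and "B = (of_int b :: complex)"
  have M: "of_int m = A + B" using True by (auto simp: A_def B_def)
  have AB: "A \<noteq> 0" "B \<noteq> 0" using a b by (simp_all add: A_def B_def)
  show ?thesis
  proof (rule polyfun_zero_if_almost[OF polyfun_symbol2_right])
    show "finite {x + A, x - B}" by simp
    fix y assume y: "y \<notin> {x + A, x - B}"
    define M where "M = A + B"
    define E2 E3 where "E2 = 2 * A * x + A\<^sup>2 + 2 * B * y + B\<^sup>2"
      and "E3 = 3 * A * x\<^sup>2 + 3 * A\<^sup>2 * x + A ^ 3 + 3 * B * y\<^sup>2 + 3 * B\<^sup>2 * y + B ^ 3"
    define f where "f n = der_symbol \<phi> m n a b x y" for n
    have s: "2 * M * f (n + 1) + M\<^sup>2 * f n = E2 * f n" for n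
      using derivation_Cartan_square[OF reduced_Der[OF \<phi>], of m a x b y n]
      unfolding reduced_square[OF \<phi> a] reduced_square_right[OF \<phi> b] M
      by (simp add: f_def E2_def M_def A_def B_def)
    have c: "3 * M * f (n + 2) + 3 * M\<^sup>2 * f (n + 1) + M ^ 3 * f n = E3 * f n"
      using derivation_Cartan_cube[OF reduced_Der[OF \<phi>], of m a x b y n]
      unfolding reduced_cube[OF \<phi> a] reduced_cube_right[OF \<phi> b] M
      by (simp add: f_def E3_def M_def A_def B_def)
    have s': "2 * M * f (n + 2) + M\<^sup>2 * f (n + 1) = E2 * f (n + 1)"
      using s[of "n + 1"] by simp
    (* Elimination of f (n + 2) and f (n + 1) from the three relations. *)
    have "(3 * E2\<^sup>2 + M ^ 4 - 4 * M * E3) * f n =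
        - 3 * (M\<^sup>2 + E2) * (2 * M * f (n + 1) + M\<^sup>2 * f n - E2 * f n)
        - 6 * M * (2 * M * f (n + 2) + M\<^sup>2 * f (n + 1) - E2 * f (n + 1))
        + 4 * M * (3 * M * f (n + 2) + 3 * M\<^sup>2 * f (n + 1) + M ^ 3 * f n - E3 * f n)"
      by (simp add: algebra_simps power2_eq_square power3_eq_cube power4_eq_xxxx)
    also have "\<dots> = 0"
      unfolding s s' c by simp
    finally have "(3 * E2\<^sup>2 + M ^ 4 - 4 * M * E3) * f n = 0" .
    moreover have "3 * E2\<^sup>2 + M ^ 4 - 4 * M * E3 = - 12 * A * B * ((x - y + A) * (x - y - B))"
      unfolding E2_def E3_def M_def
      by (simp add: algebra_simps power2_eq_square power3_eq_cube power4_eq_xxxx)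
    moreover have "x - y + A \<noteq> 0" "x - y - B \<noteq> 0" using y by (auto simp: algebra_simps)
    ultimately show "der_symbol \<phi> m n a b x y = 0" using AB by (simp add: f_def)
  qed
qed

text \<open>
  At \<open>(m, 0)\<close> the elements \<open>t\<^sup>m f(D)\<close> and their images are multiplied by the same factors, which
  cancel; only the action of \<open>t\<^sup>m D\<^sup>n\<close> on the symbol of \<open>\<phi>(D\<^sup>2)\<close> at \<open>(0, 0)\<close> survives.
\<close>

lemma reduced_edge_square:
  assumes \<phi>: "reduced \<phi>" and m: "m \<noteq> 0"
  shows "2 * of_int m * der_symbol \<phi> m (n + 1) m 0 x y = 2 * of_int m * x * der_symbol \<phi> m n m 0 x y
    + x ^ n * (der_symbol \<phi> 0 2 0 0 (x + of_int m) y - der_symbol \<phi> 0 2 0 0 x y)"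
proof -
  have z: "0 - m \<noteq> 0" using m by simp
  show ?thesis
    using derivation_Cartan_square[OF reduced_Der[OF \<phi>], of m m x 0 y n]
    unfolding reduced_square_right[OF \<phi> z] by (simp add: left_diff_distrib right_diff_distrib distrib_right)
qed

lemma reduced_edge_cube:
  assumes \<phi>: "reduced \<phi>" and m: "m \<noteq> 0"
  shows "3 * of_int m * der_symbol \<phi> m 2 m 0 x y + 3 * of_int m ^ 2 * der_symbol \<phi> m 1 m 0 x y =
    (3 * of_int m * x\<^sup>2 + 3 * of_int m ^ 2 * x) * der_symbol \<phi> m 0 m 0 x y
    + (der_symbol \<phi> 0 3 0 0 (x + of_int m) y - der_symbol \<phi> 0 3 0 0 x y)"
proof -
  have z: "0 - m \<noteq> 0" using m by simp
  show ?thesis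
    using derivation_Cartan_cube[OF reduced_Der[OF \<phi>], of m m x 0 y 0]
    unfolding reduced_cube_right[OF \<phi> z]
    by (simp add: distrib_right numeral_2_eq_2)
qed

text \<open>
  Let \<open>g\<close> and \<open>h\<close> be the symbols of \<open>\<phi>(D\<^sup>2)\<close> and \<open>\<phi>(D\<^sup>3)\<close> at \<open>(0, 0)\<close>. Compatibility at \<open>(m, 0)\<close> reads
  \<open>3(2x + m)(g(x + m) - g(x)) = 2(h(x + m) - h(x))\<close>. The right sides for \<open>m = 1\<close> at \<open>x\<close> and at
  \<open>x + 1\<close> add up to the one for \<open>m = 2\<close> at \<open>x\<close>, and this forces the second difference of \<open>g\<close> in \<open>x\<close> to vanish.
\<close>

lemma reduced_square_affine:
  assumes \<phi>: "reduced \<phi>"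
  obtains W where "polyfun W" "\<And>x y. der_symbol \<phi> 0 2 0 0 x y = der_symbol \<phi> 0 2 0 0 0 y + x * W y"
proof
  define g h where "g x y = der_symbol \<phi> 0 2 0 0 x y" and "h x y = der_symbol \<phi> 0 3 0 0 x y" for x y
  define W where "W y = g 1 y - g 0 y" for y
  show "polyfun W"
    unfolding W_def g_def by (intro polyfun_diff polyfun_symbol2_right)
  have key: "3 * (2 * x + of_int m) * (g (x + of_int m) y - g x y) = 2 * (h (x + of_int m) y - h x y)"
    if m: "m \<noteq> 0" for m x y
  proof -
    define M where "M = (of_int m :: complex)"
    define f where "f n = der_symbol \<phi> m n m 0 x y" for n
    define G H where "G = g (x + M) y - g x y" and "H = h (x + M) y - h x y"
    have 1: "2 * M * f 1 = 2 * M * x * f 0 + G" and 2: "2 * M * f 2 = 2 * M * x * f 1 + x * G"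
      using reduced_edge_square[OF \<phi> m, of x y 0] reduced_edge_square[OF \<phi> m, of x y 1]
      unfolding f_def G_def g_def M_def by (simp_all add: numeral_2_eq_2)
    have 3: "3 * M * f 2 + 3 * M\<^sup>2 * f 1 = (3 * M * x\<^sup>2 + 3 * M\<^sup>2 * x) * f 0 + H"
      using reduced_edge_cube[OF \<phi> m, of x y] unfolding f_def H_def h_def M_def .
    have "3 * (2 * x + M) * G - 2 * H =
        - 3 * (x + M) * (2 * M * f 1 - (2 * M * x * f 0 + G))
        - 3 * (2 * M * f 2 - (2 * M * x * f 1 + x * G))
        + 2 * (3 * M * f 2 + 3 * M\<^sup>2 * f 1 - ((3 * M * x\<^sup>2 + 3 * M\<^sup>2 * x) * f 0 + H))"
      by (simp add: algebra_simps power2_eq_square)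
    also have "\<dots> = 0" unfolding 1 2 3 by simp
    finally show ?thesis unfolding G_def H_def M_def by simp
  qed
  have step: "g (x + 1 + 1) y - g (x + 1) y = g (x + 1) y - g x y" for x y
  proof -
    define a b c d e f where "a = g x y" and "b = g (x + 1) y" and "c = g (x + 1 + 1) y"
      and "d = h x y" and "e = h (x + 1) y" and "f = h (x + 1 + 1) y"
    have two: "x + 2 = x + 1 + 1" by simp
    have e1: "3 * (2 * x + 1) * (b - a) = 2 * (e - d)"
      using key[of 1 x y] by (simp add: a_def b_def d_def e_def)
    have e2: "3 * (2 * (x + 1) + 1) * (c - b) = 2 * (f - e)"
      using key[of 1 "x + 1" y] by (simp add: c_def b_def e_def f_def)
    have e3: "3 * (2 * x + 2) * (c - a) = 2 * (f - d)"
      using key[of 2 x y] unfolding of_int_numeral two by (simp add: a_def c_def d_def f_def)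
    have "3 * (c - b - (b - a)) = 3 * (2 * (x + 1) + 1) * (c - b)
        + 3 * (2 * x + 1) * (b - a) - 3 * (2 * x + 2) * (c - a)"
      by (simp add: algebra_simps)
    also have "\<dots> = 0" unfolding e1 e2 e3 by simp
    finally have "c - b - (b - a) = 0" by (metis mult_eq_0_iff zero_neq_numeral)
    then show ?thesis by (simp only: a_def b_def c_def right_minus_eq)
  qed
  have slope: "g (x + 1) y - g x y = W y" for x y
  proof -
    have "polyfun (\<lambda>x. g (x + 1) y - g x y)"
      unfolding g_def by (intro polyfun_diff polyfun_shift polyfun_symbol2_left)
    from polyfun_periodic_const[OF this one_neq_zero step, of x] show ?thesis
      by (simp add: W_def)
  qed
  show "der_symbol \<phi> 0 2 0 0 x y = der_symbol \<phi> 0 2 0 0 0 y + x * W y" for x y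
  proof -
    have "polyfun (\<lambda>x. g x y - x * W y)"
      unfolding g_def by (intro polyfun_diff polyfun_mult polyfun_const polyfun_ident polyfun_symbol2_left)
    moreover have "g (x + 1) y - (x + 1) * W y = g x y - x * W y" for x
      using slope[of x y] by (simp add: algebra_simps)
    ultimately have "g x y - x * W y = g 0 y - 0 * W y"
      by (rule polyfun_periodic_const[OF _ one_neq_zero])
    then show ?thesis by (simp add: g_def algebra_simps)
  qed
qed

text \<open>
  The bracket \<open>[t\<^sup>m, t\<^sup>k D\<^sup>n]\<close> with \<open>n \<le> 1\<close> is a multiple of \<open>t\<^sup>m\<^sup>+\<^sup>k\<close>, whose image has no symbol at
  \<open>(k, m)\<close>. So the contributions of the two arguments to that symbol cancel.
\<close>

lemma reduced_cross:
  assumes \<phi>: "reduced \<phi>" and k: "k \<noteq> 0" and m: "m \<noteq> 0" and km: "k \<noteq> m" and s: "m + k \<noteq> 0"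
    and n: "n \<le> 1"
  shows "der_symbol \<phi> k n k 0 x y - der_symbol \<phi> k n k 0 x (y + of_int m) =
    x ^ n * (der_symbol \<phi> m 0 0 m x y - der_symbol \<phi> m 0 0 m (x + of_int k) y)"
proof -
  have br: "\<exists>c. diff_bracket (basis_vec (m, 0)) (basis_vec (k, n)) = c *\<^sub>v basis_vec (m + k, 0)"
  proof (cases "n = 0")
    case True
    then show ?thesis by (auto simp: diff_bracket_t intro: exI[of _ 0])
  next
    case False
    then have "n = 1" using n by simp
    then show ?thesis using diff_bracket_t(2)[of m k] by (auto intro!: exI[of _ "- of_int m"])
  qed
  then obtain c where c: "diff_bracket (basis_vec (m, 0)) (basis_vec (k, n)) = c *\<^sub>v basis_vec (m + k, 0)" ..
  have "symbol2 k m x y (\<phi> (diff_bracket (basis_vec (m, 0)) (basis_vec (k, n)))) = 0"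
    unfolding c linear_map_scale[OF Der_linear[OF reduced_Der[OF \<phi>]]]
    using reduced_mixed_zero[OF \<phi> s k m] by simp
  moreover have "k - m \<noteq> 0" "m - k \<noteq> 0" using km by auto
  note zero = reduced_mixed_zero[OF \<phi> k \<open>k - m \<noteq> 0\<close> m] reduced_mixed_zero[OF \<phi> m k \<open>m - k \<noteq> 0\<close>]
  ultimately show ?thesis
    unfolding Der_bracket[OF reduced_Der[OF \<phi>]] pairing_diff symbol2_act zero
    by (simp add: right_diff_distrib)
qed

text \<open>
  Compare the symbols at \<open>(m + k, 0)\<close> for \<open>[t\<^sup>m, t\<^sup>k] = 0\<close> and \<open>[t\<^sup>m, t\<^sup>k D] = -m t\<^sup>m\<^sup>+\<^sup>k\<close>. The slope \<open>W\<close>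
  of \<open>\<phi>(D\<^sup>2)\<close> drops out, as it does not depend on \<open>x\<close>.
\<close>

lemma reduced_cocycle:
  assumes \<phi>: "reduced \<phi>" and k: "k \<noteq> 0" and m: "m \<noteq> 0" and s: "m + k \<noteq> 0"
  shows "der_symbol \<phi> (m + k) 0 (m + k) 0 x y = der_symbol \<phi> k 0 k 0 x y + der_symbol \<phi> m 0 m 0 (x + of_int k) y"
proof -
  note lin = Der_linear[OF reduced_Der[OF \<phi>]]
  define c where "c k n x = der_symbol \<phi> k n k 0 x y" for k n x
  have z: "0 - m \<noteq> 0" "0 - k \<noteq> 0" using k m by auto
  note zero = reduced_mixed_zero[OF \<phi> k s z(1)] reduced_mixed_zero[OF \<phi> m s z(2)]
  have sub: "m + k - m = k" "m + k - k = m" by simp_all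
  have act: "symbol2 (m + k) 0 x y (\<phi> (diff_bracket (basis_vec (m, 0)) (basis_vec (k, n)))) =
      c k n x - c k n (x + of_int m)
      - ((x + of_int m) ^ n * c m 0 x - x ^ n * c m 0 (x + of_int k))" for n
    unfolding Der_bracket[OF reduced_Der[OF \<phi>]] pairing_diff symbol2_act zero sub c_def by simp
  have w: "2 * of_int k * c k 1 x = 2 * of_int k * x * c k 0 x
      + (der_symbol \<phi> 0 2 0 0 (x + of_int k) y - der_symbol \<phi> 0 2 0 0 x y)" for x
    using reduced_edge_square[OF \<phi> k, of x y 0] by (simp add: c_def)
  obtain W where W: "\<And>x y. der_symbol \<phi> 0 2 0 0 x y = der_symbol \<phi> 0 2 0 0 0 y + x * W y"
    using reduced_square_affine[OF \<phi>] by metis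
  have "2 * of_int k * c k 1 x = 2 * of_int k * (x * c k 0 x + W y / 2)" for x
    using w[of x] unfolding W[of x] W[of "x + of_int k"] by (simp add: algebra_simps)
  then have c1: "c k 1 x = x * c k 0 x + W y / 2" for x
    using k by simp
  have 0: "c k 0 x - c k 0 (x + of_int m) = c m 0 x - c m 0 (x + of_int k)"
    using act[of 0] by (simp add: diff_bracket_t linear_map_zero[OF lin])
  have "- of_int m * c (m + k) 0 x = symbol2 (m + k) 0 x y (\<phi> (diff_bracket (basis_vec (m, 0)) (basis_vec (k, 1))))"
    unfolding diff_bracket_t linear_map_uminus[OF lin] linear_map_scale[OF lin] by (simp add: c_def)
  also have "\<dots> = x * c k 0 x - (x + of_int m) * c k 0 (x + of_int m)
      - ((x + of_int m) * c m 0 x - x * c m 0 (x + of_int k))"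
    unfolding act c1 by simp
  also have "\<dots> = - of_int m * (c k 0 x + c m 0 (x + of_int k))
      + (x + of_int m) * (c k 0 x - c k 0 (x + of_int m) - (c m 0 x - c m 0 (x + of_int k)))"
    by (simp add: algebra_simps)
  also have "\<dots> = - of_int m * (c k 0 x + c m 0 (x + of_int k))"
    unfolding 0 by simp
  finally show ?thesis using m by (simp add: c_def)
qed

text \<open>
  By \<open>reduced_cross\<close> for \<open>t\<^sup>2\<close> and \<open>t D\<close>, evaluated at \<open>x = 0\<close>, the slope has period \<open>2\<close> in \<open>y\<close>. This
  excludes a term \<open>x y\<close> in the symbol of \<open>\<phi>(D\<^sup>2)\<close>.
\<close>

lemma reduced_slope_constant:
  assumes \<phi>: "reduced \<phi>"
  obtains \<alpha> where "\<And>x y. der_symbol \<phi> 0 2 0 0 x y = der_symbol \<phi> 0 2 0 0 0 y + x * \<alpha>"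
proof -
  obtain W where W: "polyfun W" "\<And>x y. der_symbol \<phi> 0 2 0 0 x y = der_symbol \<phi> 0 2 0 0 0 y + x * W y"
    using reduced_square_affine[OF \<phi>] by metis
  have edge: "der_symbol \<phi> 1 1 1 0 x y = x * der_symbol \<phi> 1 0 1 0 x y + W y / 2" for x y
    using reduced_edge_square[OF \<phi>, of 1 x y 0]
    unfolding W(2)[of x] W(2)[of "x + of_int 1"] by (simp add: field_simps)
  have "W (y + 2) = W y" for y
  proof -
    have "der_symbol \<phi> 1 1 1 0 0 y = der_symbol \<phi> 1 1 1 0 0 (y + 2)"
      using reduced_cross[OF \<phi>, of 1 2 1 0 y] by simp
    then show ?thesis unfolding edge by simp
  qed
  then have "W y = W 0" for y
    by (intro polyfun_periodic_const[OF W(1), of 2]) auto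
  then show thesis using that[of "W 0"] W(2) by metis
qed

lemma reduced_square_linear:
  assumes \<phi>: "reduced \<phi>"
  obtains \<alpha> \<alpha>' where "\<And>x y. der_symbol \<phi> 0 2 0 0 x y = der_symbol \<phi> 0 2 0 0 0 0 + \<alpha> * x + \<alpha>' * y"
proof -
  obtain \<alpha> where \<alpha>: "\<And>x y. der_symbol \<phi> 0 2 0 0 x y = der_symbol \<phi> 0 2 0 0 0 y + x * \<alpha>"
    using reduced_slope_constant[OF \<phi>] by metis
  obtain \<alpha>' where \<alpha>': "\<And>x y. der_symbol \<phi> 0 2 0 0 y x = der_symbol \<phi> 0 2 0 0 y 0 + x * \<alpha>'"
    using reduced_slope_constant[OF reduced_twist[OF \<phi>]] unfolding pairing_twist by metis
  show thesis
  proof (rule that)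
    show "der_symbol \<phi> 0 2 0 0 x y = der_symbol \<phi> 0 2 0 0 0 0 + \<alpha> * x + \<alpha>' * y" for x y
      using \<alpha>[of x y] \<alpha>'[of 0 y] by simp
  qed
qed

section \<open>Vanishing of a normalized derivation\<close>

text \<open>
  After subtraction of an outer derivation, \<open>\<phi>(D\<^sup>2)\<close> is a multiple of \<open>1 \<otimes> 1\<close>.
\<close>

definition normal :: "(diffop \<Rightarrow> ((int \<times> nat) \<times> (int \<times> nat) \<Rightarrow>\<^sub>0 complex)) \<Rightarrow> bool"
  where "normal \<phi> \<longleftrightarrow> reduced \<phi> \<and> (\<forall>x y. der_symbol \<phi> 0 2 0 0 x y = der_symbol \<phi> 0 2 0 0 0 0)"

lemma reduced_normal_mod_zeta:
  assumes \<phi>: "reduced \<phi>"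
  shows "\<exists>\<alpha> \<alpha>'. normal (\<phi> - zeta \<alpha> \<alpha>')"
proof -
  obtain \<alpha> \<alpha>' where *: "\<And>x y. der_symbol \<phi> 0 2 0 0 x y = der_symbol \<phi> 0 2 0 0 0 0 + \<alpha> * x + \<alpha>' * y"
    using reduced_square_linear[OF \<phi>] by metis
  have "der_symbol (\<phi> - zeta (\<alpha> / 2) (\<alpha>' / 2)) 0 2 0 0 x y = der_symbol \<phi> 0 2 0 0 0 0" for x y
    using *[of x y] symbol2_zeta[of x y "\<alpha> / 2" "\<alpha>' / 2"] by simp
  then have "normal (\<phi> - zeta (\<alpha> / 2) (\<alpha>' / 2))"
    unfolding normal_def by (intro conjI reduced_diff[OF \<phi> reduced_zeta]) (simp only: simp_thms)
  then show ?thesis by blast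
qed

text \<open>
  Now \<open>D\<^sup>2\<close> commutes with \<open>\<phi>\<close>, so the component in \<open>s\<^sup>m\<close> of \<open>\<phi>(t\<^sup>m f(D))\<close> is \<open>f(x)\<close> times that of \<open>\<phi>(t\<^sup>m)\<close>.
\<close>

lemma normal_edge:
  assumes \<phi>: "normal \<phi>" and m: "m \<noteq> 0"
  shows "der_symbol \<phi> m n m 0 x y = x ^ n * der_symbol \<phi> m 0 m 0 x y"
proof (induction n)
  case (Suc n)
  have red: "reduced \<phi>" and const: "\<And>x y. der_symbol \<phi> 0 2 0 0 x y = der_symbol \<phi> 0 2 0 0 0 0"
    using \<phi> unfolding normal_def by blast+
  have "2 * of_int m * der_symbol \<phi> m (n + 1) m 0 x y = 2 * of_int m * (x * der_symbol \<phi> m n m 0 x y)"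
    using reduced_edge_square[OF red m, of x y n]
    unfolding const[of x] const[of "x + of_int m"] by simp
  then show ?case using m Suc by simp
qed simp

lemma normal_twist:
  assumes \<phi>: "normal \<phi>"
  shows "normal (\<lambda>x. twist (\<phi> x))"
  using \<phi> reduced_twist unfolding normal_def pairing_twist by blast

text \<open>
  Elements supported at \<open>(0, 0)\<close> commute with \<open>D\<^sup>2\<close>. Their inner derivations are the freedom that is
  left, and on \<open>\<phi>(t)\<close> they act by differences in \<open>x\<close> and in \<open>y\<close>.
\<close>

lemma normal_minus_inner:
  assumes \<phi>: "normal \<phi>" and v: "\<And>a b x y. a \<noteq> 0 \<or> b \<noteq> 0 \<Longrightarrow> symbol2 a b x y v = 0"
  shows "normal (\<phi> - (\<lambda>x. diff_act x v))"
    and "der_symbol (\<phi> - (\<lambda>x. diff_act x v)) 1 0 1 0 x y =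
      der_symbol \<phi> 1 0 1 0 x y - (symbol2 0 0 x y v - symbol2 0 0 (x + 1) y v)"
    and "der_symbol (\<phi> - (\<lambda>x. diff_act x v)) 1 0 0 1 x y =
      der_symbol \<phi> 1 0 0 1 x y - (symbol2 0 0 x y v - symbol2 0 0 x (y + 1) v)"
proof -
  have sq: "symbol2 a b x y (diff_act (basis_vec (0, 2)) v) = 0" for a b x y
    unfolding symbol2_act_square using v[of a b x y] by (cases "a = 0 \<and> b = 0") auto
  have "homogeneous (\<lambda>x. diff_act x v)"
    by (rule homogeneous_inner, rule v) auto
  then have "reduced (\<lambda>x. diff_act x v)"
    unfolding reduced_def sq using inner_diff_in_Der by blast
  then show "normal (\<phi> - (\<lambda>x. diff_act x v))"
    using \<phi> reduced_diff unfolding normal_def by (simp add: sq)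
  show "der_symbol (\<phi> - (\<lambda>x. diff_act x v)) 1 0 1 0 x y =
      der_symbol \<phi> 1 0 1 0 x y - (symbol2 0 0 x y v - symbol2 0 0 (x + 1) y v)"
    "der_symbol (\<phi> - (\<lambda>x. diff_act x v)) 1 0 0 1 x y =
      der_symbol \<phi> 1 0 0 1 x y - (symbol2 0 0 x y v - symbol2 0 0 x (y + 1) v)"
    using v[of 1 "- 1"] v[of "- 1" 1] by (simp_all add: symbol2_act)
qed

definition antidifference :: "nat \<Rightarrow> complex poly"
  where "antidifference n = (SOME q. \<forall>x. poly q x - poly q (x + 1) = x ^ n)"

lemma antidifference: "poly (antidifference n) x - poly (antidifference n) (x + 1) = x ^ n"
  unfolding antidifference_def using someI_ex[OF polyfun_antidifference[of n]] by blast

text \<open>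
  A right inverse, on symbols, of the bracket with \<open>t\<close>.
\<close>

definition summation :: "diffop \<Rightarrow> diffop"
  where "summation = lin_ext (\<lambda>(m, n). if m = 1 then op_of 0 (antidifference n) else 0)"

lemma summation_difference:
  "pairing (ev 0 x) (summation (basis_vec k)) - pairing (ev 0 (x + 1)) (summation (basis_vec k)) = ev 1 x k"
  by (cases k) (auto simp: summation_def antidifference)

lemma summation_off: "a \<noteq> 0 \<Longrightarrow> pairing (ev a x) (summation (basis_vec k)) = 0"
  by (cases k) (auto simp: summation_def)

lemma normal_kill_left:
  assumes \<phi>: "normal \<phi>"
  shows "\<exists>v. normal (\<phi> - (\<lambda>x. diff_act x v)) \<and> (\<forall>x y. der_symbol (\<phi> - (\<lambda>x. diff_act x v)) 1 0 1 0 x y = 0)"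
proof (intro exI conjI allI)
  define P where "P = lin_ext (\<lambda>(m, n). if m = 0 then basis_vec (m, n) else (0 :: diffop))"
  have P: "pairing (ev b y) (P (basis_vec k)) = (if b = 0 then ev b y k else 0)" for b y k
    by (cases k) (auto simp: P_def)
  let ?v = "tensor_map summation P (\<phi> (basis_vec (1, 0)))"
  have off: "symbol2 a b x y ?v = 0" if "a \<noteq> 0 \<or> b \<noteq> 0" for a b x y
    unfolding pairing_tensor_map
  proof (cases "a = 0")
    case True
    then show "pairing (tensor_fun (\<lambda>k. pairing (ev a x) (summation (basis_vec k))) (\<lambda>k. pairing (ev b y) (P (basis_vec k))))
        (\<phi> (basis_vec (1, 0))) = 0"
      using that by (intro pairing_tensor_fun_zero(2)) (simp add: P)
  next
    case False
    then show "pairing (tensor_fun (\<lambda>k. pairing (ev a x) (summation (basis_vec k))) (\<lambda>k. pairing (ev b y) (P (basis_vec k))))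
        (\<phi> (basis_vec (1, 0))) = 0"
      by (intro pairing_tensor_fun_zero(1)) (simp add: summation_off)
  qed
  show "normal (\<phi> - (\<lambda>x. diff_act x ?v))"
    by (rule normal_minus_inner(1)[OF \<phi> off])
  have "symbol2 0 0 x y ?v - symbol2 0 0 (x + 1) y ?v = der_symbol \<phi> 1 0 1 0 x y" for x y
    unfolding pairing_tensor_map
    by (simp only: P summation_difference simp_thms if_True flip: pairing_tensor_fun_combine(1))
  then show "der_symbol (\<phi> - (\<lambda>x. diff_act x ?v)) 1 0 1 0 x y = 0" for x y
    using normal_minus_inner(2)[OF \<phi> off, of x y] by simp
qed

text \<open>
  The relation between \<open>t\<close> and \<open>t\<^sup>2\<close> makes \<open>d(x, y) + d(x, y + 1)\<close> periodic in \<open>x\<close>, where \<open>d\<close> is the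
  symbol of \<open>\<phi>(t)\<close> at \<open>(0, 1)\<close>. Therefore the difference of \<open>d\<close> in \<open>x\<close> changes its sign under
  \<open>y \<mapsto> y + 1\<close>, and no nonzero polynomial does so.
\<close>

lemma normal_right_independent:
  assumes \<phi>: "normal \<phi>" and left: "\<And>x y. der_symbol \<phi> 1 0 1 0 x y = 0"
  shows "der_symbol \<phi> 1 0 0 1 x y = der_symbol \<phi> 1 0 0 1 0 y"
proof -
  have red: "reduced \<phi>" using \<phi> by (simp add: normal_def)
  define d where "d x y = der_symbol \<phi> 1 0 0 1 x y" for x y
  have "der_symbol \<phi> 2 0 0 2 x y = d x y + d x (y + 1)" for x y
    using reduced_cocycle[OF reduced_twist[OF red], of 1 1 y x] unfolding pairing_twist d_def by simp
  moreover have "der_symbol \<phi> 2 0 0 2 x y = der_symbol \<phi> 2 0 0 2 (x + 1) y" for x y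
    using reduced_cross[OF red, of 1 2 0 x y] left by simp
  ultimately have sum: "d x y + d x (y + 1) = d (x + 1) y + d (x + 1) (y + 1)" for x y
    by metis
  define e where "e x y = d (x + 1) y - d x y" for x y
  have neg: "e x (y + 1) = - e x y" for x y
    using sum[of x y] unfolding e_def by (simp add: algebra_simps)
  have "e x (y + 2) = e x y" for x y
    using neg[of x y] neg[of x "y + 1"] by (simp add: add.assoc)
  moreover have "polyfun (e x)" for x
    unfolding e_def d_def by (intro polyfun_diff polyfun_symbol2_right)
  ultimately have "e x y = e x 0" for x y
    by (intro polyfun_periodic_const[of _ 2]) auto
  then have "e x y = 0" for x y
    using neg[of x y] by (metis eq_neg_iff_add_eq_0 mult_2 mult_eq_0_iff zero_neq_numeral)
  then have "d (x + 1) y = d x y" for x y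
    by (simp add: e_def)
  moreover have "polyfun (\<lambda>x. d x y)" for y
    unfolding d_def by (rule polyfun_symbol2_left)
  ultimately have "d x y = d 0 y"
    by (intro polyfun_periodic_const[of "\<lambda>x. d x y" 1]) auto
  then show ?thesis by (simp add: d_def)
qed

text \<open>
  By \<open>normal_right_independent\<close> the correction can be chosen independent of \<open>x\<close>. Such a correction
  does not disturb the component that is already zero.
\<close>

lemma normal_kill_right:
  assumes \<phi>: "normal \<phi>" and left: "\<And>x y. der_symbol \<phi> 1 0 1 0 x y = 0"
  shows "\<exists>v. normal (\<phi> - (\<lambda>x. diff_act x v)) \<and> (\<forall>x y. der_symbol (\<phi> - (\<lambda>x. diff_act x v)) 1 0 1 0 x y = 0)
    \<and> (\<forall>x y. der_symbol (\<phi> - (\<lambda>x. diff_act x v)) 1 0 0 1 x y = 0)"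
proof (intro exI conjI allI)
  (* E evaluates the first factor at x = 0 and replaces it by a multiple of 1. *)
  define E where "E = lin_ext (\<lambda>(m, n). if m = 0 \<and> n = 0 then basis_vec (m, n) else (0 :: diffop))"
  have E: "pairing (ev a x) (E (basis_vec k)) = (if a = 0 then ev a 0 k else 0)" for a x k
    by (cases k) (auto simp: E_def)
  let ?v = "tensor_map E summation (\<phi> (basis_vec (1, 0)))"
  have off: "symbol2 a b x y ?v = 0" if "a \<noteq> 0 \<or> b \<noteq> 0" for a b x y
    unfolding pairing_tensor_map
  proof (cases "a = 0")
    case True
    then show "pairing (tensor_fun (\<lambda>k. pairing (ev a x) (E (basis_vec k))) (\<lambda>k. pairing (ev b y) (summation (basis_vec k))))
        (\<phi> (basis_vec (1, 0))) = 0"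
      using that by (intro pairing_tensor_fun_zero(2)) (simp add: summation_off)
  next
    case False
    then show "pairing (tensor_fun (\<lambda>k. pairing (ev a x) (E (basis_vec k))) (\<lambda>k. pairing (ev b y) (summation (basis_vec k))))
        (\<phi> (basis_vec (1, 0))) = 0"
      by (intro pairing_tensor_fun_zero(1)) (simp add: E)
  qed
  show "normal (\<phi> - (\<lambda>x. diff_act x ?v))"
    by (rule normal_minus_inner(1)[OF \<phi> off])
  have "symbol2 0 0 x y ?v = symbol2 0 0 (x + 1) y ?v" for x y
    unfolding pairing_tensor_map by (simp only: E)
  then show "der_symbol (\<phi> - (\<lambda>x. diff_act x ?v)) 1 0 1 0 x y = 0" for x y
    using normal_minus_inner(2)[OF \<phi> off, of x y] left by simp
  have "symbol2 0 0 x y ?v - symbol2 0 0 x (y + 1) ?v = der_symbol \<phi> 1 0 0 1 0 y" for x y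
    unfolding pairing_tensor_map
    by (simp only: E summation_difference simp_thms if_True flip: pairing_tensor_fun_combine(4))
  then show "der_symbol (\<phi> - (\<lambda>x. diff_act x ?v)) 1 0 0 1 x y = 0" for x y
    using normal_minus_inner(3)[OF \<phi> off, of x y] normal_right_independent[OF \<phi> left, of x y] by simp
qed

lemma normal_zero_on_basis:
  assumes \<phi>: "normal \<phi>" and m: "m \<noteq> 0"
    and left: "\<And>x y. der_symbol \<phi> m 0 m 0 x y = 0" and right: "\<And>x y. der_symbol \<phi> m 0 0 m x y = 0"
  shows "\<phi> (basis_vec (m, n)) = 0"
proof (rule symbol2_eqI)
  fix a b x y
  have red: "reduced \<phi>" using \<phi> by (simp add: normal_def)
  consider "a + b \<noteq> m" | "a = m" "b = 0" | "a = 0" "b = m" | "a \<noteq> 0" "b \<noteq> 0" by fastforce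
  then show "symbol2 a b x y (\<phi> (basis_vec (m, n))) = symbol2 a b x y 0"
  proof cases
    case 1
    then show ?thesis using reduced_homogeneous[OF red] by simp
  next
    case 2
    then show ?thesis using normal_edge[OF \<phi> m, of x y n] left by simp
  next
    case 3
    then show ?thesis
      using normal_edge[OF normal_twist[OF \<phi>] m, of y x n] right unfolding pairing_twist by simp
  next
    case 4
    then show ?thesis using reduced_mixed_zero[OF red m] by simp
  qed
qed

text \<open>
  Starting from degree \<open>1\<close>, brackets with \<open>t\<close> and \<open>t\<^sup>-\<^sup>1\<close> reach all of \<open>\<G>\<close> by \<open>bracket_t_op_of\<close>.
\<close>

lemma derivation_zero_from_generators:
  assumes \<phi>: "\<phi> \<in> Der diff_bracket diff_act"
    and t: "\<And>n. \<phi> (basis_vec (1, n)) = 0" and t': "\<phi> (basis_vec (- 1, 0)) = 0"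
  shows "\<phi> x = 0"
proof -
  note lin = Der_linear[OF \<phi>]
  have op: "\<phi> (op_of k q) = 0" if "\<And>n. \<phi> (basis_vec (k, n)) = 0" for k q
    using that by (simp add: op_of_def linear_map_sum[OF lin] linear_map_scale[OF lin])
  have br: "\<phi> (diff_bracket x y) = 0" if "\<phi> x = 0" "\<phi> y = 0" for x y
    using that by (simp add: Der_bracket[OF \<phi>] linear_map_zero[OF linear_diag_act])
  have "\<forall>n. \<phi> (basis_vec (k, n)) = 0" for k
  proof (induction k rule: int_induct[where k = 1])
    case base
    then show ?case using t by simp
  next
    case (step1 k)
    show ?case
    proof
      fix n
      have "basis_vec (k + 1, n) = diff_bracket (basis_vec (1, 0)) (op_of k (antidifference n))"
        unfolding bracket_t_op_of add.commute[of 1 k]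
        by (rule basis_vec_op_of) (use antidifference[of n] in \<open>simp add: poly_pcompose add.commute\<close>)
      then show "\<phi> (basis_vec (k + 1, n)) = 0"
        using br[OF t[of 0] op] step1 by metis
    qed
  next
    case (step2 k)
    show ?case
    proof
      fix n
      (* For the step -1 an antidifference has to be shifted by 1 and negated. *)
      define q where "q = - pcompose (antidifference n) [:1, 1:]"
      have "poly q x - poly q (x - 1) = x ^ n" for x
        using antidifference[of n x] by (simp add: q_def poly_pcompose add.commute)
      then have "basis_vec (k - 1, n) = diff_bracket (basis_vec (- 1, 0)) (op_of k q)"
        unfolding bracket_t_op_of uminus_add_conv_diff
        by (intro basis_vec_op_of) (simp add: poly_pcompose)
      then show "\<phi> (basis_vec (k - 1, n)) = 0"
        using br[OF t' op] step2 by metis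
    qed
  qed
  then have "\<phi> (basis_vec p) = 0" for p by (cases p) simp
  then show ?thesis
    using linear_eq_lin_ext[OF lin] by (simp add: lin_ext_def fun_eq_iff)
qed

text \<open>
  The cocycle identity carries the vanishing from \<open>t\<close> to \<open>t\<^sup>2\<close>, and then from \<open>t\<^sup>2\<close> and \<open>t\<close> to \<open>t\<^sup>-\<^sup>1\<close>.
\<close>

lemma normal_zero:
  assumes \<phi>: "normal \<phi>" and left: "\<And>x y. der_symbol \<phi> 1 0 1 0 x y = 0"
    and right: "\<And>x y. der_symbol \<phi> 1 0 0 1 x y = 0"
  shows "\<phi> x = 0"
proof -
  have red: "reduced \<phi>" using \<phi> by (simp add: normal_def)
  have minus: "der_symbol \<psi> (- 1) 0 (- 1) 0 x y = 0"
    if \<psi>: "reduced \<psi>" and 0: "\<And>x y. der_symbol \<psi> 1 0 1 0 x y = 0" for \<psi> x y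
  proof -
    have "der_symbol \<psi> 2 0 2 0 x y = 0" for x y
      using reduced_cocycle[OF \<psi>, of 1 1 x y] 0 by simp
    then show ?thesis
      using reduced_cocycle[OF \<psi>, of "- 1" 2 x y] 0 by simp
  qed
  have right': "der_symbol (\<lambda>x. twist (\<phi> x)) 1 0 1 0 x y = 0" for x y
    unfolding pairing_twist by (rule right)
  have "der_symbol \<phi> (- 1) 0 0 (- 1) x y = 0" for x y
    using minus[OF reduced_twist[OF red] right', of y x] unfolding pairing_twist .
  then have "\<phi> (basis_vec (- 1, 0)) = 0"
    using minus[OF red left] by (intro normal_zero_on_basis[OF \<phi>]) auto
  moreover have "\<phi> (basis_vec (1, n)) = 0" for n
    using left right by (intro normal_zero_on_basis[OF \<phi>]) auto
  ultimately show ?thesis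
    using derivation_zero_from_generators[OF reduced_Der[OF red]] by blast
qed

theorem derivation_decomposition:
  assumes \<phi>: "\<phi> \<in> Der diff_bracket diff_act"
  shows "\<exists>v \<alpha> \<alpha>'. \<phi> = (\<lambda>x. diff_act x v) + zeta \<alpha> \<alpha>'"
proof -
  obtain v1 where "homogeneous (\<phi> - (\<lambda>x. diff_act x v1))"
    using derivation_homogeneous_mod_inner[OF \<phi>] ..
  then obtain v2 where "reduced (\<phi> - (\<lambda>x. diff_act x v1) - (\<lambda>x. diff_act x v2))"
    using homogeneous_reduced_mod_inner[OF Der_diff[OF \<phi> inner_diff_in_Der]] by blast
  then obtain \<alpha> \<alpha>' where "normal (\<phi> - (\<lambda>x. diff_act x v1) - (\<lambda>x. diff_act x v2) - zeta \<alpha> \<alpha>')"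
    (is "normal ?\<psi>")
    using reduced_normal_mod_zeta by blast
  then obtain v3 where v3: "normal (?\<psi> - (\<lambda>x. diff_act x v3))"
    "\<And>x y. der_symbol (?\<psi> - (\<lambda>x. diff_act x v3)) 1 0 1 0 x y = 0"
    using normal_kill_left by metis
  obtain v4 where v4: "normal (?\<psi> - (\<lambda>x. diff_act x v3) - (\<lambda>x. diff_act x v4))"
    "\<And>x y. der_symbol (?\<psi> - (\<lambda>x. diff_act x v3) - (\<lambda>x. diff_act x v4)) 1 0 1 0 x y = 0"
    "\<And>x y. der_symbol (?\<psi> - (\<lambda>x. diff_act x v3) - (\<lambda>x. diff_act x v4)) 1 0 0 1 x y = 0"
    using normal_kill_right[OF v3] by metis
  have "\<phi> x = diff_act x (v1 + v2 + v3 + v4) + zeta \<alpha> \<alpha>' x" for x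
    using normal_zero[OF v4, of x]
    by (simp add: linear_map_add[OF linear_diag_act] algebra_simps)
  then have "\<phi> = (\<lambda>x. diff_act x (v1 + v2 + v3 + v4)) + zeta \<alpha> \<alpha>'"
    by (simp add: fun_eq_iff)
  then show ?thesis by blast
qed

lemma Der_direct_sum: "internal_direct_sum (Der diff_bracket diff_act) (Inn diff_act) D_d"
  unfolding internal_direct_sum_def
proof (intro conjI)
  show "fm.subspace (Inn diff_act)" by (rule subspace_Inn)
  show "fm.subspace D_d" by (simp add: D_d_def)
  show "Inn diff_act \<inter> D_d = {0}" by (rule Inn_Int_D_d)
  have "(\<lambda>x. diff_act x v) + zeta \<alpha> \<alpha>' \<in> Der diff_bracket diff_act" for v \<alpha> \<alpha>'
  proof -
    have "(\<lambda>x. diff_act x v) - zeta (- \<alpha>) (- \<alpha>') = (\<lambda>x. diff_act x v) + zeta \<alpha> \<alpha>'"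
      by (simp add: fun_eq_iff zeta_eq)
    then show ?thesis using Der_diff[OF inner_diff_in_Der zeta_in_Der] by metis
  qed
  then show "Der diff_bracket diff_act = {u + w | u w. u \<in> Inn diff_act \<and> w \<in> D_d}"
    using derivation_decomposition unfolding Inn_def D_d_eq by blast
qed

section \<open>Lie bialgebra structures\<close>

text \<open>
  The only invariants are multiples of the symmetric tensor \<open>1 \<otimes> 1 \<otimes> 1\<close>, but \<open>c(r)\<close> is antisymmetric.
\<close>

lemma invariant_cyb_zero:
  assumes r: "r \<in> skew_tensors" and inv: "\<And>X. triple_act diff_bracket X (cyb diff_bracket r) = 0"
  shows "cyb diff_bracket r = 0"
proof -
  obtain c where c: "cyb diff_bracket r = c *\<^sub>v (diff_one \<otimes> diff_one \<otimes> diff_one)"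
    using diff_invariants3[OF inv] by blast
  have "cyb diff_bracket r = - cyb diff_bracket r"
    using cyb_swap12[OF lie_algebra_diff r]
    unfolding c linear_map_scale[OF linear_swap12] swap12_tensor .
  then have "2 *\<^sub>v cyb diff_bracket r = 0"
    using pm.scale_left_distrib[of 1 1 "cyb diff_bracket r"]
    by (simp add: eq_neg_iff_add_eq_0)
  then show ?thesis using pm.scale_eq_0_iff by (metis zero_neq_numeral)
qed

lemma center_d_tensor_eq: "center_d_tensor = {c *\<^sub>v (diff_one \<otimes> diff_one) | c. True}"
proof -
  have "{x \<otimes> y | x y. x \<in> center_d \<and> y \<in> center_d} = {c *\<^sub>v (diff_one \<otimes> diff_one) | c. True}"
  proof safe
    fix x y assume "x \<in> center_d" "y \<in> center_d"
    then obtain c d where "x = c *\<^sub>v diff_one" "y = d *\<^sub>v diff_one"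
      unfolding center_d_def pm.span_singleton by auto
    then show "\<exists>c. x \<otimes> y = c *\<^sub>v (diff_one \<otimes> diff_one) \<and> True"
      by (auto simp: linear_map_scale[OF linear_tensor_left] linear_map_scale[OF linear_tensor_right])
  next
    fix c
    have "c *\<^sub>v (diff_one \<otimes> diff_one) = (c *\<^sub>v diff_one) \<otimes> diff_one"
      by (simp add: linear_map_scale[OF linear_tensor_left])
    moreover have "c *\<^sub>v diff_one \<in> center_d" "diff_one \<in> center_d"
      unfolding center_d_def by (simp_all add: pm.span_base pm.span_scale)
    ultimately show "\<exists>x y. c *\<^sub>v (diff_one \<otimes> diff_one) = x \<otimes> y \<and> x \<in> center_d \<and> y \<in> center_d"
      by blast
  qed
  moreover have "pm.subspace {c *\<^sub>v (diff_one \<otimes> diff_one) | c. True}"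
    using pm.subspace_span[of "{diff_one \<otimes> diff_one}"] unfolding pm.span_singleton full_SetCompr_eq by (simp add: full_SetCompr_eq)
  ultimately show ?thesis unfolding center_d_tensor_def by (simp add: pm.span_eq_iff)
qed

lemma center_d_tensor_invariant: "u \<in> center_d_tensor \<Longrightarrow> diff_act X u = 0"
  by (auto simp: center_d_tensor_eq linear_map_scale[OF linear_diag_act]
      diag_act_tensor[OF bilinear_diff_bracket] linear_map_zero[OF linear_tensor_left]
      linear_map_zero[OF linear_tensor_right])

text \<open>
  With \<open>\<delta> = d/dD\<close> and \<open>\<beta> = -\<alpha>\<close>, iterating \<open>\<sigma>\<close> gives a multiple of
  \<open>1 \<otimes> \<delta>\<^sup>2(x) \<otimes> 1 - 1 \<otimes> 1 \<otimes> \<delta>\<^sup>2(x)\<close>, since \<open>\<sigma>(1) = 0\<close>. The cyclic sum of this tensor is zero.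
\<close>

lemma zeta_bialgebra:
  assumes "\<sigma> \<in> D_d0"
  shows "lie_bialgebra diff_bracket \<sigma>"
proof -
  obtain \<alpha> \<beta> where \<sigma>: "\<sigma> = zeta \<alpha> \<beta>" and skew: "range \<sigma> \<subseteq> skew_tensors"
    using assms by (auto simp: D_d0_def D_d_eq)
  have "zeta \<beta> \<alpha> (basis_vec (0, 2)) = - zeta \<alpha> \<beta> (basis_vec (0, 2))"
    using skew unfolding \<sigma> image_subset_iff skew_tensors_iff twist_zeta by blast
  then have "2 * \<beta> = - (2 * \<alpha>)"
    using symbol2_zeta[of 1 0 \<alpha> \<beta>] symbol2_zeta[of 1 0 \<beta> \<alpha>] by simp
  then have \<beta>: "\<beta> = - \<alpha>" by (metis mult_cancel_left mult_minus_right zero_neq_numeral)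
  have one: "\<sigma> diff_one = 0"
    by (simp add: \<sigma> zeta_eq log_derivation_basis diff_one_def linear_map_zero[OF linear_tensor_left]
        linear_map_zero[OF linear_tensor_right])
  note lin = Der_linear[OF zeta_in_Der, of \<alpha> \<beta>, folded \<sigma>]
  have "cyclic_sum (tensor_map (\<lambda>z. z) \<sigma> (\<sigma> x)) = 0" for x
  proof -
    define z where "z = log_derivation (log_derivation x)"
    have "tensor_map (\<lambda>z. z) \<sigma> (\<sigma> x) = (- \<alpha>) *\<^sub>v (diff_one \<otimes> \<sigma> (log_derivation x))"
      unfolding \<sigma>[unfolded fun_eq_iff zeta_eq, rule_format, of x] \<beta>
      by (simp add: linear_map_add[OF linear_tensor_map] linear_map_diff[OF linear_tensor_map]
          linear_map_scale[OF linear_tensor_map]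
          tensor_map_tensor[OF linear_map_id lin] one linear_map_zero[OF linear_tensor_right])
    also have "\<dots> = (- \<alpha> * \<alpha>) *\<^sub>v (diff_one \<otimes> z \<otimes> diff_one - diff_one \<otimes> diff_one \<otimes> z)"
      by (simp add: \<sigma> zeta_eq \<beta> z_def linear_map_add[OF linear_tensor_right]
          linear_map_diff[OF linear_tensor_right] linear_map_scale[OF linear_tensor_right]
          linear_map_uminus[OF linear_tensor_right] pm.scale_right_diff_distrib)
    finally show ?thesis
      by (simp add: linear_map_scale[OF linear_cyclic_sum] linear_map_diff[OF linear_cyclic_sum]
          linear_map_uminus[OF linear_cyclic_sum]
          cyclic_sum_tensor)
  qed
  then show ?thesis
    unfolding lie_bialgebra_def Let_def cyclic_sum_def
    using lie_algebra_diff lin skew Der_bracket[OF zeta_in_Der, of \<alpha> \<beta>, folded \<sigma>] by blast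
qed

text \<open>
  Symmetrizing \<open>\<Delta> = \<Delta>\<^sub>r + \<sigma>\<close> yields \<open>0 = \<Delta>\<^sub>r\<^sub>+\<^sub>\<tau>\<^sub>r + (\<sigma> + \<tau> \<sigma>)\<close>. Both parts vanish because the sum of inner
  and outer derivations is direct.
\<close>

lemma bialgebra_parts:
  assumes \<Delta>: "lie_bialgebra diff_bracket \<Delta>" and \<sigma>: "\<sigma> \<in> D_d"
    and sum: "\<Delta> = inner_der diff_bracket r + \<sigma>"
  shows "(\<exists>s\<in>skew_tensors. r - s \<in> center_d_tensor) \<and> \<sigma> \<in> D_d0"
proof -
  obtain \<alpha> \<beta> where z: "\<sigma> = zeta \<alpha> \<beta>" using \<sigma> by (auto simp: D_d_eq)
  have skew: "twist (\<Delta> x) + \<Delta> x = 0" for x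
    using \<Delta> by (auto simp: lie_bialgebra_def image_subset_iff skew_tensors_iff)
  have sym: "zeta (\<alpha> + \<beta>) (\<alpha> + \<beta>) x = zeta \<alpha> \<beta> x + zeta \<beta> \<alpha> x" for x
    using fun_cong[OF zeta_add[of \<alpha> \<beta> \<beta> \<alpha>], of x] by (simp add: add.commute)
  have eq: "diff_act x (r + twist r) + zeta (\<alpha> + \<beta>) (\<alpha> + \<beta>) x = 0" for x
    using skew[of x]
    by (simp add: sum z inner_der_def linear_map_add[OF linear_twist] twist_zeta
        twist_diag_act[OF bilinear_diff_bracket] linear_map_add[OF linear_diag_act]
        add_ac sym)
  have "zeta (\<alpha> + \<beta>) (\<alpha> + \<beta>) = (\<lambda>x. diff_act x (- (r + twist r)))"
  proof
    fix x
    show "zeta (\<alpha> + \<beta>) (\<alpha> + \<beta>) x = diff_act x (- (r + twist r))"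
      using eq[of x] unfolding linear_map_uminus[OF linear_diag_act] eq_neg_iff_add_eq_0
      by (simp only: add.commute)
  qed
  then have "zeta (\<alpha> + \<beta>) (\<alpha> + \<beta>) \<in> Inn diff_act \<inter> D_d"
    unfolding Inn_def D_d_eq by blast
  then have 0: "zeta (\<alpha> + \<beta>) (\<alpha> + \<beta>) = 0"
    using Inn_Int_D_d by blast
  have "twist (\<sigma> x) = - \<sigma> x" for x
    using sym[of x] by (simp add: 0 z twist_zeta eq_neg_iff_add_eq_0 add.commute)
  then have "\<sigma> \<in> D_d0"
    using \<sigma> by (auto simp: D_d0_def skew_tensors_iff)
  moreover have "diff_act x (r + twist r) = 0" for x
    using eq[of x] by (simp add: 0)
  then obtain c where c: "r + twist r = c *\<^sub>v (diff_one \<otimes> diff_one)"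
    using diff_invariants2 by blast
  have "(1 / 2) *\<^sub>v (r - twist r) \<in> skew_tensors"
    by (simp add: skew_tensors_iff linear_map_scale[OF linear_twist] linear_map_diff[OF linear_twist]
        flip: pm.scale_minus_right)
  moreover have "r - (1 / 2) *\<^sub>v (r - twist r) = (1 / 2) *\<^sub>v (r + twist r)"
    by (rule poly_mapping_eqI) (simp add: lookup_add lookup_minus field_simps)
  then have "r - (1 / 2) *\<^sub>v (r - twist r) \<in> center_d_tensor"
    unfolding c center_d_tensor_eq pm.scale_scale by blast
  ultimately show ?thesis by blast
qed

lemma triangular_iff_inner:
  assumes \<Delta>: "lie_bialgebra diff_bracket \<Delta>"
  shows "triangular_coboundary diff_bracket \<Delta> \<longleftrightarrow> \<Delta> \<in> Inn diff_act"
proof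
  assume "triangular_coboundary diff_bracket \<Delta>"
  then show "\<Delta> \<in> Inn diff_act"
    by (auto simp: triangular_coboundary_def Inn_def inner_der_def)
next
  assume "\<Delta> \<in> Inn diff_act"
  then obtain v where v: "\<Delta> = inner_der diff_bracket v"
    by (auto simp: Inn_def inner_der_def)
  have "(0 :: diffop \<Rightarrow> _) \<in> D_d" by (simp add: D_d_def fm.span_zero)
  then obtain s where s: "s \<in> skew_tensors" and vs: "v - s \<in> center_d_tensor"
    using bialgebra_parts[OF \<Delta>, of 0 v] v by auto
  have "diff_act x v = diff_act x s" for x
    using center_d_tensor_invariant[OF vs, of x] by (simp add: linear_map_diff[OF linear_diag_act])
  then have \<Delta>s: "\<Delta> = inner_der diff_bracket s"
    by (simp add: v inner_der_def)
  have "cyclic_sum (tensor_map (\<lambda>z. z) \<Delta> (\<Delta> x)) = 0" for x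
    using \<Delta> by (simp add: lie_bialgebra_def Let_def cyclic_sum_def)
  then have "triple_act diff_bracket x (cyb diff_bracket s) = 0" for x
    using co_jacobi_inner[OF lie_algebra_diff s, of x] unfolding \<Delta>s by simp
  then have "cyb diff_bracket s = 0" by (rule invariant_cyb_zero[OF s])
  then show "triangular_coboundary diff_bracket \<Delta>"
    unfolding triangular_coboundary_def using \<Delta> s \<Delta>s by blast
qed

theorem theorem4p4:
  shows
    "(internal_direct_sum (Der diff_bracket diff_act) (Inn diff_act) D_d \<and>
      (\<exists>F. H1_isomorphism diff_bracket diff_act D_d F)) \<and>
     ((\<forall>\<Delta>. lie_bialgebra diff_bracket \<Delta> \<longrightarrow>
        (\<forall>r. \<forall>\<sigma>\<in>D_d. \<Delta> = inner_der diff_bracket r + \<sigma> \<longrightarrow>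
          (\<exists>s\<in>skew_tensors. r - s \<in> center_d_tensor) \<and> \<sigma> \<in> D_d0)) \<and>
      (\<forall>\<sigma>\<in>D_d0. lie_bialgebra diff_bracket \<sigma>)) \<and>
     (\<forall>\<Delta>. lie_bialgebra diff_bracket \<Delta> \<longrightarrow>
        (triangular_coboundary diff_bracket \<Delta> \<longleftrightarrow> \<Delta> \<in> Inn diff_act))"
proof (intro conjI allI impI ballI)
  show "internal_direct_sum (Der diff_bracket diff_act) (Inn diff_act) D_d"
    by (rule Der_direct_sum)
  show "\<exists>F. H1_isomorphism diff_bracket diff_act D_d F"
    by (rule H1_isomorphism_of_complement[OF Der_direct_sum])
qed (use bialgebra_parts zeta_bialgebra triangular_iff_inner in blast)+

end
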